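(* Let $d\in\mathbb{N}$, $0<p<\infty$, $0<q\le\infty$, $\varphi\in\mathcal{G}_p$ with $\varphi(1)=1$, and $s\in\mathbb{R}$ be such that $X:=\mathcal{N}^s_{\varphi,p,q}(\mathbb{R}^d)\subset L_1^{\mathrm{loc}}(\mathbb{R}^d)$. Assume that $$\left\{2^{-js}\varphi(2^{-j})^{-1}\right\}_{j\in\mathbb{N}_0}\notin\ell_{q'},\qquad\text{where } \tfrac1{q'}=\left(1-\tfrac1q\right)_+.$$ If $\lim_{t\to\infty}\varphi(t)t^{-d/p}=0$, then the growth envelope function of $X$ satisfies $$\mathcal{E}_{\mathsf G}^X(t)=\infty,\qquad t>0.$$
   Context: $a_+=\max(a,0)$, $\mathbb{N}_0=\mathbb{N}\cup\{0\}$. $X\subset L_1^{\mathrm{loc}}(\mathbb{R}^d)$ means that every distribution in $X$ is regular. $\mathcal{G}_p$ is the set of all nondecreasing functions $\varphi:(0,\infty)\to(0,\infty)$ such that $t\mapsto \varphi(t)t^{-d/p}$ is nonincreasing. For $\varphi\in\mathcal{G}_p$, the generalised Morrey space $\mathcal{M}_{\varphi,p}(\mathbb{R}^d)$ is the set of all $f\in L_p^{\mathrm{loc}}(\mathbb{R}^d)$ with $$\|f\mid\mathcal{M}_{\varphi,p}(\mathbb{R}^d)\|:=\sup_{Q}\varphi(\ell(Q))\Big(\frac{1}{|Q|}\int_Q|f(y)|^p\,dy\Big)^{1/p}<\infty,$$ the supremum being over all dyadic cubes $Q=2^{-j}([0,1)^d+k)$, $j\in\mathbb{Z}$, $k\in\mathbb{Z}^d$,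 with side length $\ell(Q)$. Let $Q(r)$ be the compact cube centred at $0$ with side length $r$ and sides parallel to the axes. Let $\eta_0,\eta\in\mathcal{S}(\mathbb{R}^d)$ be nonnegative compactly supported functions with $\eta_0>0$ on $Q(2)$, $0\notin\operatorname{supp}\eta$ and $\eta>0$ on $Q(2)\setminus Q(1)$; put $\eta_j(x)=\eta(2^{-j}x)$, $j\in\mathbb{N}$. The generalised Besov-Morrey space $\mathcal{N}^s_{\varphi,p,q}(\mathbb{R}^d)$ is the set of all $f\in\mathcal{S}'(\mathbb{R}^d)$ with $$\|f\mid\mathcal{N}^s_{\varphi,p,q}(\mathbb{R}^d)\|:=\Big(\sum_{j=0}^\infty2^{jsq}\big\|\mathcal{F}^{-1}(\eta_j\mathcal{F}f)\mid\mathcal{M}_{\varphi,p}(\mathbb{R}^d)\big\|^q\Big)^{1/q}<\infty$$ (usual modification if $q=\infty$). Different choices of $\eta_0,\eta$ give equivalent quasi-norms. For measurable $f$ on $\mathbb{R}^d$, finite a.e., $f^*(t)=\inf\{\sigma>0:\ |\{x:|f(x)|>\sigma\}|\le t\}$, $t\ge 0$ (with $\inf\emptyset=\infty$). The growth envelope function of a quasi-normed function space $X$ on $\mathbb{R}^d$ is $\mathcal{E}_{\mathsf G}^{X}(t)=\sup_{\|f\mid X\|\le 1}f^*(t)\in[0,\infty]$, $t>0$. *)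

theory Defs
  imports "HOL-Analysis.Analysis"
begin

definition partial_deriv ::
    "'n::finite \<Rightarrow> (real^'n \<Rightarrow> 'b::real_normed_vector) \<Rightarrow> real^'n \<Rightarrow> 'b" where
  "partial_deriv i f x = frechet_derivative f (at x) (axis i 1)"

text \<open>Multi-indices are lists of coordinate directions, to be differentiated in turn.\<close>

primrec partial_derivs ::
    "'n::finite list \<Rightarrow> (real^'n \<Rightarrow> 'b::real_normed_vector) \<Rightarrow> real^'n \<Rightarrow> 'b" where
  "partial_derivs [] f = f"
| "partial_derivs (i # \<alpha>) f = partial_deriv i (partial_derivs \<alpha> f)"

text \<open>A function is \<open>C\<^sup>\<infinity>\<close> iff all its iterated partial derivatives are (totally) differentiable.\<close>

definition schwartz :: "(real^'n::finite \<Rightarrow> 'b::real_normed_vector) set" where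
  "schwartz = {f. (\<forall>\<alpha> x. partial_derivs \<alpha> f differentiable at x) \<and>
     (\<forall>N \<alpha>. bdd_above (range (\<lambda>x. (1 + norm x) ^ N * norm (partial_derivs \<alpha> f x))))}"

definition schwartz_seminorm ::
    "nat \<Rightarrow> 'n::finite list \<Rightarrow> (real^'n \<Rightarrow> 'b::real_normed_vector) \<Rightarrow> real" where
  "schwartz_seminorm N \<alpha> f = (SUP x. (1 + norm x) ^ N * norm (partial_derivs \<alpha> f x))"

definition fourier :: "(real^'n::finite \<Rightarrow> complex) \<Rightarrow> real^'n \<Rightarrow> complex" where
  "fourier f \<xi> = of_real ((2 * pi) powr (- (real CARD('n) / 2))) *
     (LINT x|lebesgue. exp (- \<i> * of_real (x \<bullet> \<xi>)) * f x)"

definition fourier_inv :: "(real^'n::finite \<Rightarrow> complex) \<Rightarrow> real^'n \<Rightarrow> complex" where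
  "fourier_inv f x = of_real ((2 * pi) powr (- (real CARD('n) / 2))) *
     (LINT \<xi>|lebesgue. exp (\<i> * of_real (x \<bullet> \<xi>)) * f \<xi>)"

text \<open>Distributions are functionals on Schwartz functions, extensional in the sense of
  \<^const>\<open>extensional\<close>. Continuity is stated as an estimate by finitely many seminorms.\<close>

definition tempered_distributions :: "((real^'n::finite \<Rightarrow> complex) \<Rightarrow> complex) set" where
  "tempered_distributions = {T \<in> extensional schwartz.
     (\<forall>\<psi>\<in>schwartz. \<forall>\<theta>\<in>schwartz. T (\<lambda>x. \<psi> x + \<theta> x) = T \<psi> + T \<theta>) \<and>
     (\<forall>c. \<forall>\<psi>\<in>schwartz. T (\<lambda>x. c * \<psi> x) = c * T \<psi>) \<and>
     (\<exists>C N. \<forall>\<psi>\<in>schwartz. norm (T \<psi>) \<le> C * (\<Sum>\<alpha> | length \<alpha> \<le> N. schwartz_seminorm N \<alpha> \<psi>))}"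

definition dist_fourier ::
    "((real^'n::finite \<Rightarrow> complex) \<Rightarrow> complex) \<Rightarrow> (real^'n \<Rightarrow> complex) \<Rightarrow> complex" where
  "dist_fourier T = (\<lambda>\<psi>\<in>schwartz. T (fourier \<psi>))"

definition dist_fourier_inv ::
    "((real^'n::finite \<Rightarrow> complex) \<Rightarrow> complex) \<Rightarrow> (real^'n \<Rightarrow> complex) \<Rightarrow> complex" where
  "dist_fourier_inv T = (\<lambda>\<psi>\<in>schwartz. T (fourier_inv \<psi>))"

definition dist_mult ::
    "(real^'n::finite \<Rightarrow> complex) \<Rightarrow> ((real^'n \<Rightarrow> complex) \<Rightarrow> complex) \<Rightarrow>
      (real^'n \<Rightarrow> complex) \<Rightarrow> complex" where
  "dist_mult g T = (\<lambda>\<psi>\<in>schwartz. T (\<lambda>x. g x * \<psi> x))"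

definition supp :: "('a::topological_space \<Rightarrow> 'b::zero) \<Rightarrow> 'a set" where
  "supp f = closure {x. f x \<noteq> 0}"

definition locally_integrable :: "('a::euclidean_space \<Rightarrow> complex) \<Rightarrow> bool" where
  "locally_integrable f \<longleftrightarrow> (\<forall>K. compact K \<longrightarrow> f absolutely_integrable_on K)"

text \<open>A distribution is tested against compactly supported functions only, since the product of
  a locally integrable function and a general Schwartz function need not be integrable.\<close>

definition represents ::
    "(real^'n::finite \<Rightarrow> complex) \<Rightarrow> ((real^'n \<Rightarrow> complex) \<Rightarrow> complex) \<Rightarrow> bool" where
  "represents f T \<longleftrightarrow> locally_integrable f \<and>
     (\<forall>\<psi>\<in>schwartz. compact (supp \<psi>) \<longrightarrow> T \<psi> = (LINT x|lebesgue. f x * \<psi> x))"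

definition regular :: "((real^'n::finite \<Rightarrow> complex) \<Rightarrow> complex) \<Rightarrow> bool" where
  "regular T \<longleftrightarrow> (\<exists>f. represents f T)"

text \<open>The function representing a regular distribution is unique almost everywhere; the norms
  and rearrangements below do not depend on the choice of the representative.\<close>

definition regular_fun ::
    "((real^'n::finite \<Rightarrow> complex) \<Rightarrow> complex) \<Rightarrow> real^'n \<Rightarrow> complex" where
  "regular_fun T = (SOME f. represents f T)"

text \<open>Only meant for exponents \<open>a > 0\<close>.\<close>

definition enn_powr :: "ennreal \<Rightarrow> real \<Rightarrow> ennreal" where
  "enn_powr x a = (if x = \<infinity> then \<infinity> else ennreal (enn2real x powr a))"

definition lq_norm :: "ennreal \<Rightarrow> (nat \<Rightarrow> ennreal) \<Rightarrow> ennreal" where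
  "lq_norm q a = (if q = \<infinity> then (SUP j. a j)
     else enn_powr (\<Sum>j. enn_powr (a j) (enn2real q)) (1 / enn2real q))"

definition lq_space :: "ennreal \<Rightarrow> (nat \<Rightarrow> real) set" where
  "lq_space q = {a. lq_norm q (\<lambda>j. ennreal \<bar>a j\<bar>) < \<infinity>}"

text \<open>Subtraction of extended nonnegative reals is truncated, so this is
  \<open>1/q' = (1 - 1/q)\<^sub>+\<close>, with \<open>1/\<infinity> = 0\<close> and \<open>1/0 = \<infinity>\<close>; thus \<open>q' = \<infinity>\<close> for \<open>q \<le> 1\<close>.\<close>

definition conj_exponent :: "ennreal \<Rightarrow> ennreal" where
  "conj_exponent q = inverse (1 - inverse q)"

text \<open>The class \<open>\<G>\<^sub>p\<close> for dimension \<open>d\<close>; only the values on \<open>(0,\<infinity>)\<close> matter.\<close>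

definition growth_class :: "nat \<Rightarrow> real \<Rightarrow> (real \<Rightarrow> real) set" where
  "growth_class d p = {\<phi>. (\<forall>t>0. \<phi> t > 0) \<and> mono_on {0<..} \<phi> \<and>
     antimono_on {0<..} (\<lambda>t. \<phi> t * t powr (- (real d / p)))}"

definition dyadic_cube :: "int \<Rightarrow> int^'n::finite \<Rightarrow> (real^'n) set" where
  "dyadic_cube j k = {x. \<forall>i. 2 powi (-j) * of_int (k $ i) \<le> x $ i \<and>
     x $ i < 2 powi (-j) * (of_int (k $ i) + 1)}"

text \<open>For measurable \<open>f\<close>, finiteness of this quantity already forces \<open>f\<close> to be locally in \<open>L\<^sub>p\<close>.\<close>

definition morrey_norm :: "(real \<Rightarrow> real) \<Rightarrow> real \<Rightarrow> (real^'n::finite \<Rightarrow> complex) \<Rightarrow> ennreal" where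
  "morrey_norm \<phi> p f = (SUP (j, k). ennreal (\<phi> (2 powi (-j))) *
     enn_powr ((\<integral>\<^sup>+y\<in>dyadic_cube j k. ennreal (norm (f y) powr p) \<partial>lebesgue) /
       emeasure lebesgue (dyadic_cube j k)) (1 / p))"

definition dist_morrey_norm ::
    "(real \<Rightarrow> real) \<Rightarrow> real \<Rightarrow> ((real^'n::finite \<Rightarrow> complex) \<Rightarrow> complex) \<Rightarrow> ennreal" where
  "dist_morrey_norm \<phi> p T = (if regular T then morrey_norm \<phi> p (regular_fun T) else \<infinity>)"

definition centred_cube :: "real \<Rightarrow> (real^'n::finite) set" where
  "centred_cube r = {x. \<forall>i. \<bar>x $ i\<bar> \<le> r / 2}"

definition resolution_pair :: "(real^'n::finite \<Rightarrow> real) \<Rightarrow> (real^'n \<Rightarrow> real) \<Rightarrow> bool" where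
  "resolution_pair \<eta>0 \<eta> \<longleftrightarrow>
     \<eta>0 \<in> schwartz \<and> \<eta> \<in> schwartz \<and>
     (\<forall>x. \<eta>0 x \<ge> 0) \<and> (\<forall>x. \<eta> x \<ge> 0) \<and>
     compact (supp \<eta>0) \<and> compact (supp \<eta>) \<and>
     (\<forall>x\<in>centred_cube 2. \<eta>0 x > 0) \<and>
     0 \<notin> supp \<eta> \<and>
     (\<forall>x\<in>centred_cube 2 - centred_cube 1. \<eta> x > 0)"

definition resolution ::
    "(real^'n::finite \<Rightarrow> real) \<Rightarrow> (real^'n \<Rightarrow> real) \<Rightarrow> nat \<Rightarrow> real^'n \<Rightarrow> real" where
  "resolution \<eta>0 \<eta> j x = (if j = 0 then \<eta>0 x else \<eta> ((1 / 2 ^ j) *\<^sub>R x))"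

definition besov_morrey_norm ::
    "(real^'n::finite \<Rightarrow> real) \<Rightarrow> (real^'n \<Rightarrow> real) \<Rightarrow> real \<Rightarrow> (real \<Rightarrow> real) \<Rightarrow> real \<Rightarrow> ennreal \<Rightarrow>
      ((real^'n \<Rightarrow> complex) \<Rightarrow> complex) \<Rightarrow> ennreal" where
  "besov_morrey_norm \<eta>0 \<eta> s \<phi> p q T =
     lq_norm q (\<lambda>j. ennreal (2 powr (real j * s)) *
       dist_morrey_norm \<phi> p
         (dist_fourier_inv (dist_mult (\<lambda>\<xi>. of_real (resolution \<eta>0 \<eta> j \<xi>)) (dist_fourier T))))"

definition besov_morrey_space ::
    "(real^'n::finite \<Rightarrow> real) \<Rightarrow> (real^'n \<Rightarrow> real) \<Rightarrow> real \<Rightarrow> (real \<Rightarrow> real) \<Rightarrow> real \<Rightarrow> ennreal \<Rightarrow>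
      ((real^'n \<Rightarrow> complex) \<Rightarrow> complex) set" where
  "besov_morrey_space \<eta>0 \<eta> s \<phi> p q =
     {T \<in> tempered_distributions. besov_morrey_norm \<eta>0 \<eta> s \<phi> p q T < \<infinity>}"

definition rearrangement :: "(real^'n::finite \<Rightarrow> complex) \<Rightarrow> real \<Rightarrow> ennreal" where
  "rearrangement f t =
     Inf {ennreal \<sigma> |\<sigma>. \<sigma> > 0 \<and> emeasure lebesgue {x. norm (f x) > \<sigma>} \<le> ennreal t}"

text \<open>For a space \<open>X\<close> of regular distributions with quasi-norm \<open>nrm\<close>.\<close>

definition growth_envelope ::
    "((real^'n::finite \<Rightarrow> complex) \<Rightarrow> complex) set \<Rightarrow>
      (((real^'n \<Rightarrow> complex) \<Rightarrow> complex) \<Rightarrow> ennreal) \<Rightarrow> real \<Rightarrow> ennreal" where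
  "growth_envelope X nrm t = (SUP T\<in>{T\<in>X. nrm T \<le> 1}. rearrangement (regular_fun T) t)"

end

theory Submission
  imports Defs "HOL-Probability.Sinc_Integral"
begin

text \<open>
  Let \<open>\<psi> = \<F>\<^sup>-\<^sup>1 \<eta>\<close>, whose spectrum lies in an annulus, and \<open>b\<^sub>i = 2\<^bsup>-is\<^esup> \<phi>(2\<^bsup>-i\<^esup>)\<^bsup>-1\<^esup>\<close>. By duality there are
  finitely many coefficients \<open>v\<^sub>i \<ge> 0\<close> with \<open>\<parallel>v\<parallel>\<^sub>q \<le> 1\<close> and \<open>\<Sum> v\<^sub>i b\<^sub>i\<close> as large as desired. The test
  functions are
  \<open>f(x) = \<Sum>\<^sub>i v\<^sub>i b\<^sub>i \<Sum>\<^sub>n \<psi>(2\<^sup>i (x - x\<^sub>n))\<close> with \<open>N\<close> translation points \<open>x\<^sub>n\<close>. Each frequency band sees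
  boundedly many \<open>i\<close>, and since \<open>\<phi>(t) t\<^bsup>-d/p\<^esup> \<rightarrow> 0\<close> the Morrey norm of very sparse translates is
  comparable with that of one of them. So the norm of \<open>f\<close> is bounded independently of \<open>N\<close> and \<open>v\<close>,
  whereas \<open>\<bar>f\<bar>\<close> exceeds a multiple of \<open>\<Sum> v\<^sub>i b\<^sub>i\<close> on \<open>N\<close> disjoint balls whose radius does not depend
  on \<open>N\<close>; for \<open>N\<close> large their total measure exceeds \<open>t\<close>.
\<close>

subsection \<open>Schwartz functions\<close>

text \<open>A single superposition is known to be large only on a ball whose radius shrinks with the
  number of scales, which controls the envelope for small t only. Repeating it enlarges the level
  set at will, and large cubes, which see many copies, are the one place where this could cost norm.
  The order of choices is therefore essential: scales and coefficients from the desired height, the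
  radius from the scales, the number of copies from t and the radius, and last the spacing, which
  may depend on everything before it while the constants in the norm bounds may not. The factor b_i
  is forced: a bump at scale 2^-i has Morrey norm at most a constant times \<phi>(2^-i), so after
  weighting by 2^(is) only v_i remains. Since \<eta> is nonnegative with positive integral,
  \<psi>(0) is positive, and all scales reinforce each other near each x_n although \<psi> may
  oscillate elsewhere. Prescribing the spectrum lets every band be computed exactly through Fourier
  inversion. Norms and rearrangements refer to an arbitrarily selected representative, which is why
  almost everywhere uniqueness of representing functions has to be proved as well.\<close>

lemma partial_derivs_snoc: "partial_derivs (\<alpha> @ [i]) f = partial_derivs \<alpha> (partial_deriv i f)"
  by (induction \<alpha>) auto

text \<open>All iterated derivatives of a member of \<open>S\<close> stay in \<open>S\<close>, so
  one decay bound and one differentiation rule replace Leibniz and chain formulas for multi-indices.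
  Each closure property below amounts to finding a suitable \<open>S\<close>.\<close>

lemma schwartz_coinduct:
  fixes f :: "real^'n::finite \<Rightarrow> 'b::real_normed_vector"
  assumes f: "f \<in> S"
    and diff: "\<And>g x. g \<in> S \<Longrightarrow> g differentiable at x"
    and decay: "\<And>g N. g \<in> S \<Longrightarrow> \<exists>C. \<forall>x. (1 + norm x) ^ N * norm (g x) \<le> C"
    and deriv: "\<And>g i. g \<in> S \<Longrightarrow> partial_deriv i g \<in> S"
  shows "f \<in> schwartz"
proof -
  have S: "partial_derivs \<alpha> g \<in> S" if "g \<in> S" for \<alpha> g
    using that by (induction \<alpha>) (auto intro: deriv)
  have "bdd_above (range (\<lambda>x. (1 + norm x) ^ N * norm (partial_derivs \<alpha> f x)))" for N \<alpha>
    using decay[OF S[OF f]] by (meson bdd_aboveI2)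
  with diff[OF S[OF f]] show ?thesis
    unfolding schwartz_def by auto
qed

lemma schwartz_differentiable: "f \<in> schwartz \<Longrightarrow> f differentiable at x"
  unfolding schwartz_def mem_Collect_eq by (metis partial_derivs.simps(1))

lemma schwartz_partial_deriv: "f \<in> schwartz \<Longrightarrow> partial_deriv i f \<in> schwartz"
  unfolding schwartz_def mem_Collect_eq by (metis partial_derivs_snoc)

lemma schwartz_decay:
  assumes "f \<in> schwartz"
  obtains C where "C \<ge> 0" "\<And>x. (1 + norm x) ^ N * norm (f x) \<le> C"
proof -
  have "bdd_above (range (\<lambda>x. (1 + norm x) ^ N * norm (partial_derivs [] f x)))"
    using assms[unfolded schwartz_def mem_Collect_eq, THEN conjunct2, rule_format] .
  then obtain C where C: "\<And>x. (1 + norm x) ^ N * norm (f x) \<le> C"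
    by (auto simp: bdd_above_def)
  have "0 \<le> (1 + norm (0::real^'a)) ^ N * norm (f 0)" by simp
  with C[of 0] have "C \<ge> 0" by linarith
  with C that show ?thesis by blast
qed

lemma schwartz_continuous: "f \<in> schwartz \<Longrightarrow> continuous_on A f"
  by (simp add: schwartz_differentiable differentiable_imp_continuous_within
      continuous_at_imp_continuous_on)

lemma partial_deriv_eqI: "(f has_derivative f') (at x) \<Longrightarrow> partial_deriv i f x = f' (axis i 1)"
  unfolding partial_deriv_def by (metis frechet_derivative_at)

lemma has_derivative_frechet:
  "f differentiable at x \<Longrightarrow> (f has_derivative frechet_derivative f (at x)) (at x)"
  using frechet_derivative_works by blast

lemma schwartz_zero: "(\<lambda>x. 0) \<in> schwartz"
proof (rule schwartz_coinduct[of _ "{\<lambda>x. 0}"])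
  fix i and g :: "real^'a \<Rightarrow> 'b" assume g: "g \<in> {\<lambda>x. 0}"
  have "partial_deriv i (\<lambda>x::real^'a. 0::'b) = (\<lambda>x. 0)"
    by (rule ext, rule partial_deriv_eqI[where f'="\<lambda>x. 0"]) simp
  with g show "partial_deriv i g \<in> {\<lambda>x. 0}" by simp
qed auto

lemma partial_deriv_add:
  assumes "f differentiable at x" "g differentiable at x"
  shows "partial_deriv i (\<lambda>x. f x + g x) x = partial_deriv i f x + partial_deriv i g x"
  using partial_deriv_eqI[OF has_derivative_add[OF assms[THEN has_derivative_frechet]]]
  by (simp add: partial_deriv_def)

lemma weighted_norm_add_le:
  fixes u v :: "'a::real_normed_vector \<Rightarrow> 'b::real_normed_vector"
  assumes "(1 + norm x) ^ N * norm (u x) \<le> C" "(1 + norm x) ^ N * norm (v x) \<le> D"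
  shows "(1 + norm x) ^ N * norm (u x + v x) \<le> C + D"
proof -
  have "(1 + norm x) ^ N * norm (u x + v x) \<le> (1 + norm x) ^ N * (norm (u x) + norm (v x))"
    by (intro mult_left_mono norm_triangle_ineq) auto
  with assms show ?thesis by (simp add: algebra_simps)
qed

lemma schwartz_add:
  assumes f: "f \<in> schwartz" and g: "g \<in> schwartz"
  shows "(\<lambda>x. f x + g x) \<in> schwartz"
proof -
  let ?S = "{\<lambda>x. u x + v x |u v. u \<in> schwartz \<and> v \<in> schwartz}"
  show ?thesis
  proof (rule schwartz_coinduct[of _ ?S])
    show "(\<lambda>x. f x + g x) \<in> ?S" using f g by blast
  next
    fix h :: "real^'a \<Rightarrow> 'b" and x assume "h \<in> ?S"
    then show "h differentiable at x" by (force intro: differentiable_add schwartz_differentiable)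
  next
    fix h :: "real^'a \<Rightarrow> 'b" and N assume "h \<in> ?S"
    then obtain u v where uv: "u \<in> schwartz" "v \<in> schwartz" and h: "h = (\<lambda>x. u x + v x)" by blast
    obtain C where C: "\<And>x. (1 + norm x) ^ N * norm (u x) \<le> C" by (blast intro: schwartz_decay[OF uv(1), of "N"])
    obtain D where D: "\<And>x. (1 + norm x) ^ N * norm (v x) \<le> D" by (blast intro: schwartz_decay[OF uv(2), of "N"])
    have "(1 + norm x) ^ N * norm (h x) \<le> C + D" for x
      unfolding h using weighted_norm_add_le C D by blast
    then show "\<exists>C. \<forall>x. (1 + norm x) ^ N * norm (h x) \<le> C" by blast
  next
    fix h :: "real^'a \<Rightarrow> 'b" and i assume "h \<in> ?S"
    then obtain u v where uv: "u \<in> schwartz" "v \<in> schwartz" and h: "h = (\<lambda>x. u x + v x)" by blast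
    have "partial_deriv i h = (\<lambda>x. partial_deriv i u x + partial_deriv i v x)"
      unfolding h using uv by (auto intro!: partial_deriv_add schwartz_differentiable)
    with uv show "partial_deriv i h \<in> ?S" by (auto intro: schwartz_partial_deriv)
  qed
qed

lemma schwartz_mult:
  fixes f g :: "real^'n::finite \<Rightarrow> 'b::real_normed_algebra"
  assumes f: "f \<in> schwartz" and g: "g \<in> schwartz"
  shows "(\<lambda>x. f x * g x) \<in> schwartz"
proof -
  \<comment> \<open>The product rule turns one product into a sum of two, so products alone are not
    stable under differentiation. Layer \<open>S n\<close> holds balanced sums of
    \<open>2 ^ n\<close> products; a derivative moves one layer up, and the union of the layers is
    stable.\<close>
  define S :: "nat \<Rightarrow> (real^'n \<Rightarrow> 'b) set" where
    "S = rec_nat {\<lambda>x. u x * v x |u v. u \<in> schwartz \<and> v \<in> schwartz}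
           (\<lambda>_ T. {\<lambda>x. u x + v x |u v. u \<in> T \<and> v \<in> T})"
  have S0: "S 0 = {\<lambda>x. u x * v x |u v. u \<in> schwartz \<and> v \<in> schwartz}"
    and SS: "S (Suc n) = {\<lambda>x. u x + v x |u v. u \<in> S n \<and> v \<in> S n}" for n
    by (auto simp: S_def)
  have S_add: "(\<lambda>x. u x + v x) \<in> S (Suc n)" if "u \<in> S n" "v \<in> S n" for u v n
    unfolding SS mem_Collect_eq by (rule exI[of _ u], rule exI[of _ v]) (simp add: that)
  have diff: "h differentiable at x" if "h \<in> S n" for h n x
    using that
  proof (induction n arbitrary: h)
    case 0 then show ?case by (force simp: S0 intro: differentiable_mult schwartz_differentiable)
  next
    case (Suc n) then show ?case by (auto simp: SS intro!: differentiable_add)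
  qed
  have decay: "\<exists>C. \<forall>x. (1 + norm x) ^ N * norm (h x) \<le> C" if "h \<in> S n" for h n N
    using that
  proof (induction n arbitrary: h)
    case 0
    then obtain u v where uv: "u \<in> schwartz" "v \<in> schwartz" and h: "h = (\<lambda>x. u x * v x)"
      by (auto simp: S0)
    obtain C where C: "C \<ge> 0" "\<And>x. (1 + norm x) ^ N * norm (u x) \<le> C" by (blast intro: schwartz_decay[OF uv(1), of "N"])
    obtain D where D: "D \<ge> 0" "\<And>x. (1 + norm x) ^ 0 * norm (v x) \<le> D" by (blast intro: schwartz_decay[OF uv(2), of "0"])
    have "(1 + norm x) ^ N * norm (h x) \<le> C * D" for x
    proof -
      have "(1 + norm x) ^ N * norm (h x) \<le> (1 + norm x) ^ N * (norm (u x) * norm (v x))"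
        unfolding h by (intro mult_left_mono norm_mult_ineq) auto
      also have "\<dots> \<le> C * D"
        unfolding mult.assoc[symmetric] using C D(1) D(2)[of x] by (intro mult_mono) auto
      finally show ?thesis .
    qed
    then show ?case by blast
  next
    case (Suc n)
    then obtain u v where uv: "u \<in> S n" "v \<in> S n" and h: "h = (\<lambda>x. u x + v x)"
      by (auto simp: SS)
    obtain C D where C: "\<And>x. (1 + norm x) ^ N * norm (u x) \<le> C"
      and D: "\<And>x. (1 + norm x) ^ N * norm (v x) \<le> D"
      using Suc.IH[OF uv(1)] Suc.IH[OF uv(2)] by blast
    have "(1 + norm x) ^ N * norm (h x) \<le> C + D" for x
      unfolding h using weighted_norm_add_le C D by blast
    then show ?case by blast
  qed
  have deriv: "partial_deriv i h \<in> S (Suc n)" if "h \<in> S n" for h n i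
    using that
  proof (induction n arbitrary: h)
    case 0
    then obtain u v where uv: "u \<in> schwartz" "v \<in> schwartz" and h: "h = (\<lambda>x. u x * v x)"
      by (auto simp: S0)
    have "((\<lambda>x. u x * v x) has_derivative (\<lambda>h. u x * frechet_derivative v (at x) h +
        frechet_derivative u (at x) h * v x)) (at x)" for x
      by (intro has_derivative_mult has_derivative_frechet schwartz_differentiable uv)
    from partial_deriv_eqI[OF this]
    have "partial_deriv i h = (\<lambda>x. u x * partial_deriv i v x + partial_deriv i u x * v x)"
      unfolding h by (auto simp: partial_deriv_def)
    moreover have "(\<lambda>x. u x * partial_deriv i v x) \<in> S 0" "(\<lambda>x. partial_deriv i u x * v x) \<in> S 0"
      using uv by (auto simp: S0 intro: schwartz_partial_deriv)
    ultimately show ?case by (simp add: S_add)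
  next
    case (Suc n)
    then obtain u v where uv: "u \<in> S n" "v \<in> S n" and h: "h = (\<lambda>x. u x + v x)"
      by (auto simp: SS)
    have "partial_deriv i h = (\<lambda>x. partial_deriv i u x + partial_deriv i v x)"
      unfolding h using diff[OF uv(1)] diff[OF uv(2)] by (auto intro!: partial_deriv_add)
    with Suc.IH[OF uv(1)] Suc.IH[OF uv(2)] show ?case by (simp add: S_add)
  qed
  show ?thesis
  proof (rule schwartz_coinduct[of _ "\<Union>n. S n"])
    have "(\<lambda>x. f x * g x) \<in> S 0" using f g by (auto simp: S0)
    then show "(\<lambda>x. f x * g x) \<in> (\<Union>n. S n)" by blast
  next
    fix h x assume "h \<in> (\<Union>n. S n)"
    then show "h differentiable at x" using diff by blast
  next
    fix h N assume "h \<in> (\<Union>n. S n)"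
    then show "\<exists>C. \<forall>x. (1 + norm x) ^ N * norm (h x) \<le> C" using decay by blast
  next
    fix h i assume "h \<in> (\<Union>n. S n)"
    then obtain n where "h \<in> S n" by blast
    from deriv[OF this] show "partial_deriv i h \<in> (\<Union>n. S n)" by blast
  qed
qed

lemma schwartz_bounded_linear:
  fixes f :: "real^'n::finite \<Rightarrow> 'b::real_normed_vector"
  assumes f: "f \<in> schwartz" and L: "bounded_linear L"
  shows "(\<lambda>x. L (f x)) \<in> schwartz"
proof -
  let ?S = "{\<lambda>x. L (u x) |u. u \<in> (schwartz :: (real^'n \<Rightarrow> 'b) set)}"
  have der: "((\<lambda>x. L (u x)) has_derivative (\<lambda>h. L (frechet_derivative u (at x) h))) (at x)"
    if "u \<in> schwartz" for u :: "real^'n \<Rightarrow> 'b" and x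
    by (intro bounded_linear.has_derivative[OF L] has_derivative_frechet schwartz_differentiable that)
  show ?thesis
  proof (rule schwartz_coinduct[of _ ?S])
    show "(\<lambda>x. L (f x)) \<in> ?S" using f by blast
  next
    fix h x assume "h \<in> ?S"
    then show "h differentiable at x" using der differentiable_def by blast
  next
    fix h N assume "h \<in> ?S"
    then obtain u where u: "u \<in> schwartz" and h: "h = (\<lambda>x. L (u x))" by blast
    obtain C where C: "\<And>x. (1 + norm x) ^ N * norm (u x) \<le> C" by (blast intro: schwartz_decay[OF u, of "N"])
    obtain K where K: "K \<ge> 0" "\<And>x. norm (L x) \<le> norm x * K"
      using bounded_linear.nonneg_bounded[OF L] by blast
    have "(1 + norm x) ^ N * norm (h x) \<le> C * K" for x
    proof -
      have "(1 + norm x) ^ N * norm (h x) \<le> (1 + norm x) ^ N * (norm (u x) * K)"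
        unfolding h by (intro mult_left_mono K) auto
      also have "\<dots> \<le> C * K"
        unfolding mult.assoc[symmetric] using C K by (intro mult_right_mono) auto
      finally show ?thesis .
    qed
    then show "\<exists>C. \<forall>x. (1 + norm x) ^ N * norm (h x) \<le> C" by blast
  next
    fix h i assume "h \<in> ?S"
    then obtain u where u: "u \<in> schwartz" and h: "h = (\<lambda>x. L (u x))" by blast
    have "partial_deriv i h = (\<lambda>x. L (partial_deriv i u x))"
      unfolding h partial_deriv_def[of i u] by (rule ext, rule partial_deriv_eqI[OF der[OF u]])
    with u show "partial_deriv i h \<in> ?S" by (auto intro: schwartz_partial_deriv)
  qed
qed

lemma schwartz_affine:
  fixes f :: "real^'n::finite \<Rightarrow> 'b::real_normed_vector"
  assumes f: "f \<in> schwartz" and a: "a \<noteq> 0"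
  shows "(\<lambda>x. f (a *\<^sub>R x + b)) \<in> schwartz"
proof -
  \<comment> \<open>The scalar \<open>c\<close> collects the powers of \<open>a\<close> that the
    chain rule produces.\<close>
  let ?S = "{\<lambda>x. c *\<^sub>R u (a *\<^sub>R x + b) |u c. u \<in> (schwartz :: (real^'n \<Rightarrow> 'b) set)}"
  have der: "((\<lambda>x. c *\<^sub>R u (a *\<^sub>R x + b)) has_derivative
      (\<lambda>h. c *\<^sub>R frechet_derivative u (at (a *\<^sub>R x + b)) (a *\<^sub>R h))) (at x)"
    if u: "u \<in> schwartz" for u :: "real^'n \<Rightarrow> 'b" and x c
  proof -
    have "((\<lambda>x. u (a *\<^sub>R x + b)) has_derivative
      (\<lambda>h. frechet_derivative u (at (a *\<^sub>R x + b)) (a *\<^sub>R h))) (at x)"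
      by (rule has_derivative_compose[OF _ has_derivative_frechet[OF schwartz_differentiable[OF u]]])
        (auto intro!: derivative_eq_intros)
    then show ?thesis by (rule has_derivative_scaleR_right)
  qed
  show ?thesis
  proof (rule schwartz_coinduct[of _ ?S])
    have "(\<lambda>x. f (a *\<^sub>R x + b)) = (\<lambda>x. 1 *\<^sub>R f (a *\<^sub>R x + b))" by simp
    with f show "(\<lambda>x. f (a *\<^sub>R x + b)) \<in> ?S" by blast
  next
    fix h x assume "h \<in> ?S"
    then show "h differentiable at x" using der differentiable_def by blast
  next
    fix h N assume "h \<in> ?S"
    then obtain u c where u: "u \<in> schwartz" and h: "h = (\<lambda>x. c *\<^sub>R u (a *\<^sub>R x + b))" by blast
    obtain C where C: "\<And>x. (1 + norm x) ^ N * norm (u x) \<le> C" by (blast intro: schwartz_decay[OF u, of "N"])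
    \<comment> \<open>Compares the weight at \<open>x\<close> with the weight at the transformed
      point, by way of |a| |x| \<le> |a x + b| + |b|.\<close>
    define K where "K = 1 + (1 + norm b) / \<bar>a\<bar>"
    have K: "1 + norm x \<le> K * (1 + norm (a *\<^sub>R x + b))" for x
    proof -
      have "\<bar>a\<bar> * norm x = norm (a *\<^sub>R x + b - b)" by simp
      also have "\<dots> \<le> norm (a *\<^sub>R x + b) + norm b" by (rule norm_triangle_ineq4)
      finally have "norm x \<le> (norm (a *\<^sub>R x + b) + norm b) / \<bar>a\<bar>"
        using a by (simp add: field_simps)
      also have "\<dots> \<le> (1 + norm b) / \<bar>a\<bar> * (1 + norm (a *\<^sub>R x + b))"
        using a by (simp add: field_simps)
      finally have "norm x \<le> (1 + norm b) / \<bar>a\<bar> * (1 + norm (a *\<^sub>R x + b))" .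
      moreover have "1 \<le> 1 * (1 + norm (a *\<^sub>R x + b))" by simp
      ultimately show ?thesis unfolding K_def distrib_right by (rule add_mono[rotated])
    qed
    have "(1 + norm x) ^ N * norm (h x) \<le> K ^ N * \<bar>c\<bar> * C" for x
    proof -
      have "K \<ge> 0" by (simp add: K_def)
      have "(1 + norm x) ^ N * norm (h x)
          \<le> (K * (1 + norm (a *\<^sub>R x + b))) ^ N * (\<bar>c\<bar> * norm (u (a *\<^sub>R x + b)))"
        unfolding h norm_scaleR by (intro mult_right_mono power_mono K) auto
      also have "\<dots> = K ^ N * \<bar>c\<bar> * ((1 + norm (a *\<^sub>R x + b)) ^ N * norm (u (a *\<^sub>R x + b)))"
        by (simp add: power_mult_distrib)
      also have "\<dots> \<le> K ^ N * \<bar>c\<bar> * C"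
        using \<open>K \<ge> 0\<close> by (intro mult_left_mono C) auto
      finally show ?thesis .
    qed
    then show "\<exists>C. \<forall>x. (1 + norm x) ^ N * norm (h x) \<le> C" by blast
  next
    fix h i assume "h \<in> ?S"
    then obtain u c where u: "u \<in> schwartz" and h: "h = (\<lambda>x. c *\<^sub>R u (a *\<^sub>R x + b))" by blast
    have "partial_deriv i h x = (c * a) *\<^sub>R partial_deriv i u (a *\<^sub>R x + b)" for x
      unfolding h partial_deriv_eqI[OF der[OF u]]
      using linear_cmul[OF has_derivative_linear[OF has_derivative_frechet[OF schwartz_differentiable[OF u]]]]
      by (simp add: partial_deriv_def)
    then have "partial_deriv i h = (\<lambda>x. (c * a) *\<^sub>R partial_deriv i u (a *\<^sub>R x + b))" by auto
    with u show "partial_deriv i h \<in> ?S" by (auto intro: schwartz_partial_deriv)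
  qed
qed

lemma schwartz_mult_coord:
  fixes f :: "real^'n::finite \<Rightarrow> 'b::real_normed_vector"
  assumes f: "f \<in> schwartz"
  shows "(\<lambda>x. (x $ j) *\<^sub>R f x) \<in> schwartz"
proof -
  \<comment> \<open>The summand \<open>v\<close> takes up the term without coordinate factor that
    arises when this factor is differentiated.\<close>
  let ?S = "{\<lambda>x. (x $ j) *\<^sub>R u x + v x |u v. u \<in> (schwartz :: (real^'n \<Rightarrow> 'b) set) \<and> v \<in> schwartz}"
  have der: "((\<lambda>x. (x $ j) *\<^sub>R u x + v x) has_derivative
      (\<lambda>h. (x $ j *\<^sub>R frechet_derivative u (at x) h + h $ j *\<^sub>R u x) + frechet_derivative v (at x) h)) (at x)"
    if u: "u \<in> schwartz" "v \<in> schwartz" for u v :: "real^'n \<Rightarrow> 'b" and x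
  proof -
    have "bounded_linear (\<lambda>x::real^'n. x $ j)" by (rule bounded_linear_vec_nth)
    then have "((\<lambda>x. x $ j) has_derivative (\<lambda>h. h $ j)) (at x)"
      by (rule bounded_linear_imp_has_derivative)
    then show ?thesis
      by (intro has_derivative_add has_derivative_scaleR has_derivative_frechet schwartz_differentiable u)
  qed
  show ?thesis
  proof (rule schwartz_coinduct[of _ ?S])
    have "(\<lambda>x. (x $ j) *\<^sub>R f x) = (\<lambda>x. (x $ j) *\<^sub>R f x + 0)" by simp
    with f schwartz_zero show "(\<lambda>x. (x $ j) *\<^sub>R f x) \<in> ?S"
      unfolding mem_Collect_eq by (intro exI[of _ f] exI[of _ "\<lambda>x. 0"]) simp
  next
    fix h x assume "h \<in> ?S"
    then show "h differentiable at x" using der differentiable_def by blast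
  next
    fix h N assume "h \<in> ?S"
    then obtain u v where uv: "u \<in> schwartz" "v \<in> schwartz" and h: "h = (\<lambda>x. (x $ j) *\<^sub>R u x + v x)" by blast
    \<comment> \<open>One extra power of decay of \<open>u\<close> pays for the coordinate
      factor.\<close>
    obtain C where C: "\<And>x. (1 + norm x) ^ Suc N * norm (u x) \<le> C" by (blast intro: schwartz_decay[OF uv(1), of "Suc N"])
    obtain D where D: "\<And>x. (1 + norm x) ^ N * norm (v x) \<le> D" by (blast intro: schwartz_decay[OF uv(2), of "N"])
    have "(1 + norm x) ^ N * norm (h x) \<le> C + D" for x
    proof -
      have 1: "norm ((x $ j) *\<^sub>R u x) \<le> (1 + norm x) * norm (u x)"
        unfolding norm_scaleR using component_le_norm_cart[of x j]
        by (intro mult_right_mono) auto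
      have "norm (h x) \<le> (1 + norm x) * norm (u x) + norm (v x)"
        unfolding h by (rule norm_triangle_le) (use 1 in auto)
      then have "(1 + norm x) ^ N * norm (h x) \<le> (1 + norm x) ^ N * ((1 + norm x) * norm (u x) + norm (v x))"
        by (intro mult_left_mono) auto
      with C[of x] D[of x] show ?thesis by (simp add: algebra_simps)
    qed
    then show "\<exists>C. \<forall>x. (1 + norm x) ^ N * norm (h x) \<le> C" by blast
  next
    fix h i assume "h \<in> ?S"
    then obtain u v where uv: "u \<in> schwartz" "v \<in> schwartz" and h: "h = (\<lambda>x. (x $ j) *\<^sub>R u x + v x)" by blast
    let ?d = "axis i (1::real) $ j"
    have "partial_deriv i h x = x $ j *\<^sub>R partial_deriv i u x + (?d *\<^sub>R u x + partial_deriv i v x)" for x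
      unfolding h partial_deriv_eqI[OF der[OF uv]] by (simp add: partial_deriv_def algebra_simps)
    then have "partial_deriv i h = (\<lambda>x. x $ j *\<^sub>R partial_deriv i u x + (?d *\<^sub>R u x + partial_deriv i v x))"
      by auto
    moreover have "(\<lambda>x. ?d *\<^sub>R u x + partial_deriv i v x) \<in> schwartz"
      by (intro schwartz_add schwartz_bounded_linear[OF uv(1)] bounded_linear_scaleR_right
          schwartz_partial_deriv uv)
    ultimately show "partial_deriv i h \<in> ?S"
      unfolding mem_Collect_eq
      by (intro exI[of _ "partial_deriv i u"] exI[of _ "\<lambda>x. ?d *\<^sub>R u x + partial_deriv i v x"])
        (simp add: schwartz_partial_deriv[OF uv(1)])
  qed
qed

subsection \<open>Integration\<close>

lemma nn_integral_affine:
  fixes f :: "'a::euclidean_space \<Rightarrow> ennreal"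
  assumes [measurable]: "f \<in> borel_measurable borel" and c: "c \<noteq> 0"
  shows "(\<integral>\<^sup>+x. f x \<partial>lborel) = \<bar>c\<bar> ^ DIM('a) * (\<integral>\<^sup>+x. f (t + c *\<^sub>R x) \<partial>lborel)"
  by (subst lborel_affine[OF c, of t])
     (simp add: nn_integral_density nn_integral_distr nn_integral_cmult ennreal_power)

lemma
  fixes f :: "'a::euclidean_space \<Rightarrow> 'b::{banach, second_countable_topology}"
  assumes f: "integrable lborel f" and c: "c \<noteq> 0"
  shows integrable_affine: "integrable lborel (\<lambda>x. f (t + c *\<^sub>R x))"
    and integral_affine: "(\<integral>x. f x \<partial>lborel) = \<bar>c\<bar> ^ DIM('a) *\<^sub>R (\<integral>x. f (t + c *\<^sub>R x) \<partial>lborel)"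
proof -
  have [measurable]: "f \<in> borel_measurable borel"
    using borel_measurable_integrable[OF f] by simp
  show "integrable lborel (\<lambda>x. f (t + c *\<^sub>R x))"
    using f c unfolding integrable_iff_bounded
    by (subst (asm) nn_integral_affine[where c=c and t=t]) (auto simp: ennreal_mult_less_top)
  show "(\<integral>x. f x \<partial>lborel) = \<bar>c\<bar> ^ DIM('a) *\<^sub>R (\<integral>x. f (t + c *\<^sub>R x) \<partial>lborel)"
    by (subst lborel_affine[OF c, of t])
      (simp add: integral_density integral_distr)
qed

text \<open>The exponent provides one factor \<open>(1 + norm x)\<^sup>2\<close> for each
  coordinate, and this factor dominates \<open>1 + (x \<bullet> b)\<^sup>2\<close>. Tonelli then
  leaves a power of the one-dimensional integral of \<open>inverse (1 + x\<^sup>2)\<close>.\<close>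

lemma integrable_power_decay:
  "integrable lborel (\<lambda>x::real^'n::finite. 1 / (1 + norm x) ^ (2 * CARD('n)))"
proof (rule integrableI_bounded)
  show "(\<lambda>x::real^'n. 1 / (1 + norm x) ^ (2 * CARD('n))) \<in> borel_measurable lborel"
    by measurable
  have 1: "(\<integral>\<^sup>+x. ennreal (inverse (1 + x\<^sup>2)) \<partial>lborel) < \<infinity>"
  proof -
    have "integrable lborel (\<lambda>x::real. inverse (1 + x\<^sup>2))"
      using integrable_inverse_1_plus_square unfolding set_integrable_def by simp
    then have "(\<integral>\<^sup>+(x::real). ennreal (norm (inverse (1 + x\<^sup>2))) \<partial>lborel) < \<infinity>"
      unfolding integrable_iff_bounded by (rule conjunct2)
    then show ?thesis by simp
  qed
  have "(\<integral>\<^sup>+x. ennreal (norm (1 / (1 + norm (x::real^'n)) ^ (2 * CARD('n)))) \<partial>lborel)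
      \<le> (\<integral>\<^sup>+(x::real^'n). (\<Prod>b\<in>Basis. ennreal (inverse (1 + (x \<bullet> b)\<^sup>2))) \<partial>lborel)"
  proof (rule nn_integral_mono)
    fix x :: "real^'n"
    have le: "inverse ((1 + norm x)\<^sup>2) \<le> inverse (1 + (x \<bullet> b)\<^sup>2)" if "b \<in> Basis" for b
    proof (rule le_imp_inverse_le)
      have "(x \<bullet> b)\<^sup>2 \<le> (norm x)\<^sup>2"
        using Basis_le_norm[OF that, of x] by (simp add: abs_le_square_iff[symmetric])
      moreover have "(1 + norm x)\<^sup>2 = 1 + 2 * norm x + (norm x)\<^sup>2" by (simp add: power2_sum)
      ultimately show "1 + (x \<bullet> b)\<^sup>2 \<le> (1 + norm x)\<^sup>2" using norm_ge_zero[of x] by linarith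
    qed (simp add: add_pos_nonneg)
    have "1 / (1 + norm x) ^ (2 * CARD('n)) = (\<Prod>b\<in>(Basis::(real^'n) set). inverse ((1 + norm x)\<^sup>2))"
      by (simp add: power_mult[symmetric] divide_inverse power_inverse)
    also have "\<dots> \<le> (\<Prod>b\<in>Basis. inverse (1 + (x \<bullet> b)\<^sup>2))"
      by (intro prod_mono conjI le) auto
    finally have "ennreal (1 / (1 + norm x) ^ (2 * CARD('n))) \<le> ennreal (\<Prod>b\<in>Basis. inverse (1 + (x \<bullet> b)\<^sup>2))"
      by (rule ennreal_leI)
    also have "\<dots> = (\<Prod>b\<in>Basis. ennreal (inverse (1 + (x \<bullet> b)\<^sup>2)))"
      by (subst prod_ennreal) auto
    finally show "ennreal (norm (1 / (1 + norm x) ^ (2 * CARD('n)))) \<le> (\<Prod>b\<in>Basis. ennreal (inverse (1 + (x \<bullet> b)\<^sup>2)))"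
      by simp
  qed
  also have "\<dots> = (\<Prod>b\<in>(Basis::(real^'n) set). (\<integral>\<^sup>+x. ennreal (inverse (1 + x\<^sup>2)) \<partial>lborel))"
    by (rule nn_integral_lborel_prod) auto
  also have "\<dots> < \<infinity>"
    using 1 by (simp add: power_less_top_ennreal)
  finally show "(\<integral>\<^sup>+x. ennreal (norm (1 / (1 + norm (x::real^'n)) ^ (2 * CARD('n)))) \<partial>lborel) < \<infinity>" .
qed

lemma integrable_of_decay:
  fixes f :: "real^'n::finite \<Rightarrow> 'b::{banach, second_countable_topology}"
  assumes f: "f \<in> borel_measurable borel"
    and C: "\<And>x. (1 + norm x) ^ (2 * CARD('n)) * norm (f x) \<le> C"
  shows "integrable lborel f"
proof (rule Bochner_Integration.integrable_bound)
  show "integrable lborel (\<lambda>x::real^'n. C * (1 / (1 + norm x) ^ (2 * CARD('n))))"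
    by (intro integrable_mult_right integrable_power_decay)
  have pos: "(1 + norm x) ^ (2 * CARD('n)) > 0" for x :: "real^'n"
    by (intro zero_less_power) (simp add: add_pos_nonneg)
  have "norm (f x) \<le> norm (C * (1 / (1 + norm x) ^ (2 * CARD('n))))" for x
  proof -
    have "norm (f x) \<le> C * (1 / (1 + norm x) ^ (2 * CARD('n)))"
      using C[of x] pos[of x] by (simp add: field_simps)
    also have "\<dots> \<le> norm \<dots>" by (simp del: times_divide_eq_right)
    finally show ?thesis .
  qed
  then show "AE x in lborel. norm (f x) \<le> norm (C * (1 / (1 + norm x) ^ (2 * CARD('n))))" by simp
qed (use f in simp)

lemma schwartz_measurable [measurable_dest]: "f \<in> schwartz \<Longrightarrow> f \<in> borel_measurable borel"
  by (intro borel_measurable_continuous_onI schwartz_continuous)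

lemma schwartz_integrable:
  fixes f :: "real^'n::finite \<Rightarrow> 'b::{banach, second_countable_topology}"
  assumes "f \<in> schwartz"
  shows "integrable lborel f"
  using schwartz_decay[OF assms, of "2 * CARD('n)"] integrable_of_decay schwartz_measurable[OF assms]
  by blast

lemma schwartz_norm_integrable:
  fixes f :: "real^'n::finite \<Rightarrow> 'b::{banach, second_countable_topology}"
  assumes "f \<in> schwartz"
  shows "integrable lborel (\<lambda>x. norm x * norm (f x))"
proof -
  obtain C where C: "\<And>x. (1 + norm x) ^ Suc (2 * CARD('n)) * norm (f x) \<le> C"
    by (blast intro: schwartz_decay[OF assms, of "Suc (2 * CARD('n))"])
  note [measurable] = schwartz_measurable[OF assms]
  show ?thesis
  proof (rule integrable_of_decay)
    fix x :: "real^'n"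
    have "(1 + norm x) ^ (2 * CARD('n)) * norm (norm x * norm (f x))
        \<le> (1 + norm x) ^ (2 * CARD('n)) * ((1 + norm x) * norm (f x))"
      by (intro mult_left_mono) (auto intro: mult_right_mono)
    also have "\<dots> \<le> C" using C[of x] by (simp add: mult_ac)
    finally show "(1 + norm x) ^ (2 * CARD('n)) * norm (norm x * norm (f x)) \<le> C" .
  qed simp
qed

text \<open>The mean value inequality turns \<open>bnd\<close> into a Lipschitz bound on the ball,
  so the normalised remainder is dominated by \<open>2 * g\<close> and tends to 0 pointwise;
  dominated convergence along sequences concludes. The total derivative is obtained at once, as the
  definition of \<open>schwartz\<close> demands.\<close>

lemma has_derivative_integral:
  fixes K :: "'m \<Rightarrow> 'a::euclidean_space \<Rightarrow> 'b::{banach, second_countable_topology}"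
  assumes r: "r > 0"
    and int: "\<And>t. t \<in> ball t0 r \<Longrightarrow> integrable M (\<lambda>x. K x t)"
    and der: "\<And>x t. t \<in> ball t0 r \<Longrightarrow> (K x has_derivative D x t) (at t)"
    and bnd: "\<And>x t h. t \<in> ball t0 r \<Longrightarrow> norm (D x t h) \<le> g x * norm h"
    and g: "integrable M g"
    and meas: "\<And>h. (\<lambda>x. D x t0 h) \<in> borel_measurable M"
  shows "((\<lambda>t. \<integral>x. K x t \<partial>M) has_derivative (\<lambda>h. \<integral>x. D x t0 h \<partial>M)) (at t0)"
proof -
  have t0: "t0 \<in> ball t0 r" using r by simp
  have intD: "integrable M (\<lambda>x. D x t0 h)" for h
  proof (rule Bochner_Integration.integrable_bound)
    show "integrable M (\<lambda>x. g x * norm h)" using g by simp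
    show "AE x in M. norm (D x t0 h) \<le> norm (g x * norm h)"
      using bnd[OF t0, of _ h] by (intro AE_I2) (simp add: order_trans[OF _ abs_ge_self])
  qed (rule meas)
  have lin: "linear (D x t0)" for x using has_derivative_linear[OF der[OF t0]] .
  have lip: "norm (K x (t0 + h) - K x t0) \<le> g x * norm h" if "h \<in> ball 0 r" for x h
  proof -
    have "norm (K x (t0 + h) - K x t0) \<le> g x * norm (t0 + h - t0)"
    proof (rule differentiable_bound[of "ball t0 r" "K x" "D x"])
      show "(K x has_derivative D x t) (at t within ball t0 r)" if "t \<in> ball t0 r" for t
        using der[OF that] has_derivative_at_withinI by blast
      show "onorm (D x t) \<le> g x" if "t \<in> ball t0 r" for t
        using bnd[OF that, of x] by (rule onorm_le)
    qed (use that r in \<open>auto simp: dist_norm\<close>)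
    then show ?thesis by simp
  qed
  let ?L = "\<lambda>h. \<integral>x. D x t0 h \<partial>M"
  show ?thesis
    unfolding has_derivative_at
  proof
    have bl: "bounded_linear ?L"
    proof (rule linear_conv_bounded_linear[THEN iffD1], rule linearI)
      show "?L (x + y) = ?L x + ?L y" for x y
        using intD by (simp add: linear_add[OF lin])
      show "?L (c *\<^sub>R x) = c *\<^sub>R ?L x" for x c
        using intD by (simp add: linear_cmul[OF lin])
    qed
    show "bounded_linear ?L" by (rule bl)
    show "(\<lambda>h. norm ((\<integral>x. K x (t0 + h) \<partial>M) - (\<integral>x. K x t0 \<partial>M) - ?L h) / norm h) \<midarrow>0\<rightarrow> 0"
      unfolding tendsto_at_iff_sequentially
    proof (intro allI impI)
      fix X :: "nat \<Rightarrow> 'a" assume X: "\<forall>i. X i \<in> UNIV - {0}" "X \<longlonglongrightarrow> 0"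
      have ev: "eventually (\<lambda>i. X i \<in> ball 0 r) sequentially"
        using X(2) r by (intro topological_tendstoD) auto
      \<comment> \<open>Outside the ball the quotient is set to 0, so that measurability and
        domination hold for every \<open>i\<close> and not only eventually.\<close>
      define q where "q i x = (if X i \<in> ball 0 r
          then (1 / norm (X i)) *\<^sub>R (K x (t0 + X i) - K x t0 - D x t0 (X i)) else 0)" for i x
      have int1: "integrable M (\<lambda>x. K x (t0 + h))" if "h \<in> ball 0 r" for h
        using that by (intro int) (auto simp: dist_norm)
      have "(\<lambda>i. \<integral>x. q i x \<partial>M) \<longlonglongrightarrow> (\<integral>x. 0 \<partial>M)"
      proof (rule integral_dominated_convergence[where w="\<lambda>x. 2 * g x"])
        show "q i \<in> borel_measurable M" for i
        proof (cases "X i \<in> ball 0 r")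
          case True
          note [measurable] = borel_measurable_integrable[OF int1[OF True]]
            borel_measurable_integrable[OF int[OF t0]] meas
          have "q i = (\<lambda>x. (1 / norm (X i)) *\<^sub>R (K x (t0 + X i) - K x t0 - D x t0 (X i)))"
            using True by (auto simp: q_def)
          then show ?thesis by simp
        next
          case False
          then have "q i = (\<lambda>x. 0)" by (auto simp: q_def)
          then show ?thesis by simp
        qed
        show "AE x in M. norm (q i x) \<le> 2 * g x" for i
        proof (rule AE_I2)
          fix x
          show "norm (q i x) \<le> 2 * g x"
          proof (cases "X i \<in> ball 0 r")
            case True
            have "norm (K x (t0 + X i) - K x t0 - D x t0 (X i)) \<le> g x * norm (X i) + g x * norm (X i)"
              by (rule order_trans[OF norm_triangle_ineq4]) (intro add_mono lip[OF True] bnd[OF t0])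
            moreover have "norm (X i) > 0" using X(1) by auto
            ultimately have "norm (K x (t0 + X i) - K x t0 - D x t0 (X i)) / norm (X i) \<le> 2 * g x"
              by (simp add: divide_le_eq)
            then show ?thesis
              using True by (simp add: q_def del: scaleR_diff_right)
          next
            case False
            \<comment> \<open>Nonnegativity of \<open>g\<close> is read off from \<open>bnd\<close>
              at a basis vector, whose norm is 1.\<close>
            have "0 \<le> norm (D x t0 (SOME b. b \<in> Basis))" by simp
            also have "\<dots> \<le> g x * norm (SOME b::'a. b \<in> Basis)" by (rule bnd[OF t0])
            finally have "0 \<le> g x" by (simp add: SOME_Basis)
            with False show ?thesis by (simp add: q_def)
          qed
        qed
        show "AE x in M. (\<lambda>i. q i x) \<longlonglongrightarrow> 0"
        proof (rule AE_I2)
          fix x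
          have "(\<lambda>h. norm (K x (t0 + h) - K x t0 - D x t0 h) / norm h) \<midarrow>0\<rightarrow> 0"
            using der[OF t0, of x] unfolding has_derivative_at by blast
          then have "(\<lambda>i. norm (K x (t0 + X i) - K x t0 - D x t0 (X i)) / norm (X i)) \<longlonglongrightarrow> 0"
            using X unfolding tendsto_at_iff_sequentially by (auto simp: comp_def)
          then have "(\<lambda>i. norm (q i x)) \<longlonglongrightarrow> 0"
            by (rule Lim_transform_eventually)
              (use ev in eventually_elim, auto simp: q_def)
          then show "(\<lambda>i. q i x) \<longlonglongrightarrow> 0" by (rule tendsto_norm_zero_cancel)
        qed
      qed (use g in simp_all)
      then have "(\<lambda>i. norm (\<integral>x. q i x \<partial>M)) \<longlonglongrightarrow> 0"
        using tendsto_norm_zero by simp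
      then show "((\<lambda>h. norm ((\<integral>x. K x (t0 + h) \<partial>M) - (\<integral>x. K x t0 \<partial>M) - ?L h) / norm h) \<circ> X) \<longlonglongrightarrow> 0"
      proof (rule Lim_transform_eventually)
        show "\<forall>\<^sub>F i in sequentially. norm (\<integral>x. q i x \<partial>M) =
            ((\<lambda>h. norm ((\<integral>x. K x (t0 + h) \<partial>M) - (\<integral>x. K x t0 \<partial>M) - ?L h) / norm h) \<circ> X) i"
          using ev
        proof eventually_elim
          case (elim i)
          have "(\<integral>x. q i x \<partial>M) = (1 / norm (X i)) *\<^sub>R
              ((\<integral>x. K x (t0 + X i) \<partial>M) - (\<integral>x. K x t0 \<partial>M) - ?L (X i))"
            using elim int1[OF elim] int[OF t0] intD[of "X i"] by (simp add: q_def)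
          then show ?case by simp
        qed
      qed
    qed
  qed
qed

lemma frechet_derivative_expand:
  fixes f :: "real^'n::finite \<Rightarrow> 'b::real_normed_vector"
  assumes "f differentiable at x"
  shows "frechet_derivative f (at x) h = (\<Sum>i\<in>UNIV. (h $ i) *\<^sub>R partial_deriv i f x)"
proof -
  have lin: "linear (frechet_derivative f (at x))"
    using assms by (rule linear_frechet_derivative)
  have "h = (\<Sum>i\<in>UNIV. (h $ i) *\<^sub>R axis i 1)"
    using basis_expansion[of h] by (simp add: scalar_mult_eq_scaleR)
  then have "frechet_derivative f (at x) h = frechet_derivative f (at x) (\<Sum>i\<in>UNIV. (h $ i) *\<^sub>R axis i 1)"
    by simp
  then show ?thesis
    by (simp add: linear_sum[OF lin] linear_cmul[OF lin] partial_deriv_def)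
qed

text \<open>By translation invariance the integral of \<open>f (x + t)\<close> over \<open>x\<close>
  does not depend on \<open>t\<close>, and its derivative at \<open>t = 0\<close> in direction
  \<open>axis i 1\<close> is the integral in question. This takes the place of integration by
  parts.\<close>

lemma integral_partial_deriv_schwartz:
  fixes f :: "real^'n::finite \<Rightarrow> complex"
  assumes f: "f \<in> schwartz"
  shows "(\<integral>x. partial_deriv i f x \<partial>lborel) = 0"
proof -
  let ?d = "2 * CARD('n)"
  have "\<exists>C\<ge>0. \<forall>x. (1 + norm x) ^ ?d * norm (partial_deriv j f x) \<le> C" for j
    by (rule schwartz_decay[OF schwartz_partial_deriv[OF f], of ?d j]) blast
  then obtain C where C: "\<And>j. C j \<ge> 0" "\<And>j x. (1 + norm x) ^ ?d * norm (partial_deriv j f x) \<le> C j"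
    by metis
  define B where "B = (\<Sum>j\<in>UNIV. C j)"
  have D: "norm (frechet_derivative f (at x) h) \<le> B / (1 + norm x) ^ ?d * norm h" for x h
  proof -
    have pos: "(1 + norm x) ^ ?d > 0" by (intro zero_less_power) (simp add: add_pos_nonneg)
    have "norm (frechet_derivative f (at x) h) \<le> (\<Sum>j\<in>UNIV. norm ((h $ j) *\<^sub>R partial_deriv j f x))"
      unfolding frechet_derivative_expand[OF schwartz_differentiable[OF f]] by (rule norm_sum)
    also have "\<dots> \<le> (\<Sum>j\<in>UNIV. norm h * (C j / (1 + norm x) ^ ?d))"
      unfolding norm_scaleR using C pos component_le_norm_cart[of h]
      by (intro sum_mono mult_mono) (auto simp: field_simps)
    also have "\<dots> = B / (1 + norm x) ^ ?d * norm h"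
      by (simp add: B_def sum_distrib_left[symmetric] sum_divide_distrib[symmetric])
    finally show ?thesis .
  qed
  have trans: "(\<integral>x. f (x + t) \<partial>lborel) = (\<integral>x. f x \<partial>lborel)" for t
    using integral_affine[OF schwartz_integrable[OF f], of 1 t] by (simp add: add.commute)
  have "((\<lambda>t. \<integral>x. f (x + t) \<partial>lborel) has_derivative
      (\<lambda>h. \<integral>x. frechet_derivative f (at (x + 0)) h \<partial>lborel)) (at 0)"
  proof (rule has_derivative_integral[where r=1 and D="\<lambda>x t. frechet_derivative f (at (x + t))"
        and g="\<lambda>x. B * 2 ^ ?d * (1 / (1 + norm x) ^ ?d)"])
    show "integrable lborel (\<lambda>x. f (x + t))" for t
      using integrable_affine[OF schwartz_integrable[OF f], of 1 t] by (simp add: add.commute)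
    show "((\<lambda>t. f (x + t)) has_derivative frechet_derivative f (at (x + t))) (at t)" for x t
    proof -
      have "((\<lambda>t. f (x + t)) has_derivative (\<lambda>h. frechet_derivative f (at (x + t)) h)) (at t)"
        by (rule has_derivative_compose[OF _ has_derivative_frechet[OF schwartz_differentiable[OF f]]])
          (auto intro!: derivative_eq_intros)
      then show ?thesis .
    qed
    show "norm (frechet_derivative f (at (x + t)) h) \<le> B * 2 ^ ?d * (1 / (1 + norm x) ^ ?d) * norm h"
      if "t \<in> ball 0 1" for x t h :: "real^'n"
    proof -
      have "norm x \<le> norm (x + t) + norm t" by (metis add_diff_cancel norm_triangle_ineq4)
      moreover have "norm t < 1" using that by simp
      \<comment> \<open>A shift by less than 1 changes the weight by at most the factor 2; hence the
        factor \<open>2 ^ ?d\<close> in a majorant that does not depend on \<open>t\<close>.\<close>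
      ultimately have "1 + norm x \<le> 2 * (1 + norm (x + t))"
        using norm_ge_zero[of "x + t"] unfolding distrib_left by linarith
      then have le: "(1 + norm x) ^ ?d \<le> 2 ^ ?d * (1 + norm (x + t)) ^ ?d"
        unfolding power_mult_distrib[symmetric] by (intro power_mono) auto
      have pos: "(1 + norm y) ^ ?d > 0" for y :: "real^'n"
        by (intro zero_less_power) (simp add: add_pos_nonneg)
      have "1 / (1 + norm (x + t)) ^ ?d \<le> 2 ^ ?d * (1 / (1 + norm x) ^ ?d)"
        using le pos[of x] pos[of "x + t"] by (simp add: field_simps)
      then have "B * (1 / (1 + norm (x + t)) ^ ?d) * norm h \<le> B * (2 ^ ?d * (1 / (1 + norm x) ^ ?d)) * norm h"
        using C(1) by (intro mult_right_mono mult_left_mono) (auto simp: B_def intro: sum_nonneg)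
      with D[of "x + t" h] show ?thesis by (simp add: mult_ac)
    qed
    show "integrable lborel (\<lambda>x::real^'n. B * 2 ^ ?d * (1 / (1 + norm x) ^ ?d))"
      by (intro integrable_mult_right integrable_power_decay)
    show "(\<lambda>x. frechet_derivative f (at (x + 0)) h) \<in> borel_measurable lborel" for h
    proof -
      have [measurable]: "partial_deriv j f \<in> borel_measurable borel" for j
        by (rule schwartz_measurable[OF schwartz_partial_deriv[OF f]])
      show ?thesis
        unfolding frechet_derivative_expand[OF schwartz_differentiable[OF f]] by simp
    qed
  qed simp
  then have "((\<lambda>t::real^'n. \<integral>x. f x \<partial>lborel) has_derivative
      (\<lambda>h. \<integral>x. frechet_derivative f (at (x + 0)) h \<partial>lborel)) (at 0)"
    unfolding trans .
  from has_derivative_unique[OF this has_derivative_const]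
  have "(\<integral>x. frechet_derivative f (at x) (axis i 1) \<partial>lborel) = 0" by (auto dest: fun_cong)
  then show ?thesis by (simp add: partial_deriv_def)
qed

lemma integrable_kernel:
  fixes u v :: "'a::euclidean_space \<Rightarrow> complex"
  assumes u: "integrable lborel u" and v: "integrable lborel v"
    and [measurable]: "(\<lambda>(x, y). k x y) \<in> borel_measurable borel"
    and k: "\<And>x y. norm (k x y) \<le> B"
  shows "integrable (lborel \<Otimes>\<^sub>M lborel) (\<lambda>(x, y). u x * k x y * v y)"
proof -
  have [measurable]: "u \<in> borel_measurable borel" "v \<in> borel_measurable borel"
    using borel_measurable_integrable[OF u] borel_measurable_integrable[OF v] by auto
  have k'[measurable]: "(\<lambda>(x, y). k x y) \<in> borel_measurable (borel \<Otimes>\<^sub>M borel)"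
    by (simp add: borel_prod)
  have int: "integrable (lborel \<Otimes>\<^sub>M lborel) (\<lambda>(x, y). u x * v y)"
  proof (rule lborel_pair.Fubini_integrable)
    show "integrable lborel (\<lambda>x. \<integral>y. norm (case (x, y) of (x, y) \<Rightarrow> u x * v y) \<partial>lborel)"
      using u by (simp add: norm_mult)
  qed (use v in \<open>auto simp: case_prod_unfold\<close>)
  show ?thesis
  proof (rule Bochner_Integration.integrable_bound)
    show "integrable (lborel \<Otimes>\<^sub>M lborel) (\<lambda>z. B * norm (case z of (x, y) \<Rightarrow> u x * v y))"
      using int by simp
    have "norm (u x * k x y * v y) \<le> norm (B * norm (u x * v y))" for x y
    proof -
      have "norm (u x * k x y * v y) = norm (k x y) * norm (u x * v y)" by (simp add: norm_mult)
      also have "\<dots> \<le> B * norm (u x * v y)" by (intro mult_right_mono k) auto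
      also have "\<dots> \<le> norm (B * norm (u x * v y))" unfolding real_norm_def by (rule abs_ge_self)
      finally show ?thesis .
    qed
    then show "AE z in lborel \<Otimes>\<^sub>M lborel. norm (case z of (x, y) \<Rightarrow> u x * k x y * v y)
        \<le> norm (B * norm (case z of (x, y) \<Rightarrow> u x * v y))"
      by (intro AE_I2) (auto simp: case_prod_unfold)
  qed measurable
qed

text \<open>Serves two purposes: with characters as kernels it gives the multiplication formulas of
  the Fourier transform, with rescaled mollifiers it drives the proof that representing functions
  are unique.\<close>

lemma integral_kernel_swap:
  fixes u v :: "'a::euclidean_space \<Rightarrow> complex"
  assumes "integrable lborel u" "integrable lborel v"
    and "(\<lambda>(x, y). k x y) \<in> borel_measurable borel"
    and "\<And>x y. norm (k x y) \<le> B"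
  shows "(\<integral>x. u x * (\<integral>y. k x y * v y \<partial>lborel) \<partial>lborel) = (\<integral>y. (\<integral>x. u x * k x y \<partial>lborel) * v y \<partial>lborel)"
proof -
  have "(\<integral>y. (\<integral>x. u x * k x y * v y \<partial>lborel) \<partial>lborel) = (\<integral>x. (\<integral>y. u x * k x y * v y \<partial>lborel) \<partial>lborel)"
    by (rule lborel_pair.Fubini_integral[OF integrable_kernel[OF assms]])
  then show ?thesis
    by (simp add: mult.assoc flip: integral_mult_left_zero integral_mult_right_zero)
qed

subsection \<open>The Fourier transform of Schwartz functions\<close>

abbreviation fourier_const :: "'n::finite itself \<Rightarrow> complex" where
  "fourier_const _ \<equiv> of_real ((2 * pi) powr (- (real CARD('n) / 2)))"

text \<open>Passes to \<open>lborel\<close>, where the substitution and Fubini lemmas above live,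
  and to \<open>cis\<close>, which makes the modulus 1 of the kernel visible.\<close>

lemma fourier_eq_lborel:
  fixes u :: "real^'n::finite \<Rightarrow> complex"
  assumes [measurable]: "u \<in> borel_measurable borel"
  shows "fourier u \<xi> = fourier_const TYPE('n) * (\<integral>x. cis (- (x \<bullet> \<xi>)) * u x \<partial>lborel)"
proof -
  have "(\<lambda>x. cis (- (x \<bullet> \<xi>)) * u x) \<in> borel_measurable lborel"
    unfolding cis_conv_exp by measurable
  from integral_completion[OF this] show ?thesis
    unfolding fourier_def by (simp add: cis_conv_exp)
qed

lemma fourier_inv_eq_fourier: "fourier_inv u x = fourier u (- x)"
  unfolding fourier_inv_def fourier_def by (simp add: inner_commute)

lemma fourier_inv_eq_lborel:
  fixes u :: "real^'n::finite \<Rightarrow> complex"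
  assumes "u \<in> borel_measurable borel"
  shows "fourier_inv u x = fourier_const TYPE('n) * (\<integral>\<xi>. cis (x \<bullet> \<xi>) * u \<xi> \<partial>lborel)"
  unfolding fourier_inv_eq_fourier fourier_eq_lborel[OF assms] by (simp add: inner_commute)

lemma has_derivative_cis_inner:
  fixes x \<xi> :: "'a::real_inner"
  shows "((\<lambda>x. cis (- (x \<bullet> \<xi>))) has_derivative (\<lambda>h. - \<i> * of_real (h \<bullet> \<xi>) * cis (- (x \<bullet> \<xi>)))) (at x)"
proof -
  have "((\<lambda>x. \<i> * of_real (- (x \<bullet> \<xi>))) has_derivative (\<lambda>h. \<i> * of_real (- (h \<bullet> \<xi>)))) (at x)"
    by (auto intro!: derivative_eq_intros)
  from has_derivative_compose[OF this DERIV_exp[unfolded has_field_derivative_def]]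
  show ?thesis unfolding cis_conv_exp by (simp add: mult_ac)
qed

text \<open>Differentiating the character only produces a constant factor, so the products of this
  one character with Schwartz functions are closed under derivatives. The kernel of the inverse
  transform is the instance \<open>- \<xi>\<close>.\<close>

lemma schwartz_modulation:
  fixes f :: "real^'n::finite \<Rightarrow> complex"
  assumes f: "f \<in> schwartz"
  shows "(\<lambda>x. cis (- (x \<bullet> \<xi>)) * f x) \<in> schwartz"
proof -
  let ?S = "{\<lambda>x. cis (- (x \<bullet> \<xi>)) * u x |u. u \<in> (schwartz :: (real^'n \<Rightarrow> complex) set)}"
  have der: "((\<lambda>x. cis (- (x \<bullet> \<xi>)) * u x) has_derivative
      (\<lambda>h. cis (- (x \<bullet> \<xi>)) * frechet_derivative u (at x) h +
        - \<i> * of_real (h \<bullet> \<xi>) * cis (- (x \<bullet> \<xi>)) * u x)) (at x)"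
    if "u \<in> schwartz" for u :: "real^'n \<Rightarrow> complex" and x
    by (intro has_derivative_mult has_derivative_cis_inner has_derivative_frechet schwartz_differentiable that)
  show ?thesis
  proof (rule schwartz_coinduct[of _ ?S])
    show "(\<lambda>x. cis (- (x \<bullet> \<xi>)) * f x) \<in> ?S" using f by blast
  next
    fix h x assume "h \<in> ?S"
    then show "h differentiable at x" using der differentiable_def by blast
  next
    fix h N assume "h \<in> ?S"
    then obtain u where u: "u \<in> schwartz" and h: "h = (\<lambda>x. cis (- (x \<bullet> \<xi>)) * u x)" by blast
    obtain C where "\<And>x. (1 + norm x) ^ N * norm (u x) \<le> C" by (blast intro: schwartz_decay[OF u, of N])
    then show "\<exists>C. \<forall>x. (1 + norm x) ^ N * norm (h x) \<le> C"
      unfolding h norm_mult norm_cis by auto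
  next
    fix h i assume "h \<in> ?S"
    then obtain u where u: "u \<in> schwartz" and h: "h = (\<lambda>x. cis (- (x \<bullet> \<xi>)) * u x)" by blast
    define v where "v = (\<lambda>x. partial_deriv i u x + (- \<i> * of_real (\<xi> $ i)) * u x)"
    have "v \<in> schwartz"
      unfolding v_def by (intro schwartz_add schwartz_partial_deriv u
          schwartz_bounded_linear[OF u bounded_linear_mult_right])
    moreover have "partial_deriv i h = (\<lambda>x. cis (- (x \<bullet> \<xi>)) * v x)"
      unfolding h partial_deriv_eqI[OF der[OF u]] fun_eq_iff
      by (simp add: v_def partial_deriv_def inner_axis' algebra_simps)
    ultimately show "partial_deriv i h \<in> ?S" by blast
  qed
qed

lemma norm_fourier_le:
  fixes f :: "real^'n::finite \<Rightarrow> complex"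
  assumes f: "integrable lborel f"
  shows "norm (fourier f \<xi>) \<le> norm (fourier_const TYPE('n)) * (\<integral>x. norm (f x) \<partial>lborel)"
proof -
  have "norm (\<integral>x. cis (- (x \<bullet> \<xi>)) * f x \<partial>lborel) \<le> (\<integral>x. norm (cis (- (x \<bullet> \<xi>)) * f x) \<partial>lborel)"
    by (rule integral_norm_bound)
  also have "\<dots> = (\<integral>x. norm (f x) \<partial>lborel)" by (simp add: norm_mult)
  finally show ?thesis
    using borel_measurable_integrable[OF f]
    by (simp add: fourier_eq_lborel norm_mult mult_left_mono)
qed

text \<open>The derivative of character times \<open>f\<close> integrates to 0, and the product rule
  splits this integral into the two sides of the formula.\<close>

lemma fourier_partial_deriv:
  fixes f :: "real^'n::finite \<Rightarrow> complex"
  assumes f: "f \<in> schwartz"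
  shows "fourier (partial_deriv i f) \<xi> = \<i> * of_real (\<xi> $ i) * fourier f \<xi>"
proof -
  let ?e = "\<lambda>x. cis (- (x \<bullet> \<xi>))"
  have 1: "partial_deriv i (\<lambda>x. ?e x * f x) x = ?e x * partial_deriv i f x - \<i> * of_real (\<xi> $ i) * (?e x * f x)" for x
    using partial_deriv_eqI[OF has_derivative_mult[OF has_derivative_cis_inner
          has_derivative_frechet[OF schwartz_differentiable[OF f]]], of i \<xi> x]
    by (simp add: partial_deriv_def inner_axis' algebra_simps)
  have i1: "integrable lborel (\<lambda>x. ?e x * partial_deriv i f x)"
    and i2: "integrable lborel (\<lambda>x. ?e x * f x)"
    by (intro schwartz_integrable schwartz_modulation schwartz_partial_deriv f)+
  have "0 = (\<integral>x. ?e x * partial_deriv i f x \<partial>lborel) - \<i> * of_real (\<xi> $ i) * (\<integral>x. ?e x * f x \<partial>lborel)"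
    using integral_partial_deriv_schwartz[OF schwartz_modulation[OF f, of \<xi>], of i] i1 i2
    unfolding 1 by simp
  then show ?thesis
    using schwartz_measurable[OF f] schwartz_measurable[OF schwartz_partial_deriv[OF f]]
    by (simp add: fourier_eq_lborel)
qed

lemma has_derivative_fourier:
  fixes f :: "real^'n::finite \<Rightarrow> complex"
  assumes f: "f \<in> schwartz"
  shows "(fourier f has_derivative
      (\<lambda>h. fourier_const TYPE('n) * (\<integral>x. - \<i> * of_real (h \<bullet> x) * cis (- (x \<bullet> \<xi>)) * f x \<partial>lborel))) (at \<xi>)"
proof -
  note [measurable] = schwartz_measurable[OF f]
  have "((\<lambda>\<xi>. \<integral>x. cis (- (\<xi> \<bullet> x)) * f x \<partial>lborel) has_derivative
     (\<lambda>h. \<integral>x. - \<i> * of_real (h \<bullet> x) * cis (- (\<xi> \<bullet> x)) * f x \<partial>lborel)) (at \<xi>)"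
  proof (rule has_derivative_integral[where r=1 and g="\<lambda>x. norm x * norm (f x)"])
    show "integrable lborel (\<lambda>x. cis (- (\<xi> \<bullet> x)) * f x)" for \<xi>
      using schwartz_integrable[OF schwartz_modulation[OF f, of \<xi>]] by (simp add: inner_commute)
    show "((\<lambda>\<xi>. cis (- (\<xi> \<bullet> x)) * f x) has_derivative
        (\<lambda>h. - \<i> * of_real (h \<bullet> x) * cis (- (\<xi> \<bullet> x)) * f x)) (at \<xi>)" for x \<xi>
      by (intro has_derivative_mult_left has_derivative_cis_inner)
    show "norm (- \<i> * of_real (h \<bullet> x) * cis (- (\<xi> \<bullet> x)) * f x) \<le> norm x * norm (f x) * norm h" for x \<xi> h
    proof -
      have "norm (- \<i> * of_real (h \<bullet> x) * cis (- (\<xi> \<bullet> x)) * f x) = \<bar>h \<bullet> x\<bar> * norm (f x)"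
        by (simp add: norm_mult)
      also have "\<dots> \<le> (norm h * norm x) * norm (f x)"
        by (intro mult_right_mono Cauchy_Schwarz_ineq2) auto
      finally show ?thesis by (simp add: mult_ac)
    qed
    show "(\<lambda>x. - \<i> * of_real (h \<bullet> x) * cis (- (\<xi> \<bullet> x)) * f x) \<in> borel_measurable lborel" for h
      unfolding cis_conv_exp by measurable
  qed (use schwartz_norm_integrable[OF f] in simp_all)
  from has_derivative_mult_right[OF this, of "fourier_const TYPE('n)"]
  show ?thesis
    unfolding fourier_eq_lborel[OF schwartz_measurable[OF f], abs_def] by (simp add: inner_commute)
qed

lemma schwartz_fourier:
  fixes f :: "real^'n::finite \<Rightarrow> complex"
  assumes f: "f \<in> schwartz"
  shows "fourier f \<in> schwartz"
proof -
  let ?S = "fourier ` (schwartz :: (real^'n \<Rightarrow> complex) set)"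
  show ?thesis
  proof (rule schwartz_coinduct[of _ ?S])
    show "fourier f \<in> ?S" using f by blast
  next
    fix h x assume "h \<in> ?S"
    then show "h differentiable at x" using has_derivative_fourier differentiable_def by blast
  next
    fix h N assume "h \<in> ?S"
    then obtain u where "u \<in> schwartz" and h: "h = fourier u" by blast
    then show "\<exists>C. \<forall>x. (1 + norm x) ^ N * norm (h x) \<le> C"
    \<comment> \<open>One power of the weight is traded for one derivative of \<open>u\<close>,
      since the norm is at most the sum of the absolute coordinates and each coordinate is absorbed
      by \<open>fourier_partial_deriv\<close>. Hence \<open>u\<close> must vary in the
      induction.\<close>
    proof (induction N arbitrary: u h)
      case 0
      then show ?case using norm_fourier_le[OF schwartz_integrable] by auto
    next
      case (Suc N)
      have "\<exists>C. \<forall>x. (1 + norm x) ^ N * norm (fourier (partial_deriv i u) x) \<le> C" for i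
        by (rule Suc.IH[OF schwartz_partial_deriv[OF Suc.prems(1)] refl])
      then obtain C where C: "\<And>i x. (1 + norm x) ^ N * norm (fourier (partial_deriv i u) x) \<le> C i" by metis
      obtain D where D: "\<And>x. (1 + norm x) ^ N * norm (fourier u x) \<le> D"
        using Suc.IH[OF Suc.prems(1) refl] by blast
      have "(1 + norm x) ^ Suc N * norm (h x) \<le> D + (\<Sum>i\<in>UNIV. C i)" for x
      proof -
        have "(1 + norm x) ^ Suc N * norm (h x) =
            (1 + norm x) ^ N * norm (fourier u x) + norm x * ((1 + norm x) ^ N * norm (fourier u x))"
          by (simp add: Suc.prems(2) algebra_simps)
        also have "\<dots> \<le> D + (\<Sum>i\<in>UNIV. \<bar>x $ i\<bar>) * ((1 + norm x) ^ N * norm (fourier u x))"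
          by (intro add_mono D mult_right_mono norm_le_l1_cart) auto
        also have "(\<Sum>i\<in>UNIV. \<bar>x $ i\<bar>) * ((1 + norm x) ^ N * norm (fourier u x))
            = (\<Sum>i\<in>UNIV. (1 + norm x) ^ N * norm (fourier (partial_deriv i u) x))"
          unfolding sum_distrib_right fourier_partial_deriv[OF Suc.prems(1)]
          by (simp add: norm_mult mult_ac)
        also have "\<dots> \<le> (\<Sum>i\<in>UNIV. C i)" by (intro sum_mono C)
        finally show ?thesis by simp
      qed
      then show ?case by blast
    qed
  next
    fix h i assume "h \<in> ?S"
    then obtain u where u: "u \<in> schwartz" and h: "h = fourier u" by blast
    define v where "v = (\<lambda>x. - \<i> * ((x $ i) *\<^sub>R u x))"
    have v: "v \<in> schwartz"
      unfolding v_def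
      by (intro schwartz_bounded_linear[OF _ bounded_linear_mult_right] schwartz_mult_coord u)
    have "partial_deriv i h = fourier v"
      unfolding h partial_deriv_eqI[OF has_derivative_fourier[OF u]] fun_eq_iff
        fourier_eq_lborel[OF schwartz_measurable[OF v]]
      by (simp add: v_def inner_axis' scaleR_conv_of_real mult_ac)
    with v show "partial_deriv i h \<in> ?S" by blast
  qed
qed

lemma schwartz_fourier_inv:
  fixes f :: "real^'n::finite \<Rightarrow> complex"
  assumes "f \<in> schwartz"
  shows "fourier_inv f \<in> schwartz"
  using schwartz_affine[OF schwartz_fourier[OF assms], of "-1" 0]
  unfolding fourier_inv_eq_fourier[abs_def] by simp

lemma cis_inner_measurable: "(\<lambda>(x, y). cis (c * (x \<bullet> y))) \<in> borel_measurable borel"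
  unfolding cis_conv_exp case_prod_unfold
  by (intro borel_measurable_continuous_onI continuous_intros)

lemma integral_fourier_swap:
  fixes u v :: "real^'n::finite \<Rightarrow> complex"
  assumes u: "integrable lborel u" and v: "integrable lborel v"
  shows "(\<integral>x. u x * fourier v x \<partial>lborel) = (\<integral>x. fourier u x * v x \<partial>lborel)"
proof -
  have "(\<integral>x. u x * (\<integral>y. cis (- 1 * (x \<bullet> y)) * v y \<partial>lborel) \<partial>lborel)
      = (\<integral>y. (\<integral>x. u x * cis (- 1 * (x \<bullet> y)) \<partial>lborel) * v y \<partial>lborel)"
    by (rule integral_kernel_swap[OF u v cis_inner_measurable, where B=1]) simp
  moreover have "u x * fourier v x = fourier_const TYPE('n) * (u x * (\<integral>y. cis (- 1 * (x \<bullet> y)) * v y \<partial>lborel))"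
    and "fourier u x * v x = fourier_const TYPE('n) * ((\<integral>y. u y * cis (- 1 * (y \<bullet> x)) \<partial>lborel) * v x)" for x
    using borel_measurable_integrable[OF u] borel_measurable_integrable[OF v]
    by (simp_all add: fourier_eq_lborel inner_commute mult_ac)
  ultimately show ?thesis by (simp only: integral_mult_right_zero)
qed

lemma integral_fourier_inv_swap:
  fixes u v :: "real^'n::finite \<Rightarrow> complex"
  assumes u: "integrable lborel u" and v: "integrable lborel v"
  shows "(\<integral>x. u x * fourier_inv v x \<partial>lborel) = (\<integral>x. fourier_inv u x * v x \<partial>lborel)"
proof -
  have "(\<integral>x. u x * (\<integral>y. cis (1 * (x \<bullet> y)) * v y \<partial>lborel) \<partial>lborel)
      = (\<integral>y. (\<integral>x. u x * cis (1 * (x \<bullet> y)) \<partial>lborel) * v y \<partial>lborel)"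
    by (rule integral_kernel_swap[OF u v cis_inner_measurable, where B=1]) simp
  moreover have "u x * fourier_inv v x = fourier_const TYPE('n) * (u x * (\<integral>y. cis (1 * (x \<bullet> y)) * v y \<partial>lborel))"
    and "fourier_inv u x * v x = fourier_const TYPE('n) * ((\<integral>y. u y * cis (1 * (y \<bullet> x)) \<partial>lborel) * v x)" for x
    using borel_measurable_integrable[OF u] borel_measurable_integrable[OF v]
    by (simp_all add: fourier_inv_eq_lborel inner_commute mult_ac)
  ultimately show ?thesis by (simp only: integral_mult_right_zero)
qed

text \<open>Any Schwartz regulariser \<open>\<theta>\<close> serves instead of the Gaussian, at the price of an unspecified
  constant (which is 1, but this is irrelevant for norm estimates).\<close>

lemma fourier_inversion_upto_const:
  fixes \<theta> :: "real^'n::finite \<Rightarrow> complex"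
  assumes \<theta>: "\<theta> \<in> schwartz" "\<theta> 0 = 1"
  obtains c where "\<And>h x. h \<in> schwartz \<Longrightarrow> fourier_inv (fourier h) (x::real^'n) = c * h x"
proof
  fix h :: "real^'n \<Rightarrow> complex" and x :: "real^'n" assume h: "h \<in> schwartz"
  let ?\<kappa> = "fourier_const TYPE('n)"
  have Fh: "fourier h \<in> schwartz" by (rule schwartz_fourier[OF h])
  have F\<theta>: "fourier \<theta> \<in> schwartz" by (rule schwartz_fourier[OF \<theta>(1)])
  note [measurable] = schwartz_measurable[OF Fh] schwartz_measurable[OF \<theta>(1)]
    schwartz_measurable[OF F\<theta>] schwartz_measurable[OF h]
  define a where "a n = 1 / real (Suc n)" for n
  have a: "a n > 0" for n by (simp add: a_def)
  have a0: "a \<longlonglongrightarrow> 0" unfolding a_def by (rule LIMSEQ_Suc[OF lim_1_over_n])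
  \<comment> \<open>A character cut off by the stretched regulariser. It tends to
    \<open>cis (x \<bullet> \<xi>)\<close> as \<open>n\<close> grows, while its transform is an ever
    narrower copy of \<open>fourier \<theta>\<close> around \<open>x\<close>. The multiplication
    formula equates the two resulting limits.\<close>
  define w where "w n \<xi> = cis (- (\<xi> \<bullet> (- x))) * \<theta> (a n *\<^sub>R \<xi>)" for n \<xi>
  have w: "w n \<in> schwartz" for n
    using schwartz_modulation[OF schwartz_affine[OF \<theta>(1), of "a n" 0], of "- x"] a[of n]
    unfolding w_def[abs_def] by simp
  obtain B where B: "\<And>y. norm (\<theta> y) \<le> B" using schwartz_decay[OF \<theta>(1), of 0] by auto
  obtain B' where B': "\<And>y. norm (h y) \<le> B'" using schwartz_decay[OF h, of 0] by auto
  have lhs: "(\<lambda>n. \<integral>\<xi>. w n \<xi> * fourier h \<xi> \<partial>lborel) \<longlonglongrightarrow> (\<integral>\<xi>. cis (x \<bullet> \<xi>) * fourier h \<xi> \<partial>lborel)"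
  proof (rule integral_dominated_convergence[where w="\<lambda>\<xi>. B * norm (fourier h \<xi>)"])
    show "(\<lambda>\<xi>. cis (x \<bullet> \<xi>) * fourier h \<xi>) \<in> borel_measurable lborel"
      unfolding cis_conv_exp by measurable
    show "(\<lambda>\<xi>. w n \<xi> * fourier h \<xi>) \<in> borel_measurable lborel" for n
      using schwartz_measurable[OF w[of n]] by simp
    show "integrable lborel (\<lambda>\<xi>. B * norm (fourier h \<xi>))"
      using schwartz_integrable[OF Fh] by simp
    show "AE \<xi> in lborel. (\<lambda>n. w n \<xi> * fourier h \<xi>) \<longlonglongrightarrow> cis (x \<bullet> \<xi>) * fourier h \<xi>"
    proof (rule AE_I2)
      fix \<xi>
      have "(\<lambda>n. \<theta> (a n *\<^sub>R \<xi>)) \<longlonglongrightarrow> \<theta> (0 *\<^sub>R \<xi>)"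
        by (rule continuous_on_tendsto_compose[OF schwartz_continuous[OF \<theta>(1), of UNIV]
              tendsto_scaleR[OF a0 tendsto_const]]) auto
      then have "(\<lambda>n. cis (x \<bullet> \<xi>) * \<theta> (a n *\<^sub>R \<xi>) * fourier h \<xi>) \<longlonglongrightarrow> cis (x \<bullet> \<xi>) * 1 * fourier h \<xi>"
        using \<theta>(2) by (intro tendsto_mult tendsto_const) simp
      then show "(\<lambda>n. w n \<xi> * fourier h \<xi>) \<longlonglongrightarrow> cis (x \<bullet> \<xi>) * fourier h \<xi>"
        by (simp add: w_def inner_commute)
    qed
    show "AE \<xi> in lborel. norm (w n \<xi> * fourier h \<xi>) \<le> B * norm (fourier h \<xi>)" for n
      using B by (intro AE_I2) (simp add: w_def norm_mult mult_right_mono)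
  qed
  have Fw: "fourier (w n) y = (1 / a n) ^ CARD('n) *\<^sub>R fourier \<theta> ((1 / a n) *\<^sub>R (y - x))" for n y
  proof -
    let ?z = "(1 / a n) *\<^sub>R (y - x)"
    have z: "a n *\<^sub>R \<xi> \<bullet> ?z = \<xi> \<bullet> y - \<xi> \<bullet> x" for \<xi>
      using a[of n] by (simp add: inner_diff_right diff_divide_distrib)
    have "(\<integral>\<xi>. cis (- (\<xi> \<bullet> ?z)) * \<theta> \<xi> \<partial>lborel) =
        a n ^ CARD('n) *\<^sub>R (\<integral>\<xi>. cis (- ((0 + a n *\<^sub>R \<xi>) \<bullet> ?z)) * \<theta> (0 + a n *\<^sub>R \<xi>) \<partial>lborel)"
      using integral_affine[OF schwartz_integrable[OF schwartz_modulation[OF \<theta>(1), of ?z]], of "a n" 0] a[of n]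
      by simp
    also have "(\<lambda>\<xi>. cis (- ((0 + a n *\<^sub>R \<xi>) \<bullet> ?z)) * \<theta> (0 + a n *\<^sub>R \<xi>)) = (\<lambda>\<xi>. cis (- (\<xi> \<bullet> y)) * w n \<xi>)"
      unfolding add_0 z by (simp add: w_def cis_mult flip: mult.assoc)
    finally show ?thesis
      using schwartz_measurable[OF w[of n]] a[of n]
      by (simp add: fourier_eq_lborel power_divide scaleR_conv_of_real)
  qed
  have eq: "(\<integral>\<xi>. w n \<xi> * fourier h \<xi> \<partial>lborel) = (\<integral>z. fourier \<theta> z * h (x + a n *\<^sub>R z) \<partial>lborel)" for n
  proof -
    have "(\<integral>\<xi>. w n \<xi> * fourier h \<xi> \<partial>lborel) = (\<integral>y. fourier (w n) y * h y \<partial>lborel)"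
      by (intro integral_fourier_swap schwartz_integrable w h)
    also have "\<dots> = a n ^ CARD('n) *\<^sub>R (\<integral>z. fourier (w n) (x + a n *\<^sub>R z) * h (x + a n *\<^sub>R z) \<partial>lborel)"
      using integral_affine[OF schwartz_integrable[OF schwartz_mult[OF schwartz_fourier[OF w[of n]] h]], of "a n" x] a[of n]
      by simp
    also have "\<dots> = (\<integral>z. fourier \<theta> z * h (x + a n *\<^sub>R z) \<partial>lborel)"
      unfolding Fw using a[of n] by (simp add: power_divide)
    finally show ?thesis .
  qed
  have rhs: "(\<lambda>n. \<integral>z. fourier \<theta> z * h (x + a n *\<^sub>R z) \<partial>lborel) \<longlonglongrightarrow> (\<integral>z. fourier \<theta> z * h x \<partial>lborel)"
  proof (rule integral_dominated_convergence[where w="\<lambda>z. B' * norm (fourier \<theta> z)"])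
    show "integrable lborel (\<lambda>z. B' * norm (fourier \<theta> z))"
      using schwartz_integrable[OF F\<theta>] by simp
    show "AE z in lborel. (\<lambda>n. fourier \<theta> z * h (x + a n *\<^sub>R z)) \<longlonglongrightarrow> fourier \<theta> z * h x"
    proof (rule AE_I2)
      fix z
      have "(\<lambda>n. h (x + a n *\<^sub>R z)) \<longlonglongrightarrow> h (x + 0 *\<^sub>R z)"
        by (rule continuous_on_tendsto_compose[OF schwartz_continuous[OF h, of UNIV]
              tendsto_add[OF tendsto_const tendsto_scaleR[OF a0 tendsto_const]]]) auto
      then show "(\<lambda>n. fourier \<theta> z * h (x + a n *\<^sub>R z)) \<longlonglongrightarrow> fourier \<theta> z * h x"
        by (intro tendsto_mult tendsto_const) simp
    qed
    show "AE z in lborel. norm (fourier \<theta> z * h (x + a n *\<^sub>R z)) \<le> B' * norm (fourier \<theta> z)" for n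
      using B' by (intro AE_I2) (simp add: norm_mult mult.commute[of B'] mult_left_mono)
  qed measurable
  have "(\<integral>\<xi>. cis (x \<bullet> \<xi>) * fourier h \<xi> \<partial>lborel) = (\<integral>z. fourier \<theta> z * h x \<partial>lborel)"
    by (rule LIMSEQ_unique[OF lhs[unfolded eq] rhs])
  \<comment> \<open>The constant is built from \<open>\<theta>\<close> alone; that it is the same
    for all \<open>h\<close> and \<open>x\<close> is what matters.\<close>
  then show "fourier_inv (fourier h) x = (?\<kappa> * (\<integral>z. fourier \<theta> z \<partial>lborel)) * h x"
    by (simp add: fourier_inv_eq_lborel)
qed

subsection \<open>Uniqueness of the representing function\<close>

lemma integrable_locally_integrable_mult:
  fixes f \<psi> :: "'a::euclidean_space \<Rightarrow> complex"
  assumes f: "locally_integrable f" and K: "compact K"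
    and [measurable]: "\<psi> \<in> borel_measurable borel"
    and B: "\<And>x. norm (\<psi> x) \<le> B" and \<psi>: "\<And>x. x \<notin> K \<Longrightarrow> \<psi> x = 0"
  shows "integrable lebesgue (\<lambda>x. f x * \<psi> x)"
proof -
  have fK: "integrable lebesgue (\<lambda>x. indicator K x *\<^sub>R f x)"
    using f K unfolding locally_integrable_def set_integrable_def by blast
  note [measurable] = borel_measurable_integrable[OF fK]
  have "integrable lebesgue (\<lambda>x. (indicator K x *\<^sub>R f x) * \<psi> x)"
  proof (rule Bochner_Integration.integrable_bound)
    show "integrable lebesgue (\<lambda>x. B * norm (indicator K x *\<^sub>R f x))"
      using integrable_norm[OF fK] by (rule integrable_mult_right)
    have "\<psi> \<in> borel_measurable lebesgue" by (intro measurable_completion) simp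
    then show "(\<lambda>x. (indicator K x *\<^sub>R f x) * \<psi> x) \<in> borel_measurable lebesgue"
      by (intro borel_measurable_times borel_measurable_integrable[OF fK])
    have "norm ((indicator K x *\<^sub>R f x) * \<psi> x) \<le> norm (B * norm (indicator K x *\<^sub>R f x))" for x
    proof -
      have "norm ((indicator K x *\<^sub>R f x) * \<psi> x) \<le> norm (indicator K x *\<^sub>R f x) * B"
        unfolding norm_mult by (intro mult_left_mono B) auto
      also have "\<dots> \<le> norm (B * norm (indicator K x *\<^sub>R f x))"
        unfolding real_norm_def by (subst mult.commute) (rule abs_ge_self)
      finally show ?thesis .
    qed
    then show "AE x in lebesgue. norm ((indicator K x *\<^sub>R f x) * \<psi> x) \<le> norm (B * norm (indicator K x *\<^sub>R f x))"
      by simp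
  qed
  also have "(\<lambda>x. (indicator K x *\<^sub>R f x) * \<psi> x) = (\<lambda>x. f x * \<psi> x)"
    using \<psi> by (auto simp: fun_eq_iff indicator_def)
  finally show ?thesis .
qed

lemma lebesgue_measurable_complex_ex_borel:
  fixes f :: "'a::euclidean_space \<Rightarrow> complex"
  assumes [measurable]: "f \<in> borel_measurable lebesgue"
  obtains g where "g \<in> borel_measurable borel" "AE x in lebesgue. f x = g x"
proof -
  have "(\<lambda>x. Re (f x)) \<in> borel_measurable (completion lborel)"
    "(\<lambda>x. Im (f x)) \<in> borel_measurable (completion lborel)" by measurable
  then obtain a b where a: "a \<in> borel_measurable lborel" "AE x in lborel. Re (f x) = a x"
    and b: "b \<in> borel_measurable lborel" "AE x in lborel. Im (f x) = b x"
    using completion_ex_borel_measurable_real by metis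
  show ?thesis
  proof
    show "(\<lambda>x. of_real (a x) + \<i> * of_real (b x)) \<in> borel_measurable borel"
      using a(1) b(1) by simp
    have "AE x in lborel. f x = of_real (a x) + \<i> * of_real (b x)"
      using a(2) b(2) by eventually_elim (simp add: complex_eq_iff)
    then show "AE x in lebesgue. f x = of_real (a x) + \<i> * of_real (b x)"
      by (rule AE_completion)
  qed
qed

lemma schwartz_complex_of_real:
  "f \<in> schwartz \<Longrightarrow> (\<lambda>x. complex_of_real (f x)) \<in> schwartz"
  by (rule schwartz_bounded_linear[OF _ bounded_linear_of_real])

text \<open>Extends orthogonality from test functions to continuous functions of bounded support.
  After mollifying \<open>w\<close>, Fubini leaves for each \<open>y\<close> the integral of
  \<open>u\<close> against a translated mollifier, which is itself an admissible test function; the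
  smoothness of the mollified \<open>w\<close> never has to be discussed.\<close>

lemma integral_mult_continuous_eq_0:
  fixes u w :: "real^'n::finite \<Rightarrow> complex" and \<kappa> :: "real^'n \<Rightarrow> real"
  assumes u: "locally_integrable u"
    and orth: "\<And>\<psi>. \<psi> \<in> schwartz \<Longrightarrow> compact (supp \<psi>) \<Longrightarrow> (\<integral>x. u x * \<psi> x \<partial>lebesgue) = 0"
    and \<kappa>: "\<kappa> \<in> schwartz" "\<And>x. \<kappa> x \<ge> 0" "(\<integral>x. \<kappa> x \<partial>lborel) = 1" "compact (supp \<kappa>)"
    and w: "continuous_on UNIV w" "\<And>x. norm x > r \<Longrightarrow> w x = 0" "\<And>x. norm (w x) \<le> B"
  shows "(\<integral>x. u x * w x \<partial>lebesgue) = 0"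
proof -
  obtain \<rho> where \<rho>: "\<rho> > 0" "\<And>x. x \<in> supp \<kappa> \<Longrightarrow> norm x \<le> \<rho>"
    using compact_imp_bounded[OF \<kappa>(4)] unfolding bounded_pos by blast
  have \<kappa>0: "\<kappa> x = 0" if "norm x > \<rho>" for x
    using \<rho>(2)[of x] that closure_subset[of "{x. \<kappa> x \<noteq> 0}"] unfolding supp_def by force
  \<comment> \<open>A mollifier of width at most 1 centred within \<open>r\<close> of the origin is
    supported in the ball of radius \<open>R\<close>. So \<open>u\<close> may be replaced by its
    truncation \<open>U\<close>, and this by a Borel version \<open>v\<close> that is integrable
    over \<open>lborel\<close>.\<close>
  define R where "R = r + \<rho>"
  define U where "U x = indicator (cball 0 R) x *\<^sub>R u x" for x
  have U: "integrable lebesgue U"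
    using u compact_cball unfolding locally_integrable_def set_integrable_def U_def[abs_def] by blast
  obtain v where v[measurable]: "v \<in> borel_measurable borel" and vU: "AE x in lebesgue. U x = v x"
    using lebesgue_measurable_complex_ex_borel[OF borel_measurable_integrable[OF U]] .
  have "integrable lebesgue v"
    using U vU by (subst integrable_cong_AE[symmetric, OF _ _ vU])
      (auto intro: borel_measurable_integrable measurable_completion)
  then have vint: "integrable lborel v"
    by (subst (asm) integrable_completion) simp_all
  note [measurable] = schwartz_measurable[OF \<kappa>(1)] borel_measurable_continuous_onI[OF w(1)]
  have to_u: "(\<integral>x. v x * h x \<partial>lborel) = (\<integral>x. u x * h x \<partial>lebesgue)"
    if [measurable]: "h \<in> borel_measurable borel" and h0: "\<And>x. norm x > R \<Longrightarrow> h x = 0" for h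
  proof -
    have h': "h \<in> borel_measurable lebesgue" by (intro measurable_completion) simp
    have "(\<integral>x. v x * h x \<partial>lborel) = (\<integral>x. v x * h x \<partial>lebesgue)"
      by (rule integral_completion[symmetric]) simp
    also have "\<dots> = (\<integral>x. U x * h x \<partial>lebesgue)"
      using vU h' borel_measurable_integrable[OF U]
      by (intro integral_cong_AE) (auto intro!: borel_measurable_times intro: measurable_completion elim: AE_mp)
    also have "(\<lambda>x. U x * h x) = (\<lambda>x. u x * h x)"
      using h0 by (auto simp: fun_eq_iff U_def indicator_def)
    finally show ?thesis .
  qed
  define a where "a n = 1 / real (Suc n)" for n
  have a: "a n > 0" "a n \<le> 1" for n by (auto simp: a_def)
  have a0: "a \<longlonglongrightarrow> 0" unfolding a_def by (rule LIMSEQ_Suc[OF lim_1_over_n])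
  define \<Phi> where "\<Phi> n x = (\<integral>z. of_real (\<kappa> z) * w (x - a n *\<^sub>R z) \<partial>lborel)" for n x
  have wint: "integrable lborel w"
  proof -
    have "locally_integrable (\<lambda>x::real^'n. 1)"
      unfolding locally_integrable_def by (auto intro: absolutely_integrable_on_const lmeasurable_compact)
    then have "integrable lebesgue (\<lambda>x. 1 * w x)"
      by (rule integrable_locally_integrable_mult[OF _ compact_cball[of 0 r] _ w(3)])
        (simp_all add: w(2))
    then show ?thesis by (subst (asm) integrable_completion) simp_all
  qed
  obtain K where K: "\<And>x. norm (\<kappa> x) \<le> K" using schwartz_decay[OF \<kappa>(1), of 0] by auto
  \<comment> \<open>In the definition of \<open>\<Phi>\<close> the variable \<open>x\<close> sits in
    \<open>w\<close>, which suits the limit; here it sits in the mollifier, which suits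
    Fubini.\<close>
  have \<Phi>_conv: "\<Phi> n x = (\<integral>y. (1 / a n) ^ CARD('n) *\<^sub>R of_real (\<kappa> ((1 / a n) *\<^sub>R (x - y))) * w y \<partial>lborel)" for n x
  proof -
    have "integrable lborel (\<lambda>y. (of_real (\<kappa> ((1 / a n) *\<^sub>R (x - y)))) * w y)"
    proof (rule Bochner_Integration.integrable_bound)
      show "integrable lborel (\<lambda>y. K * norm (w y))" using wint by simp
      show "AE y in lborel. norm (of_real (\<kappa> ((1 / a n) *\<^sub>R (x - y))) * w y) \<le> norm (K * norm (w y))"
        using K order_trans[OF norm_ge_zero K]
        by (intro AE_I2) (simp add: norm_mult mult_right_mono)
    qed measurable
    from integral_affine[OF this, of "- a n" x]
    show ?thesis
      using a[of n] by (simp add: \<Phi>_def power_divide)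
  qed
  have zero: "(\<integral>x. v x * \<Phi> n x \<partial>lborel) = 0" for n
  proof -
    let ?k = "\<lambda>x y. (1 / a n) ^ CARD('n) *\<^sub>R complex_of_real (\<kappa> ((1 / a n) *\<^sub>R (x - y)))"
    have "(\<integral>x. v x * \<Phi> n x \<partial>lborel) = (\<integral>y. (\<integral>x. v x * ?k x y \<partial>lborel) * w y \<partial>lborel)"
      unfolding \<Phi>_conv
    proof (rule integral_kernel_swap[OF vint wint, where B="(1 / a n) ^ CARD('n) * K"])
      show "(\<lambda>(x, y). ?k x y) \<in> borel_measurable borel"
        unfolding case_prod_unfold
        by (intro borel_measurable_continuous_onI continuous_intros
            continuous_on_compose2[OF schwartz_continuous[OF \<kappa>(1), of UNIV]]) auto
      show "norm (?k x y) \<le> (1 / a n) ^ CARD('n) * K" for x y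
        using K a[of n] by (simp add: divide_right_mono power_divide)
    qed
    also have "\<dots> = (\<integral>(y::real^'n). 0 \<partial>lborel)"
    proof (rule Bochner_Integration.integral_cong[OF refl])
      fix y
      show "(\<integral>x. v x * ?k x y \<partial>lborel) * w y = 0"
      \<comment> \<open>Centres far out are annihilated by \<open>w\<close>; for the others the
        mollifier lives within radius \<open>R\<close>, where \<open>v\<close> and \<open>u\<close>
        agree almost everywhere.\<close>
      proof (cases "norm y > r")
        case True
        then show ?thesis by (simp add: w(2))
      next
        case False
        let ?\<psi> = "\<lambda>x. complex_of_real (\<kappa> ((1 / a n) *\<^sub>R (x - y)))"
        have van: "?\<psi> x = 0" if "norm x > R" for x
        proof -
          have "norm x \<le> norm (x - y) + norm y" by (metis diff_add_cancel norm_triangle_ineq)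
          with that False have "norm (x - y) > \<rho>" by (simp add: R_def)
          moreover have "norm (x - y) \<le> norm ((1 / a n) *\<^sub>R (x - y))"
            unfolding norm_scaleR using a[of n] mult_right_mono[of 1 "\<bar>1 / a n\<bar>" "norm (x - y)"] by simp
          ultimately show ?thesis using \<kappa>0 by simp
        qed
        have \<psi>: "?\<psi> \<in> schwartz"
          using schwartz_complex_of_real[OF schwartz_affine[OF \<kappa>(1), of "1 / a n" "- (1 / a n) *\<^sub>R y"]] a(1)[of n]
          by (simp add: scaleR_diff_right)
        have "compact (supp ?\<psi>)"
          unfolding supp_def compact_closure bounded_iff using van by (meson mem_Collect_eq not_le)
        from orth[OF \<psi> this] to_u[OF schwartz_measurable[OF \<psi>] van]
        have "(\<integral>x. v x * ?\<psi> x \<partial>lborel) = 0" by simp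
        then show ?thesis by simp
      qed
    qed
    finally show ?thesis by simp
  qed
  have "(\<lambda>n. \<integral>x. v x * \<Phi> n x \<partial>lborel) \<longlonglongrightarrow> (\<integral>x. v x * w x \<partial>lborel)"
  proof (rule integral_dominated_convergence[where w="\<lambda>x. norm (v x) * B"])
    have \<kappa>int: "integrable lborel \<kappa>" by (rule schwartz_integrable[OF \<kappa>(1)])
    have meas: "(\<lambda>z. of_real (\<kappa> z) * w (x - a n *\<^sub>R z)) \<in> borel_measurable lborel" for n x
      by measurable
    show "AE x in lborel. (\<lambda>n. v x * \<Phi> n x) \<longlonglongrightarrow> v x * w x"
    proof (rule AE_I2)
      fix x
      have "(\<lambda>n. \<Phi> n x) \<longlonglongrightarrow> (\<integral>z. of_real (\<kappa> z) * w x \<partial>lborel)"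
        unfolding \<Phi>_def
      proof (rule integral_dominated_convergence[where w="\<lambda>z. \<kappa> z * B"])
        show "AE z in lborel. (\<lambda>n. of_real (\<kappa> z) * w (x - a n *\<^sub>R z)) \<longlonglongrightarrow> of_real (\<kappa> z) * w x"
        proof (rule AE_I2)
          fix z
          have "(\<lambda>n. w (x - a n *\<^sub>R z)) \<longlonglongrightarrow> w (x - 0 *\<^sub>R z)"
            by (rule continuous_on_tendsto_compose[OF w(1)
                tendsto_diff[OF tendsto_const tendsto_scaleR[OF a0 tendsto_const]]]) auto
          then show "(\<lambda>n. of_real (\<kappa> z) * w (x - a n *\<^sub>R z)) \<longlonglongrightarrow> of_real (\<kappa> z) * w x"
            by (intro tendsto_mult tendsto_const) simp
        qed
        show "AE z in lborel. norm (of_real (\<kappa> z) * w (x - a n *\<^sub>R z)) \<le> \<kappa> z * B" for n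
          using w(3) \<kappa>(2) by (intro AE_I2) (simp add: norm_mult mult_left_mono)
      qed (use \<kappa>int meas in simp_all)
      also have "(\<integral>z. of_real (\<kappa> z) * w x \<partial>lborel) = w x" using \<kappa>(3) by simp
      finally show "(\<lambda>n. v x * \<Phi> n x) \<longlonglongrightarrow> v x * w x" by (intro tendsto_mult tendsto_const)
    qed
    have "norm (\<Phi> n x) \<le> B" for n x
    proof -
      have "norm (\<Phi> n x) \<le> (\<integral>z. norm (of_real (\<kappa> z) * w (x - a n *\<^sub>R z)) \<partial>lborel)"
        unfolding \<Phi>_def by (rule integral_norm_bound)
      also have "\<dots> \<le> (\<integral>z. \<kappa> z * B \<partial>lborel)"
      proof (rule integral_mono')
        show "integrable lborel (\<lambda>z. \<kappa> z * B)" using \<kappa>int by simp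
        show "norm (of_real (\<kappa> z) * w (x - a n *\<^sub>R z)) \<le> \<kappa> z * B" for z
          using w(3) \<kappa>(2) by (simp add: norm_mult mult_left_mono)
        show "0 \<le> \<kappa> z * B" for z
          using \<kappa>(2)[of z] order_trans[OF norm_ge_zero w(3)] by simp
      qed
      also have "\<dots> = B" using \<kappa>(3) by simp
      finally show ?thesis .
    qed
    then show "AE x in lborel. norm (v x * \<Phi> n x) \<le> norm (v x) * B" for n
      by (intro AE_I2) (simp add: norm_mult mult_left_mono)
    show "(\<lambda>x. v x * \<Phi> n x) \<in> borel_measurable lborel" for n
      unfolding \<Phi>_def by measurable
  qed (use vint in simp_all)
  then have "(\<integral>x. v x * w x \<partial>lborel) = 0"
    unfolding zero by (simp add: LIMSEQ_const_iff)
  then show ?thesis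
    using to_u[of w] w(2) \<rho>(1) by (simp add: R_def)
qed

text \<open>Testing with the conjugate sign of \<open>u\<close> on a ball would give the integral of
  the modulus there. The sign is merely measurable, so it is approached almost everywhere by
  continuous functions of bounded support and modulus at most 1.\<close>

lemma AE_eq_0_of_orthogonal:
  fixes u :: "real^'n::finite \<Rightarrow> complex"
  assumes u: "locally_integrable u"
    and orth: "\<And>w r. continuous_on UNIV w \<Longrightarrow> (\<And>x. norm x > r \<Longrightarrow> w x = 0) \<Longrightarrow> (\<And>x. norm (w x) \<le> 1)
      \<Longrightarrow> (\<integral>x. u x * w x \<partial>lebesgue) = 0"
  shows "AE x in lebesgue. u x = 0"
proof -
  have ball: "AE x in lebesgue. x \<in> cball 0 (real m) \<longrightarrow> u x = 0" for m :: nat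
  proof -
    let ?D = "cball (0::real^'n) (real m)" and ?E = "cball (0::real^'n) (real m + 1)"
    have intE: "integrable lebesgue (\<lambda>x. indicator ?E x *\<^sub>R u x)"
      and intD: "integrable lebesgue (\<lambda>x. indicator ?D x *\<^sub>R u x)"
      using u compact_cball unfolding locally_integrable_def set_integrable_def by blast+
    define s where "s x = cnj (sgn (indicator ?D x *\<^sub>R u x))" for x
    have s1: "norm (s x) \<le> 1" for x by (simp add: s_def norm_sgn)
    have "z * cnj (sgn z) = of_real (norm z)" for z :: complex
      using complex_norm_square[of z]
      by (cases "z = 0") (simp_all add: sgn_eq field_simps power2_eq_square)
    then have us: "u x * s x = of_real (norm (indicator ?D x *\<^sub>R u x))" for x
      by (auto simp: s_def indicator_def)
    have smeas: "s \<in> borel_measurable lebesgue"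
    proof -
      have [measurable]: "cnj \<in> borel_measurable borel"
        by (intro borel_measurable_continuous_onI continuous_intros)
      have "(\<lambda>z::complex. cnj (sgn z)) \<in> borel_measurable borel"
        unfolding sgn_div_norm by measurable
      from measurable_compose[OF borel_measurable_integrable[OF intD] this] show ?thesis
        by (simp add: s_def[abs_def])
    qed
    then have "s measurable_on UNIV"
      using measurable_on_iff_borel_measurable[of UNIV s] by simp
    then obtain N g where N: "negligible N" and g: "\<And>n. continuous_on UNIV (g n)"
      and lim: "\<And>x. x \<notin> N \<Longrightarrow> (\<lambda>n. g n x) \<longlonglongrightarrow> s x"
      unfolding measurable_on_def by auto
    \<comment> \<open>\<open>cut\<close> is 1 on \<open>?D\<close> and 0 off \<open>?E\<close>.
      Dividing by \<open>max 1 (norm (g n x))\<close> bounds \<open>h\<close> by 1 and leaves the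
      limit alone, because \<open>s\<close> is bounded by 1.\<close>
    define cut where "cut x = max 0 (min 1 (real m + 1 - norm x))" for x :: "real^'n"
    define h where "h n x = of_real (cut x / max 1 (norm (g n x))) * g n x" for n x
    have hcont: "continuous_on UNIV (h n)" for n
      unfolding h_def cut_def by (intro continuous_intros g) (auto simp: max_def)
    have h0: "h n x = 0" if "norm x > real m + 1" for n x
      using that by (simp add: h_def cut_def)
    have h1: "norm (h n x) \<le> 1" for n x
    proof -
      have "norm (h n x) = cut x * (norm (g n x) / max 1 (norm (g n x)))"
        by (simp add: h_def norm_mult cut_def norm_divide)
      also have "\<dots> \<le> 1 * 1"
        by (intro mult_mono) (auto simp: cut_def divide_le_eq)
      finally show ?thesis by simp
    qed
    have zero: "(\<integral>x. u x * h n x \<partial>lebesgue) = 0" for n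
      by (rule orth[OF hcont, of "real m + 1"]) (use h0 h1 in auto)
    have "(\<lambda>n. \<integral>x. u x * h n x \<partial>lebesgue) \<longlonglongrightarrow> (\<integral>x. u x * s x \<partial>lebesgue)"
    proof (rule integral_dominated_convergence[where w="\<lambda>x. norm (indicator ?E x *\<^sub>R u x)"])
      show "(\<lambda>x. u x * s x) \<in> borel_measurable lebesgue"
        unfolding us
        by (rule measurable_compose[OF borel_measurable_integrable[OF intD], of "\<lambda>z. of_real (norm z)"]) simp
      show "(\<lambda>x. u x * h n x) \<in> borel_measurable lebesgue" for n
        by (rule borel_measurable_integrable[OF integrable_locally_integrable_mult[OF u
                compact_cball[of 0 "real m + 1"] borel_measurable_continuous_onI[OF hcont] h1]])
          (use h0 in auto)
      show "integrable lebesgue (\<lambda>x. norm (indicator ?E x *\<^sub>R u x))"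
        by (rule integrable_norm[OF intE])
      have "AE x in lebesgue. x \<notin> N"
        using N negligible_iff_null_sets AE_not_in by blast
      then show "AE x in lebesgue. (\<lambda>n. u x * h n x) \<longlonglongrightarrow> u x * s x"
      proof eventually_elim
        case (elim x)
        have "(\<lambda>n. of_real (cut x / max 1 (norm (g n x))) * g n x) \<longlonglongrightarrow> of_real (cut x / max 1 (norm (s x))) * s x"
          by (intro tendsto_intros lim elim) (auto simp: max_def)
        also have "of_real (cut x / max 1 (norm (s x))) * s x = s x"
        proof (cases "x \<in> ?D")
          case True
          then have "cut x = 1" by (simp add: cut_def)
          moreover have "max 1 (norm (s x)) = 1" using s1[of x] by simp
          ultimately show ?thesis by simp
        qed (simp add: s_def)
        finally show ?case unfolding h_def by (intro tendsto_mult tendsto_const)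
      qed
      show "AE x in lebesgue. norm (u x * h n x) \<le> norm (indicator ?E x *\<^sub>R u x)" for n
      proof (rule AE_I2)
        fix x
        show "norm (u x * h n x) \<le> norm (indicator ?E x *\<^sub>R u x)"
        proof (cases "x \<in> ?E")
          case True
          then show ?thesis using mult_left_mono[OF h1[of n x], of "norm (u x)"] by (simp add: norm_mult)
        qed (use h0[of x n] in auto)
      qed
    qed
    then have "(\<integral>x. u x * s x \<partial>lebesgue) = 0" unfolding zero by (simp add: LIMSEQ_const_iff)
    then have "(\<integral>x. norm (indicator ?D x *\<^sub>R u x) \<partial>lebesgue) = 0"
      unfolding us integral_complex_of_real by simp
    then have "AE x in lebesgue. norm (indicator ?D x *\<^sub>R u x) = 0"
      by (subst (asm) integral_nonneg_eq_0_iff_AE[OF integrable_norm[OF intD]]) auto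
    then show ?thesis by eventually_elim (auto simp: indicator_def)
  qed
  have "AE x in lebesgue. \<forall>m::nat. x \<in> cball 0 (real m) \<longrightarrow> u x = 0"
    unfolding AE_all_countable using ball by blast
  then show ?thesis
  proof eventually_elim
    case (elim x)
    obtain m :: nat where "norm x \<le> real m" using real_arch_simple by blast
    with elim show ?case by auto
  qed
qed

text \<open>Any function with the properties of \<open>\<kappa>\<close> becomes a mollifier after
  normalisation. The function \<open>\<eta>0\<close> of the resolution pair will take this part, so
  no bump function has to be constructed.\<close>

lemma represents_unique:
  fixes f g :: "real^'n::finite \<Rightarrow> complex" and \<kappa> :: "real^'n \<Rightarrow> real"
  assumes f: "represents f T" and g: "represents g T"
    and \<kappa>: "\<kappa> \<in> schwartz" "\<And>x. \<kappa> x \<ge> 0" "(\<integral>x. \<kappa> x \<partial>lborel) > 0" "compact (supp \<kappa>)"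
  shows "AE x in lebesgue. f x = g x"
proof -
  let ?I = "\<integral>x. \<kappa> x \<partial>lborel"
  define \<kappa>1 where "\<kappa>1 x = (1 / ?I) *\<^sub>R \<kappa> x" for x
  have \<kappa>1: "\<kappa>1 \<in> schwartz" "\<kappa>1 x \<ge> 0" "(\<integral>x. \<kappa>1 x \<partial>lborel) = 1" "compact (supp \<kappa>1)" for x
    using \<kappa> schwartz_bounded_linear[OF \<kappa>(1) bounded_linear_scaleR_right[of "1 / ?I"]]
    by (auto simp: \<kappa>1_def[abs_def] supp_def)
  have lf: "locally_integrable f" and lg: "locally_integrable g"
    using f g unfolding represents_def by auto
  have lu: "locally_integrable (\<lambda>x. f x - g x)"
    using lf lg unfolding locally_integrable_def by (auto intro: set_integral_diff)
  have orth: "(\<integral>x. (f x - g x) * \<psi> x \<partial>lebesgue) = 0" if \<psi>: "\<psi> \<in> schwartz" "compact (supp \<psi>)" for \<psi>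
  proof -
    obtain B where B: "\<And>x. norm (\<psi> x) \<le> B" using schwartz_decay[OF \<psi>(1), of 0] by auto
    have \<psi>0: "\<psi> x = 0" if "x \<notin> supp \<psi>" for x
      using that closure_subset[of "{x. \<psi> x \<noteq> 0}"] unfolding supp_def by blast
    note int = integrable_locally_integrable_mult[OF _ \<psi>(2) schwartz_measurable[OF \<psi>(1)] B \<psi>0]
    have "(\<integral>x. f x * \<psi> x \<partial>lebesgue) = (\<integral>x. g x * \<psi> x \<partial>lebesgue)"
      using f g \<psi> unfolding represents_def by metis
    then show ?thesis
      using int[OF lf] int[OF lg] by (simp add: left_diff_distrib)
  qed
  have "AE x in lebesgue. f x - g x = 0"
  proof (rule AE_eq_0_of_orthogonal[OF lu])
    fix w :: "real^'n \<Rightarrow> complex" and r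
    assume w: "continuous_on UNIV w" "\<And>x. norm x > r \<Longrightarrow> w x = 0" "\<And>x. norm (w x) \<le> 1"
    show "(\<integral>x. (f x - g x) * w x \<partial>lebesgue) = 0"
      by (rule integral_mult_continuous_eq_0[OF lu orth \<kappa>1 w])
  qed
  then show ?thesis by simp
qed

subsection \<open>Morrey norms\<close>

lemma enn_powr_ennreal: "r \<ge> 0 \<Longrightarrow> enn_powr (ennreal r) a = ennreal (r powr a)"
  by (simp add: enn_powr_def)

lemma enn_powr_mono:
  assumes "x \<le> y" "a \<ge> 0"
  shows "enn_powr x a \<le> enn_powr y a"
proof (cases "y = \<infinity>")
  case False
  then obtain r where r: "y = ennreal r" "r \<ge> 0" by (cases y) auto
  with assms(1) obtain t where t: "x = ennreal t" "t \<ge> 0"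
    by (cases x) (auto simp: top_unique)
  from assms r t show ?thesis by (simp add: enn_powr_ennreal powr_mono2)
qed (simp add: enn_powr_def)

lemma dyadic_cube_measurable [measurable]: "dyadic_cube j k \<in> sets borel"
  unfolding dyadic_cube_def by measurable

text \<open>The half-open cube lies between an open and a closed box with the same corners, hence of
  the same volume.\<close>

lemma emeasure_dyadic_cube:
  "emeasure lebesgue (dyadic_cube j (k::int^'n::finite)) = ennreal ((2 powi (-j)) ^ CARD('n))"
proof -
  define l where "l = (2::real) powi (-j)"
  have l: "l > 0" by (simp add: l_def)
  define a where "a = (vec_lambda (\<lambda>i. l * of_int (k $ i)) :: real^'n)"
  define b where "b = (vec_lambda (\<lambda>i. l * (of_int (k $ i) + 1)) :: real^'n)"
  have ab: "a $ i < b $ i" for i using l by (simp add: a_def b_def algebra_simps)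
  have prod: "(\<Prod>c\<in>Basis. (b - a) \<bullet> c) = l ^ CARD('n)"
  proof -
    have "(b - a) \<bullet> c = l" if "c \<in> Basis" for c
      using that by (auto simp: Basis_vec_def a_def b_def inner_axis algebra_simps)
    then show ?thesis by simp
  qed
  have le: "\<forall>c\<in>Basis. a \<bullet> c \<le> b \<bullet> c"
    using ab by (auto simp: Basis_vec_def inner_axis less_imp_le)
  have Q: "dyadic_cube j k = {x. \<forall>i. a $ i \<le> x $ i \<and> x $ i < b $ i}"
    by (simp add: dyadic_cube_def a_def b_def l_def)
  have "box a b \<subseteq> dyadic_cube j k" "dyadic_cube j k \<subseteq> cbox a b"
    unfolding Q by (auto simp: mem_box_cart less_imp_le)
  then have "emeasure lborel (box a b) \<le> emeasure lborel (dyadic_cube j k)"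
    "emeasure lborel (dyadic_cube j k) \<le> emeasure lborel (cbox a b)"
    by (auto intro!: emeasure_mono)
  with le have "emeasure lborel (dyadic_cube j k) = ennreal (l ^ CARD('n))"
    by (simp add: emeasure_lborel_box_eq emeasure_lborel_cbox_eq prod)
  then show ?thesis by (simp add: l_def)
qed

lemma dyadic_cube_diameter:
  assumes "x \<in> dyadic_cube j (k::int^'n::finite)" "y \<in> dyadic_cube j k"
  shows "norm (x - y) \<le> real CARD('n) * 2 powi (-j)"
proof -
  have "\<bar>(x - y) $ i\<bar> \<le> 2 powi (-j)" for i
  proof -
    have "2 powi (-j) * of_int (k $ i) \<le> x $ i" "x $ i < 2 powi (-j) * of_int (k $ i) + 2 powi (-j)"
      "2 powi (-j) * of_int (k $ i) \<le> y $ i" "y $ i < 2 powi (-j) * of_int (k $ i) + 2 powi (-j)"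
      using assms unfolding dyadic_cube_def by (auto simp: algebra_simps)
    then show ?thesis by simp
  qed
  then have "(\<Sum>i\<in>UNIV. \<bar>(x - y) $ i\<bar>) \<le> (\<Sum>i\<in>(UNIV::'n set). 2 powi (-j))"
    by (intro sum_mono)
  with norm_le_l1_cart[of "x - y"] show ?thesis by simp
qed

text \<open>With p-th powers taken, the estimate on each cube becomes an inequality between real
  numbers without roots or quotients. \<open>B\<close> may depend on the cube, \<open>C\<close> may
  not.\<close>

lemma morrey_norm_leI:
  fixes f :: "real^'n::finite \<Rightarrow> complex"
  assumes p: "p > 0" and \<phi>: "\<And>t. t > 0 \<Longrightarrow> \<phi> t > 0" and C: "C \<ge> 0"
    and B: "\<And>j k. \<exists>B\<ge>0. (\<integral>\<^sup>+y\<in>dyadic_cube j k. ennreal (norm (f y) powr p) \<partial>lebesgue) \<le> ennreal B \<and>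
      \<phi> (2 powi (-j)) powr p * B \<le> C powr p * (2 powi (-j)) ^ CARD('n)"
  shows "morrey_norm \<phi> p f \<le> ennreal C"
  unfolding morrey_norm_def
proof (rule SUP_least, clarify)
  fix j k
  define l where "l = (2::real) powi (-j)"
  let ?I = "\<integral>\<^sup>+y\<in>dyadic_cube j k. ennreal (norm (f y) powr p) \<partial>lebesgue"
  have l: "l > 0" by (simp add: l_def)
  obtain B where "B \<ge> 0" and int: "?I \<le> ennreal B"
    and le: "\<phi> l powr p * B \<le> C powr p * l ^ CARD('n)"
    using B[of j k] by (auto simp: l_def)
  have "enn_powr (?I / emeasure lebesgue (dyadic_cube j k)) (1 / p) \<le> enn_powr (ennreal B / ennreal (l ^ CARD('n))) (1 / p)"
    unfolding emeasure_dyadic_cube l_def[symmetric]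
    using int p by (intro enn_powr_mono divide_right_mono_ennreal) auto
  also have "\<dots> = ennreal ((B / l ^ CARD('n)) powr (1 / p))"
    using \<open>B \<ge> 0\<close> l by (simp add: divide_ennreal enn_powr_ennreal)
  finally have "ennreal (\<phi> l) * enn_powr (?I / emeasure lebesgue (dyadic_cube j k)) (1 / p) \<le> ennreal (\<phi> l) * ennreal ((B / l ^ CARD('n)) powr (1 / p))"
    by (rule mult_left_mono) simp
  also have "\<dots> = ennreal (\<phi> l * (B / l ^ CARD('n)) powr (1 / p))"
    using \<phi>[OF l] by (simp add: ennreal_mult)
  also have "\<phi> l * (B / l ^ CARD('n)) powr (1 / p) = (\<phi> l powr p * B / l ^ CARD('n)) powr (1 / p)"
    using \<phi>[OF l] \<open>B \<ge> 0\<close> l p by (simp add: powr_mult powr_divide powr_powr)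
  also have "\<dots> \<le> (C powr p) powr (1 / p)"
    using le \<open>B \<ge> 0\<close> l p \<phi>[OF l] by (intro powr_mono2) (auto simp: divide_le_eq)
  also have "\<dots> = C" using C p by (simp add: powr_powr)
  finally show "ennreal (\<phi> (2 powi (-j))) * enn_powr (?I / emeasure lebesgue (dyadic_cube j k)) (1 / p) \<le> ennreal C"
    by (simp add: l_def ennreal_leI)
qed

lemma morrey_norm_cong_AE:
  assumes "AE x in lebesgue. f x = g x"
  shows "morrey_norm \<phi> p f = morrey_norm \<phi> p g"
proof -
  have "(\<integral>\<^sup>+y\<in>D. ennreal (norm (f y) powr p) \<partial>lebesgue) = (\<integral>\<^sup>+y\<in>D. ennreal (norm (g y) powr p) \<partial>lebesgue)" for D
    using assms by (intro nn_integral_cong_AE) (auto elim: AE_mp)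
  then show ?thesis unfolding morrey_norm_def by simp
qed

text \<open>Replacing every term by the largest works for all exponents alike, so that
  \<open>p < 1\<close> and \<open>p \<ge> 1\<close> need no separate treatment.\<close>

lemma powr_sum_le:
  assumes "finite A" "\<And>n. n \<in> A \<Longrightarrow> a n \<ge> (0::real)" "p > 0"
  shows "(\<Sum>n\<in>A. a n) powr p \<le> real (card A) powr p * (\<Sum>n\<in>A. a n powr p)"
proof (cases "A = {}")
  case False
  then have "Max (a ` A) \<in> a ` A" using assms(1) by (intro Max_in) auto
  then obtain n0 where "n0 \<in> A" "Max (a ` A) = a n0" by blast
  with assms(1) have n0: "n0 \<in> A" "\<And>n. n \<in> A \<Longrightarrow> a n \<le> a n0" by (metis Max_ge finite_imageI imageI)+
  have "(\<Sum>n\<in>A. a n) powr p \<le> (real (card A) * a n0) powr p"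
    using assms n0 sum_bounded_above[of A a "a n0"] by (intro powr_mono2 sum_nonneg) auto
  also have "\<dots> = real (card A) powr p * a n0 powr p"
    using assms n0 by (simp add: powr_mult)
  also have "\<dots> \<le> real (card A) powr p * (\<Sum>n\<in>A. a n powr p)"
    using assms n0 by (intro mult_left_mono member_le_sum) auto
  finally show ?thesis .
qed simp

lemma powr_add_le:
  assumes "a \<ge> 0" "b \<ge> (0::real)" "p > 0"
  shows "(a + b) powr p \<le> 2 powr p * (a powr p + b powr p)"
  using powr_sum_le[of "{0,1::nat}" "\<lambda>n. if n = 0 then a else b" p] assms by simp

lemma growth_class_pos: "\<phi> \<in> growth_class d p \<Longrightarrow> t > 0 \<Longrightarrow> \<phi> t > 0"
  by (simp add: growth_class_def)

lemma growth_class_mono: "\<phi> \<in> growth_class d p \<Longrightarrow> 0 < s \<Longrightarrow> s \<le> t \<Longrightarrow> \<phi> s \<le> \<phi> t"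
  unfolding growth_class_def by (auto dest!: monotone_onD[of _ _ _ _ s t])

lemma powr_minus_divide_powr:
  fixes x p :: real
  assumes "x > 0" "p > 0"
  shows "(x powr (- (real d / p))) powr p = inverse (x ^ d)"
proof -
  have "(x powr (- (real d / p))) powr p = x powr (- (real d / p) * p)" by (rule powr_powr)
  also have "\<dots> = x powr (- real d)" using assms by simp
  also have "\<dots> = inverse (x ^ d)" using assms by (simp add: powr_minus powr_realpow)
  finally show ?thesis .
qed

text \<open>The second condition on \<phi> raised to the power p and cleared of denominators, which
  turns the exponent d/p into the integer d.\<close>

lemma growth_class_antimono:
  assumes \<phi>: "\<phi> \<in> growth_class d p" and p: "p > 0" and st: "0 < s" "s \<le> t"
  shows "\<phi> t powr p * s ^ d \<le> \<phi> s powr p * t ^ d"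
proof -
  have "antimono_on {0<..} (\<lambda>t. \<phi> t * t powr (- (real d / p)))"
    using \<phi> by (simp add: growth_class_def)
  then have "\<phi> t * t powr (- (real d / p)) \<le> \<phi> s * s powr (- (real d / p))"
    using st by (auto dest!: monotone_onD[of _ _ _ _ s t])
  then have "(\<phi> t * t powr (- (real d / p))) powr p \<le> (\<phi> s * s powr (- (real d / p))) powr p"
    using st p growth_class_pos[OF \<phi>, of t] by (intro powr_mono2) auto
  then have "\<phi> t powr p * inverse (t ^ d) \<le> \<phi> s powr p * inverse (s ^ d)"
    using st growth_class_pos[OF \<phi>, of t] growth_class_pos[OF \<phi>, of s] by (simp add: powr_mult powr_minus_divide_powr[OF _ p])
  then show ?thesis using st by (simp add: field_simps)
qed

section \<open>Polynomial weights as majorants of bumps\<close>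

definition decay_weight :: "nat \<Rightarrow> real^'n::finite \<Rightarrow> real" where
  "decay_weight m x = 1 / (1 + norm x) ^ m"

lemma decay_weight_pos: "0 < decay_weight m x" and decay_weight_le_1: "decay_weight m x \<le> 1"
  by (auto simp: decay_weight_def add_pos_nonneg one_le_power)

lemma decay_weight_measurable [measurable]: "decay_weight m \<in> borel_measurable borel"
  unfolding decay_weight_def[abs_def] by measurable

text \<open>Dilation by \<open>2 ^ i \<ge> 1\<close> only speeds up the decay, so this tail bound is
  uniform in the scale.\<close>

lemma decay_weight_scale_le:
  assumes "m \<ge> 1" "norm y \<ge> r" "r > 0"
  shows "decay_weight m (2 ^ i *\<^sub>R y) \<le> 1 / r"
proof -
  have "r \<le> 1 + 2 ^ i * norm y"
    using assms(2) mult_right_mono[of 1 "2 ^ i" "norm y"] by simp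
  also have "\<dots> \<le> (1 + 2 ^ i * norm y) ^ m"
    using assms(1) by (intro self_le_power) auto
  finally show ?thesis
    using assms(3) by (simp add: decay_weight_def frac_le)
qed

text \<open>The condition on \<open>m\<close> puts the p-th power of the weight below the integrable
  majorant of order \<open>2 * CARD('n)\<close>. \<open>J\<close> is the integral of the undilated
  weight, hence common to all scales and centres.\<close>

lemma nn_integral_decay_weight:
  fixes p :: real
  assumes m: "real (2 * CARD('n::finite)) \<le> real m * p" and p: "p > 0"
  obtains J where "J \<ge> 0"
    "\<And>i (a::real^'n). (\<integral>\<^sup>+x. ennreal (decay_weight m (2 ^ i *\<^sub>R (x - a)) powr p) \<partial>lebesgue)
      = ennreal (J * (1 / 2 ^ i) ^ CARD('n))"
proof -
  let ?w = "\<lambda>x::real^'n. ennreal (decay_weight m x powr p)"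
  have "(\<integral>\<^sup>+x. ?w x \<partial>lborel) \<le> (\<integral>\<^sup>+(x::real^'n). ennreal (norm (1 / (1 + norm x) ^ (2 * CARD('n)))) \<partial>lborel)"
  proof (intro nn_integral_mono ennreal_leI)
    fix x :: "real^'n"
    have "(1 + norm x) ^ (2 * CARD('n)) = (1 + norm x) powr real (2 * CARD('n))"
      by (rule powr_realpow[symmetric]) (simp add: add_pos_nonneg)
    also have "\<dots> \<le> (1 + norm x) powr (real m * p)"
      using m by (intro powr_mono) auto
    also have "\<dots> = ((1 + norm x) ^ m) powr p"
      by (simp add: powr_powr[symmetric] powr_realpow add_pos_nonneg)
    finally have "(1 + norm x) ^ (2 * CARD('n)) \<le> ((1 + norm x) ^ m) powr p" .
    moreover have "0 < (1 + norm x) ^ (2 * CARD('n))" by (simp add: add_pos_nonneg)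
    ultimately show "decay_weight m x powr p \<le> norm (1 / (1 + norm x) ^ (2 * CARD('n)))"
      by (simp add: decay_weight_def powr_divide frac_le)
  qed
  also have "\<dots> < \<infinity>"
    using integrable_power_decay unfolding integrable_iff_bounded by (rule conjunct2)
  finally obtain J where J: "J \<ge> 0" "(\<integral>\<^sup>+x. ?w x \<partial>lborel) = ennreal J"
    by (cases "\<integral>\<^sup>+x. ?w x \<partial>lborel") auto
  have "(\<integral>\<^sup>+x. ennreal (decay_weight m (2 ^ i *\<^sub>R (x - a)) powr p) \<partial>lebesgue)
      = ennreal (J * (1 / 2 ^ i) ^ CARD('n))" for i and a :: "real^'n"
  proof -
    let ?Y = "\<integral>\<^sup>+x. ennreal (decay_weight m (2 ^ i *\<^sub>R (x - a)) powr p) \<partial>lborel"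
    have "ennreal J = ennreal ((2 ^ i) ^ CARD('n)) * ?Y"
      using nn_integral_affine[of ?w "2 ^ i" "- (2 ^ i *\<^sub>R a)"] J
      by (simp add: scaleR_diff_right ennreal_power)
    then have "?Y = ennreal (J * (1 / 2 ^ i) ^ CARD('n))"
    proof (cases ?Y)
      case (real y)
      with \<open>ennreal J = _\<close> have "ennreal J = ennreal ((2 ^ i) ^ CARD('n) * y)" by (simp add: ennreal_mult)
      with real J have "J = (2 ^ i) ^ CARD('n) * y" by (subst (asm) ennreal_inj) auto
      with real show ?thesis by (simp add: power_divide)
    next
      case top
      with \<open>ennreal J = _\<close> show ?thesis by (simp add: ennreal_mult_top)
    qed
    then show ?thesis by (simp add: nn_integral_completion)
  qed
  with J(1) show ?thesis by (rule that)
qed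

text \<open>Condition \<open>\<phi>(t) t\<^bsup>-d/p\<^esup> \<rightarrow> 0\<close> makes large cubes harmless, so that arbitrarily many
  sufficiently sparse copies of a bump have Morrey norm comparable to that of a single one.\<close>

lemma morrey_norm_sparse_sum:
  fixes \<phi> :: "real \<Rightarrow> real" and p :: real and e :: "real^'n::finite"
  assumes \<phi>: "\<phi> \<in> growth_class CARD('n) p" and p: "p > 0"
    and lim: "((\<lambda>t. \<phi> t * t powr (- (real CARD('n) / p))) \<longlongrightarrow> 0) at_top"
    and m: "real (2 * CARD('n)) \<le> real m * p" "m \<ge> 1" and e: "norm e = 1"
  obtains C where "C > 0"
    "\<And>K N. \<exists>R0. \<forall>R\<ge>R0. \<forall>i\<le>K. \<forall>A\<ge>0. \<forall>h :: real^'n \<Rightarrow> complex.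
      (\<forall>x. norm (h x) \<le> A * (\<Sum>n<N. decay_weight m (2 ^ i *\<^sub>R (x - (real n * R) *\<^sub>R e)))) \<longrightarrow>
      morrey_norm \<phi> p h \<le> ennreal (C * A * \<phi> (2 powr (- real i)))"
proof -
  let ?d = "CARD('n)"
  obtain J where J: "J \<ge> 0"
    "\<And>i (a::real^'n). (\<integral>\<^sup>+x. ennreal (decay_weight m (2 ^ i *\<^sub>R (x - a)) powr p) \<partial>lebesgue)
      = ennreal (J * (1 / 2 ^ i) ^ ?d)"
    using nn_integral_decay_weight[OF m(1) p] by blast
  \<comment> \<open>In the bound for small cubes, \<open>2 powr p\<close> comes from splitting off
    one bump, \<open>J + 1\<close> covers that bump on cubes finer or coarser than its scale, and
    the last 1 covers all other bumps together.\<close>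
  define C where "C = (2 powr p * (J + 2)) powr (1 / p)"
  have C: "C > 0" using J(1) by (simp add: C_def)
  have Cp: "C powr p = 2 powr p * (J + 2)" using J(1) p by (simp add: C_def powr_powr)
  show ?thesis
  proof (rule that[OF C])
    fix K N :: nat
    define r where "r i = 2 powr (- real i)" for i :: nat
    have r: "r i > 0" "r i \<le> 1" for i by (auto simp: r_def powr_le_one_le powr_minus inverse_le_1_iff ge_one_powr_ge_zero)
    have r_eq: "r i = 1 / 2 ^ i" for i by (simp add: r_def powr_minus powr_realpow divide_inverse)
    have rK: "\<phi> (r K) \<le> \<phi> (r i)" if "i \<le> K" for i
      by (rule growth_class_mono[OF \<phi> r(1)]) (use that in \<open>simp add: r_def\<close>)
    \<comment> \<open>Bounds the integral over the whole space of the p-th power of the sum of all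
      \<open>N\<close> bumps, at whatever scale; the added 1 keeps it positive.\<close>
    define \<mu> where "\<mu> = real N powr p * (real N * J) + 1"
    have \<mu>: "\<mu> > 0" using J(1) by (simp add: \<mu>_def add_nonneg_pos)
    have "\<forall>\<^sub>F t in at_top. \<phi> t * t powr (- (real ?d / p)) < \<phi> (r K) / \<mu> powr (1 / p)"
      using order_tendstoD(2)[OF lim] growth_class_pos[OF \<phi> r(1)] \<mu> by simp
    then obtain L0 where L0: "\<And>t. t \<ge> L0 \<Longrightarrow> \<phi> t * t powr (- (real ?d / p)) < \<phi> (r K) / \<mu> powr (1 / p)"
      unfolding eventually_at_top_linorder by blast
    \<comment> \<open>Cubes of side above \<open>L\<close> count as large. The reference value
      \<open>\<phi> (r K)\<close> is the least among \<open>\<phi> (r i)\<close> with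
      \<open>i \<le> K\<close>, so one threshold serves all scales.\<close>
    define L where "L = max 1 L0"
    have large: "\<phi> l powr p * \<mu> \<le> \<phi> (r K) powr p * l ^ ?d" if "l \<ge> L" for l
    proof -
      have l: "l \<ge> 1" "l \<ge> L0" using that by (auto simp: L_def)
      then have "l > 0" by simp
      have "\<phi> l * l powr (- (real ?d / p)) * \<mu> powr (1 / p) \<le> \<phi> (r K)"
        using L0[OF l(2)] \<mu> by (simp add: field_simps)
      then have "(\<phi> l * l powr (- (real ?d / p)) * \<mu> powr (1 / p)) powr p \<le> \<phi> (r K) powr p"
        using p growth_class_pos[OF \<phi> \<open>l > 0\<close>] by (intro powr_mono2) auto
      moreover have "(\<mu> powr (1 / p)) powr p = \<mu>" using \<mu> p by (simp add: powr_powr)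
      moreover from this have "(\<phi> l * l powr (- (real ?d / p)) * \<mu> powr (1 / p)) powr p = \<phi> l powr p * inverse (l ^ ?d) * \<mu>"
        using \<mu> p growth_class_pos[OF \<phi> \<open>l > 0\<close>] \<open>l > 0\<close>
        by (simp add: powr_mult powr_minus_divide_powr[OF \<open>l > 0\<close> p])
      ultimately have "\<phi> l powr p * inverse (l ^ ?d) * \<mu> \<le> \<phi> (r K) powr p" by argo
      then show ?thesis using \<open>l > 0\<close> by (simp add: field_simps)
    qed
    \<comment> \<open>The total height granted to the far bumps on a small cube: even multiplied by
      the largest factor \<open>\<phi> L\<close> it stays within
      \<open>\<phi> (r K)\<close>.\<close>
    define \<delta> where "\<delta> = min 1 (\<phi> (r K) / \<phi> L)"
    have L: "L > 0" by (simp add: L_def)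
    have \<delta>: "\<delta> > 0" "\<delta> \<le> 1" "\<phi> L * \<delta> \<le> \<phi> (r K)"
      using growth_class_pos[OF \<phi> L] growth_class_pos[OF \<phi> r(1)[of K]]
      by (auto simp: \<delta>_def min_def field_simps)
    \<comment> \<open>The entry \<open>2 * real ?d * L\<close> keeps the diameter of a small cube
      below half the spacing; the last entry makes \<open>N\<close> tails of height
      \<open>4 / R\<close> add up to at most \<open>\<delta>\<close>.\<close>
    define R0 where "R0 = max (max 1 (2 * real ?d * L)) (4 * real N / \<delta>)"
    show "\<exists>R0. \<forall>R\<ge>R0. \<forall>i\<le>K. \<forall>A\<ge>0. \<forall>h :: real^'n \<Rightarrow> complex.
      (\<forall>x. norm (h x) \<le> A * (\<Sum>n<N. decay_weight m (2 ^ i *\<^sub>R (x - (real n * R) *\<^sub>R e)))) \<longrightarrow>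
      morrey_norm \<phi> p h \<le> ennreal (C * A * \<phi> (2 powr (- real i)))"
    proof (intro exI[of _ R0] allI impI)
      fix R i A and h :: "real^'n \<Rightarrow> complex"
      assume R0: "R0 \<le> R" and i: "i \<le> K" and A: "0 \<le> A"
        and h: "\<forall>x. norm (h x) \<le> A * (\<Sum>n<N. decay_weight m (2 ^ i *\<^sub>R (x - (real n * R) *\<^sub>R e)))"
      have R: "R \<ge> 1" "real ?d * L \<le> R / 2" "4 * real N / R \<le> \<delta>"
        using R0 \<delta>(1) by (auto simp: R0_def field_simps)
      define w where "w n x = decay_weight m (2 ^ i *\<^sub>R (x - (real n * R) *\<^sub>R e))" for n x
      have w: "0 \<le> w n x" "w n x \<le> 1" for n x
        by (simp_all add: w_def decay_weight_le_1 less_imp_le[OF decay_weight_pos])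
      have wmeas [measurable]: "w n \<in> borel_measurable borel" for n
        unfolding w_def[abs_def] by measurable
      have wmeas' [measurable]: "w n \<in> borel_measurable lebesgue" for n
        by (intro measurable_completion) simp
      have wint: "(\<integral>\<^sup>+x. ennreal (w n x powr p) \<partial>lebesgue) = ennreal (J * r i ^ ?d)" for n
        unfolding w_def r_eq by (rule J(2))
      have far: "w n x \<le> 4 / R" if "norm (x - (real n * R) *\<^sub>R e) \<ge> R / 4" for n x
        using decay_weight_scale_le[OF m(2) that, of i] R(1) by (simp add: w_def)
      have hw: "norm (h x) powr p \<le> A powr p * (\<Sum>n<N. w n x) powr p" for x
      proof -
        have "norm (h x) powr p \<le> (A * (\<Sum>n<N. w n x)) powr p"
          using h p by (intro powr_mono2) (auto simp: w_def)
        then show ?thesis using A w by (simp add: powr_mult sum_nonneg)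
      qed
      show "morrey_norm \<phi> p h \<le> ennreal (C * A * \<phi> (2 powr (- real i)))"
      proof (rule morrey_norm_leI[OF p])
        show "0 < \<phi> t" if "0 < t" for t using growth_class_pos[OF \<phi> that] .
        show "0 \<le> C * A * \<phi> (2 powr (- real i))"
          using C A growth_class_pos[OF \<phi> r(1)[of i]] by (simp add: r_def)
        fix j and k :: "int^'n"
        define l where "l = (2::real) powi (-j)"
        have l: "l > 0" by (simp add: l_def)
        let ?Q = "dyadic_cube j k"
        let ?S = "\<integral>\<^sup>+y\<in>?Q. ennreal ((\<Sum>n<N. w n y) powr p) \<partial>lebesgue"
        have eQ: "emeasure lebesgue ?Q = ennreal (l ^ ?d)"
          by (simp add: emeasure_dyadic_cube l_def)
        have Qm [measurable]: "?Q \<in> sets lebesgue" by simp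
        have "\<exists>B\<ge>0. ?S \<le> ennreal B \<and>
            \<phi> l powr p * B \<le> (C * \<phi> (r i)) powr p * l ^ ?d"
        proof (cases "l \<le> L")
          case False
          let ?B = "real N powr p * (real N * (J * r i ^ ?d))"
          have "?S
              \<le> (\<integral>\<^sup>+y. ennreal (real N powr p) * (\<Sum>n<N. ennreal (w n y powr p)) \<partial>lebesgue)"
          proof (rule nn_integral_mono)
            fix y
            have "ennreal ((\<Sum>n<N. w n y) powr p) \<le> ennreal (real N powr p * (\<Sum>n<N. w n y powr p))"
              using powr_sum_le[of "{..<N}" "\<lambda>n. w n y" p] w p by (intro ennreal_leI) auto
            also have "\<dots> = ennreal (real N powr p) * (\<Sum>n<N. ennreal (w n y powr p))"
              by (simp add: ennreal_mult sum_nonneg)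
            finally show "ennreal ((\<Sum>n<N. w n y) powr p) * indicator ?Q y \<le> \<dots>"
              by (auto simp: indicator_def)
          qed
          also have "\<dots> = ennreal (real N powr p) * (\<Sum>n<N. (\<integral>\<^sup>+y. ennreal (w n y powr p) \<partial>lebesgue))"
            by (subst nn_integral_cmult) (simp_all add: nn_integral_sum del: sum_ennreal)
          also have "\<dots> = ennreal ?B"
            unfolding wint using J(1) r(1)[of i]
            by (simp add: ennreal_mult ennreal_of_nat_eq_real_of_nat)
          finally have 1: "?S \<le> ennreal ?B" .
          have "r i ^ ?d \<le> 1" using r[of i] by (intro power_le_one) auto
          then have "?B \<le> \<mu>"
            using J(1) mult_left_mono[of "r i ^ ?d" 1 "real N powr p * (real N * J)"]
            by (simp add: \<mu>_def mult_ac)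
          then have "\<phi> l powr p * ?B \<le> \<phi> l powr p * \<mu>" by (intro mult_left_mono) auto
          also have "\<dots> \<le> \<phi> (r K) powr p * l ^ ?d" using False by (intro large) auto
          also have "\<dots> \<le> (1 * \<phi> (r i) powr p) * l ^ ?d"
            using rK[OF i] p l growth_class_pos[OF \<phi> r(1)[of K]] by (intro mult_right_mono) (auto intro: powr_mono2)
          also have "\<dots> \<le> (C powr p * \<phi> (r i) powr p) * l ^ ?d"
          proof (intro mult_right_mono)
            have "1 \<le> 2 powr p" using p by (simp add: ge_one_powr_ge_zero)
            then have "1 * 1 \<le> 2 powr p * (J + 2)" using J(1) by (intro mult_mono) auto
            then show "1 \<le> C powr p" by (simp add: Cp)
          qed (use l in auto)
          also have "\<dots> = (C * \<phi> (r i)) powr p * l ^ ?d"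
            using C growth_class_pos[OF \<phi> r(1)[of i]] by (simp add: powr_mult)
          finally have 2: "\<phi> l powr p * ?B \<le> (C * \<phi> (r i)) powr p * l ^ ?d" .
          show ?thesis
            using 1 2 J(1) r(1)[of i] by (intro exI[of _ ?B]) auto
        next
          case lL: True
          \<comment> \<open>At most one centre comes within \<open>R / 4\<close> of a small cube:
            from the spacing \<open>R\<close> one subtracts \<open>R / 4\<close> and the diameter
            \<open>R / 2\<close>, and \<open>R / 4\<close> is left for every other centre. If no
            centre is near, the index 0 serves, since \<open>w\<close> is nonnegative.\<close>
          obtain n0 where n0: "\<And>x. x \<in> ?Q \<Longrightarrow> (\<Sum>n<N. w n x) \<le> w n0 x + \<delta>"
          proof -
            obtain n0 where n0: "\<And>n x. n < N \<Longrightarrow> n \<noteq> n0 \<Longrightarrow> x \<in> ?Q \<Longrightarrow> norm (x - (real n * R) *\<^sub>R e) \<ge> R / 4"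
            proof (cases "\<exists>n<N. \<exists>x\<in>?Q. norm (x - (real n * R) *\<^sub>R e) < R / 4")
              case True
              then obtain n0 x0 where x0: "x0 \<in> ?Q" "norm (x0 - (real n0 * R) *\<^sub>R e) < R / 4" by blast
              have "norm (x - (real n * R) *\<^sub>R e) \<ge> R / 4" if "n \<noteq> n0" "x \<in> ?Q" for n x
              proof -
                have "R * 1 \<le> R * \<bar>real n - real n0\<bar>"
                  using that(1) R(1) by (intro mult_left_mono) auto
                also have "\<dots> = norm ((real n * R) *\<^sub>R e - (real n0 * R) *\<^sub>R e)"
                  using R(1) by (simp add: e abs_mult flip: scaleR_diff_left left_diff_distrib)
                also have "\<dots> = norm ((x0 - (real n0 * R) *\<^sub>R e) + (x - x0) - (x - (real n * R) *\<^sub>R e))"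
                  by simp
                also have "\<dots> \<le> norm (x0 - (real n0 * R) *\<^sub>R e) + norm (x - x0) + norm (x - (real n * R) *\<^sub>R e)"
                  by (intro order_trans[OF norm_triangle_ineq4] add_mono norm_triangle_ineq order_refl)
                finally have "R \<le> norm (x0 - (real n0 * R) *\<^sub>R e) + norm (x - x0) + norm (x - (real n * R) *\<^sub>R e)"
                  by simp
                moreover have "norm (x - x0) \<le> R / 2"
                  using dyadic_cube_diameter[OF that(2) x0(1)] R(2) mult_left_mono[OF lL of_nat_0_le_iff[of ?d]]
                  unfolding l_def by linarith
                ultimately show ?thesis using x0(2) by linarith
              qed
              then show ?thesis using that by blast
            next
              case False
              then show ?thesis using that[of 0] by (meson not_le)
            qed
            have "(\<Sum>n<N. w n x) \<le> w n0 x + \<delta>" if "x \<in> ?Q" for x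
            proof -
              have "(\<Sum>n<N. w n x) \<le> (\<Sum>n<N. (if n = n0 then w n0 x else 0) + 4 / R)"
                using far n0[OF _ _ that] w R(1) by (intro sum_mono) auto
              also have "\<dots> \<le> w n0 x + real N * (4 / R)"
                using w by (simp add: sum.distrib)
              finally show ?thesis using R(3) by (simp add: mult.commute)
            qed
            then show ?thesis using that by blast
          qed
          let ?W = "\<integral>\<^sup>+y\<in>?Q. ennreal (w n0 y powr p) \<partial>lebesgue"
          have *: "?S \<le> ennreal (2 powr p * (b + \<delta> powr p * l ^ ?d))"
            if b: "?W \<le> ennreal b" "b \<ge> 0" for b
          proof -
            have "?S
              \<le> (\<integral>\<^sup>+y. ennreal (2 powr p) * (ennreal (w n0 y powr p) * indicator ?Q y + ennreal (\<delta> powr p) * indicator ?Q y) \<partial>lebesgue)"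
            proof (rule nn_integral_mono)
              fix y
              show "ennreal ((\<Sum>n<N. w n y) powr p) * indicator ?Q y \<le>
                ennreal (2 powr p) * (ennreal (w n0 y powr p) * indicator ?Q y + ennreal (\<delta> powr p) * indicator ?Q y)"
              proof (cases "y \<in> ?Q")
                case True
                have "(\<Sum>n<N. w n y) powr p \<le> (w n0 y + \<delta>) powr p"
                  using n0[OF True] w p by (intro powr_mono2 sum_nonneg) auto
                also have "\<dots> \<le> 2 powr p * (w n0 y powr p + \<delta> powr p)"
                  using w \<delta> p by (intro powr_add_le) auto
                finally have "ennreal ((\<Sum>n<N. w n y) powr p) \<le> ennreal \<dots>" by (rule ennreal_leI)
                with True show ?thesis by (simp add: ennreal_mult)
              qed simp
            qed
            also have "\<dots> = ennreal (2 powr p) * (?W + ennreal (\<delta> powr p) * ennreal (l ^ ?d))"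
              by (simp add: nn_integral_cmult nn_integral_add nn_integral_cmult_indicator eQ)
            also have "\<dots> \<le> ennreal (2 powr p) * (ennreal b + ennreal (\<delta> powr p) * ennreal (l ^ ?d))"
              using b by (intro mult_left_mono add_right_mono) auto
            also have "\<dots> = ennreal (2 powr p * (b + \<delta> powr p * l ^ ?d))"
              using b(2) l by (simp add: ennreal_mult)
            finally show ?thesis .
          qed
          have \<phi>\<delta>: "\<phi> l powr p * \<delta> powr p \<le> \<phi> (r i) powr p"
          proof -
            have "\<phi> l * \<delta> \<le> \<phi> (r i)"
              using mult_right_mono[OF growth_class_mono[OF \<phi> l lL], of \<delta>] \<delta> rK[OF i] by linarith
            then have "(\<phi> l * \<delta>) powr p \<le> \<phi> (r i) powr p"
              using p \<delta> growth_class_pos[OF \<phi> l] by (intro powr_mono2) auto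
            then show ?thesis using \<delta> growth_class_pos[OF \<phi> l] by (simp add: powr_mult)
          qed
          \<comment> \<open>Both growth conditions meet here. On cubes finer than the bump the
            weight is at most 1 and \<phi> is nondecreasing; on coarser cubes the whole mass
            \<open>J * r i ^ ?d\<close> is charged and \<open>growth_class_antimono\<close> balances
            it.\<close>
          obtain b where b: "b \<ge> 0" "?W \<le> ennreal b"
            "\<phi> l powr p * b \<le> \<phi> (r i) powr p * (J + 1) * l ^ ?d"
          proof (cases "l \<le> r i")
            case True
            have "?W \<le> (\<integral>\<^sup>+y. 1 * indicator ?Q y \<partial>lebesgue)"
              using w p by (intro nn_integral_mono mult_right_mono) (auto simp: powr_le1)
            also have "\<dots> = ennreal (l ^ ?d)" by (simp add: eQ)
            finally have 1: "?W \<le> ennreal (l ^ ?d)" .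
            have "\<phi> l powr p * 1 \<le> \<phi> (r i) powr p * (J + 1)"
              using growth_class_mono[OF \<phi> l True] p growth_class_pos[OF \<phi> l] J(1)
              by (intro mult_mono powr_mono2) auto
            then have "\<phi> l powr p * l ^ ?d \<le> \<phi> (r i) powr p * (J + 1) * l ^ ?d"
              using l by (intro mult_right_mono) auto
            with 1 l that[of "l ^ ?d"] show ?thesis by simp
          next
            case False
            have "?W \<le> (\<integral>\<^sup>+y. ennreal (w n0 y powr p) \<partial>lebesgue)"
              by (intro nn_integral_mono) (auto simp: indicator_def)
            then have 1: "?W \<le> ennreal (J * r i ^ ?d)"
              unfolding wint .
            have "\<phi> l powr p * (J * r i ^ ?d) = J * (\<phi> l powr p * r i ^ ?d)" by simp
            also have "\<dots> \<le> J * (\<phi> (r i) powr p * l ^ ?d)"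
              using growth_class_antimono[OF \<phi> p r(1)[of i], of l] False J(1) by (intro mult_left_mono) auto
            also have "\<dots> \<le> (J + 1) * (\<phi> (r i) powr p * l ^ ?d)"
              using l by (intro mult_right_mono) auto
            finally have "\<phi> l powr p * (J * r i ^ ?d) \<le> \<phi> (r i) powr p * (J + 1) * l ^ ?d"
              by (simp add: mult_ac)
            with 1 J(1) r(1)[of i] that[of "J * r i ^ ?d"] show ?thesis by simp
          qed
          let ?B = "2 powr p * (b + \<delta> powr p * l ^ ?d)"
          have "\<phi> l powr p * ?B = 2 powr p * (\<phi> l powr p * b + \<phi> l powr p * \<delta> powr p * l ^ ?d)"
            by (simp add: algebra_simps)
          also have "\<dots> \<le> 2 powr p * (\<phi> (r i) powr p * (J + 1) * l ^ ?d + \<phi> (r i) powr p * l ^ ?d)"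
            using b(3) \<phi>\<delta> l by (intro mult_left_mono add_mono mult_right_mono) auto
          also have "\<dots> = C powr p * \<phi> (r i) powr p * l ^ ?d"
            by (simp add: Cp algebra_simps)
          also have "\<dots> = (C * \<phi> (r i)) powr p * l ^ ?d"
            using C growth_class_pos[OF \<phi> r(1)[of i]] by (simp add: powr_mult)
          finally show ?thesis
            using *[OF b(2,1)] b(1) l by (intro exI[of _ ?B]) auto
        qed
        then obtain B where B: "B \<ge> 0" "?S \<le> ennreal B"
            "\<phi> l powr p * B \<le> (C * \<phi> (r i)) powr p * l ^ ?d" by blast
        have "(\<integral>\<^sup>+y\<in>?Q. ennreal (norm (h y) powr p) \<partial>lebesgue)
            \<le> (\<integral>\<^sup>+y. ennreal (A powr p) * (ennreal ((\<Sum>n<N. w n y) powr p) * indicator ?Q y) \<partial>lebesgue)"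
          using hw by (intro nn_integral_mono) (auto simp: indicator_def ennreal_mult[symmetric] intro!: ennreal_leI)
        also have "\<dots> = ennreal (A powr p) * ?S"
          by (rule nn_integral_cmult) measurable
        also have "\<dots> \<le> ennreal (A powr p) * ennreal B"
          by (intro mult_left_mono B) auto
        also have "\<dots> = ennreal (A powr p * B)" using B(1) by (simp add: ennreal_mult)
        finally have 1: "(\<integral>\<^sup>+y\<in>?Q. ennreal (norm (h y) powr p) \<partial>lebesgue) \<le> ennreal (A powr p * B)" .
        have "\<phi> l powr p * (A powr p * B) = A powr p * (\<phi> l powr p * B)" by simp
        also have "\<dots> \<le> A powr p * ((C * \<phi> (r i)) powr p * l ^ ?d)"
          by (intro mult_left_mono B) auto
        also have "\<dots> = (C * A * \<phi> (r i)) powr p * l ^ ?d"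
          using A C growth_class_pos[OF \<phi> r(1)[of i]] by (simp add: powr_mult)
        finally show "\<exists>B\<ge>0. (\<integral>\<^sup>+y\<in>?Q. ennreal (norm (h y) powr p) \<partial>lebesgue) \<le> ennreal B \<and>
            \<phi> (2 powi (-j)) powr p * B \<le> (C * A * \<phi> (2 powr (- real i))) powr p * (2 powi (-j)) ^ ?d"
          using 1 B(1) by (intro exI[of _ "A powr p * B"]) (auto simp: l_def r_def)
      qed
    qed
  qed
qed

subsection \<open>Sequence spaces\<close>

text \<open>Says that the section \<open>i \<le> K\<close> lies in the unit ball; the root is
  dropped because the bound is 1.\<close>

definition lq_unit :: "ennreal \<Rightarrow> nat \<Rightarrow> (nat \<Rightarrow> real) \<Rightarrow> bool" where
  "lq_unit q K v \<longleftrightarrow> (\<forall>i. v i \<ge> 0) \<and>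
     (if q = \<infinity> then \<forall>i\<le>K. v i \<le> 1 else (\<Sum>i\<le>K. v i powr enn2real q) \<le> 1)"

text \<open>Each \<open>k\<close> sees at most \<open>2 * c + 1\<close> indices \<open>i\<close>,
  and conversely. Powers of such short sums are handled by \<open>powr_sum_le\<close>, exponents
  below 1 included, and the double sum is interchanged. The constant depends on \<open>q\<close> and
  \<open>c\<close> only.\<close>

lemma lq_norm_banded:
  assumes "0 < q"
  obtains C where "C > 0"
    "\<And>K v D a. lq_unit q K v \<Longrightarrow> D \<ge> 0 \<Longrightarrow>
      (\<And>k. a k \<le> ennreal (D * (\<Sum>i | i \<le> K \<and> i \<le> k + c \<and> k \<le> i + c. v i))) \<Longrightarrow>
      lq_norm q a \<le> ennreal (C * D)"
proof -
  define I where "I K k = {i. i \<le> K \<and> i \<le> k + c \<and> k \<le> i + c}" for K k :: nat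
  define c1 where "c1 = real (2 * c + 1)"
  have c1: "c1 \<ge> 1" by (simp add: c1_def)
  have finI: "finite (I K k)" for K k by (rule finite_subset[of _ "{..K}"]) (auto simp: I_def)
  have "I K k \<subseteq> {k - c..k + c}" for K k by (auto simp: I_def)
  then have "card (I K k) \<le> card {k - c..k + c}" for K k by (intro card_mono) auto
  then have "card (I K k) \<le> 2 * c + 1" for K k by (rule order_trans) auto
  then have cardI: "real (card (I K k)) \<le> c1" for K k unfolding c1_def using of_nat_mono by blast
  show ?thesis
  proof (cases "q = \<infinity>")
    case True
    show ?thesis
    proof (rule that[of c1])
      fix K v D and a :: "nat \<Rightarrow> ennreal"
      assume unit: "lq_unit q K v" and D: "D \<ge> 0"
        and a: "\<And>k. a k \<le> ennreal (D * (\<Sum>i | i \<le> K \<and> i \<le> k + c \<and> k \<le> i + c. v i))"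
      have "a k \<le> ennreal (c1 * D)" for k
      proof -
        have "(\<Sum>i\<in>I K k. v i) \<le> real (card (I K k)) * 1"
          using unit True by (intro sum_bounded_above) (auto simp: lq_unit_def I_def)
        also have "\<dots> \<le> c1" using cardI by simp
        finally have "D * (\<Sum>i\<in>I K k. v i) \<le> c1 * D" using D by (simp add: mult_left_mono mult.commute)
        with a[of k] show ?thesis unfolding I_def by (meson ennreal_leI order_trans)
      qed
      then show "lq_norm q a \<le> ennreal (c1 * D)"
        using True by (auto simp: lq_norm_def intro: SUP_least)
    qed (use c1 in auto)
  next
    case False
    define r where "r = enn2real q"
    have r: "r > 0" using False assms by (cases q) (auto simp: r_def)
    \<comment> \<open>\<open>c1 powr r\<close> is the loss in the power of a sum of at most
      \<open>c1\<close> terms; the other \<open>c1\<close> arises because each \<open>i\<close>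
      enters at most \<open>c1\<close> bands.\<close>
    define C where "C = (c1 powr r * c1) powr (1 / r)"
    show ?thesis
    proof (rule that[of C])
      show "C > 0" using c1 by (simp add: C_def)
      fix K v D and a :: "nat \<Rightarrow> ennreal"
      assume unit: "lq_unit q K v" and D: "D \<ge> 0"
        and a: "\<And>k. a k \<le> ennreal (D * (\<Sum>i | i \<le> K \<and> i \<le> k + c \<and> k \<le> i + c. v i))"
      have v: "v i \<ge> 0" for i using unit by (simp add: lq_unit_def)
      have v1: "(\<Sum>i\<le>K. v i powr r) \<le> 1" using unit False by (simp add: lq_unit_def r_def)
      have bound: "enn_powr (a k) r \<le> ennreal (D powr r * c1 powr r * (\<Sum>i\<in>I K k. v i powr r))" for k
      proof -
        have "enn_powr (a k) r \<le> enn_powr (ennreal (D * (\<Sum>i\<in>I K k. v i))) r"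
          using a[of k] r unfolding I_def by (intro enn_powr_mono) auto
        also have "\<dots> = ennreal (D powr r * (\<Sum>i\<in>I K k. v i) powr r)"
          using D v by (simp add: enn_powr_ennreal sum_nonneg powr_mult)
        also have "\<dots> \<le> ennreal (D powr r * (c1 powr r * (\<Sum>i\<in>I K k. v i powr r)))"
        proof (intro ennreal_leI mult_left_mono)
          have "(\<Sum>i\<in>I K k. v i) powr r \<le> real (card (I K k)) powr r * (\<Sum>i\<in>I K k. v i powr r)"
            using v r by (intro powr_sum_le finI)
          also have "\<dots> \<le> c1 powr r * (\<Sum>i\<in>I K k. v i powr r)"
            using cardI r by (intro mult_right_mono powr_mono2 sum_nonneg) auto
          finally show "(\<Sum>i\<in>I K k. v i) powr r \<le> c1 powr r * (\<Sum>i\<in>I K k. v i powr r)" .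
        qed simp
        finally show ?thesis by (simp add: mult.assoc)
      qed
      have zero: "enn_powr (a k) r = 0" if "k \<notin> {..K + c}" for k
      proof -
        have "I K k = {}" using that by (auto simp: I_def)
        with bound[of k] show ?thesis by simp
      qed
      have swap: "(\<Sum>k\<le>K + c. \<Sum>i\<in>I K k. v i powr r) \<le> c1"
      proof -
        have "(\<Sum>k\<le>K + c. \<Sum>i\<in>I K k. v i powr r) = (\<Sum>k\<le>K + c. \<Sum>i | i \<in> {..K} \<and> (i \<le> k + c \<and> k \<le> i + c). v i powr r)"
          by (simp add: I_def)
        also have "\<dots> = (\<Sum>i\<le>K. \<Sum>k | k \<in> {..K + c} \<and> (i \<le> k + c \<and> k \<le> i + c). v i powr r)"
          by (rule sum.swap_restrict) auto
        also have "\<dots> \<le> (\<Sum>i\<le>K. c1 * v i powr r)"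
        proof (rule sum_mono)
          fix i
          \<comment> \<open>The band relation is symmetric, so the count of \<open>i\<close> for
            given \<open>k\<close> also counts \<open>k\<close> for given \<open>i\<close>.\<close>
          have "{k \<in> {..K + c}. i \<le> k + c \<and> k \<le> i + c} = I (K + c) i" by (auto simp: I_def)
          then show "(\<Sum>k | k \<in> {..K + c} \<and> (i \<le> k + c \<and> k \<le> i + c). v i powr r) \<le> c1 * v i powr r"
            using cardI[of "K + c" i] by (simp add: mult_right_mono)
        qed
        also have "\<dots> \<le> c1 * 1"
          unfolding sum_distrib_left[symmetric] using v1 c1 by (intro mult_left_mono) auto
        finally show ?thesis by simp
      qed
      have "(\<Sum>k. enn_powr (a k) r) = (\<Sum>k\<le>K + c. enn_powr (a k) r)"
        using zero by (intro suminf_finite) auto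
      also have "\<dots> \<le> (\<Sum>k\<le>K + c. ennreal (D powr r * c1 powr r * (\<Sum>i\<in>I K k. v i powr r)))"
        by (intro sum_mono bound)
      also have "\<dots> = ennreal (\<Sum>k\<le>K + c. D powr r * c1 powr r * (\<Sum>i\<in>I K k. v i powr r))"
        by (intro sum_ennreal mult_nonneg_nonneg sum_nonneg) auto
      also have "\<dots> \<le> ennreal (D powr r * c1 powr r * c1)"
        unfolding sum_distrib_left[symmetric] by (intro ennreal_leI mult_left_mono swap) auto
      finally have "enn_powr (\<Sum>k. enn_powr (a k) r) (1 / r) \<le> enn_powr (ennreal (D powr r * c1 powr r * c1)) (1 / r)"
        using r by (intro enn_powr_mono) auto
      also have "\<dots> = ennreal (C * D)"
        using r D c1 by (simp add: enn_powr_ennreal C_def powr_mult powr_powr)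
      finally show "lq_norm q a \<le> ennreal (C * D)"
        using False by (simp add: lq_norm_def r_def)
    qed
  qed
qed

section \<open>Converse Hoelder inequality on finite sections\<close>

lemma partial_sums_unbounded:
  assumes "\<And>j. g j \<ge> 0" "(\<Sum>j. ennreal (g j)) = \<infinity>"
  obtains K where "M \<le> (\<Sum>i\<le>K. g i)"
proof (rule ccontr)
  assume "\<not> thesis"
  then have le: "(\<Sum>i\<le>K. g i) \<le> M" for K using that by (meson linear)
  have "(\<Sum>j. ennreal (g j)) \<le> ennreal M"
    unfolding suminf_eq_SUP
  proof (rule SUP_least)
    fix n
    have "(\<Sum>i<n. ennreal (g i)) = ennreal (\<Sum>i<n. g i)" using assms(1) by (intro sum_ennreal) auto
    also have "\<dots> \<le> ennreal (\<Sum>i\<le>n. g i)" using assms(1) by (intro ennreal_leI sum_mono2) auto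
    also have "\<dots> \<le> ennreal M" by (intro ennreal_leI le)
    finally show "(\<Sum>i<n. ennreal (g i)) \<le> ennreal M" .
  qed
  with assms(2) show False by (simp add: top_unique)
qed

lemma lq_norm_infinite_imp_sum:
  assumes r: "r > 0" and b: "\<And>j. b j \<ge> 0" and inf: "b \<notin> lq_space (ennreal r)"
  shows "(\<Sum>j. ennreal (b j powr r)) = \<infinity>"
proof (rule ccontr)
  assume fin: "(\<Sum>j. ennreal (b j powr r)) \<noteq> \<infinity>"
  have "lq_norm (ennreal r) (\<lambda>j. ennreal \<bar>b j\<bar>) = enn_powr (\<Sum>j. ennreal (b j powr r)) (1 / r)"
    using r b by (simp add: lq_norm_def enn_powr_ennreal)
  also have "\<dots> < \<infinity>" using fin by (simp add: enn_powr_def)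
  finally show False using inf by (simp add: lq_space_def)
qed

lemma conj_exponent_top: "conj_exponent \<infinity> = ennreal 1"
  by (simp add: conj_exponent_def)

lemma conj_exponent_le_1:
  assumes "0 < r" "r \<le> 1"
  shows "conj_exponent (ennreal r) = \<infinity>"
proof -
  have "1 \<le> inverse (ennreal r)" using assms by (simp add: inverse_ennreal one_le_inverse)
  then have "1 - inverse (ennreal r) = 0" by (simp add: diff_eq_0_iff_ennreal)
  then show ?thesis by (simp add: conj_exponent_def)
qed

lemma conj_exponent_gt_1:
  assumes "r > 1"
  shows "conj_exponent (ennreal r) = ennreal (r / (r - 1))"
proof -
  have "1 - inverse (ennreal r) = ennreal (1 - 1 / r)"
    using assms by (simp add: inverse_ennreal divide_inverse ennreal_minus flip: ennreal_1)
  then show ?thesis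
    using assms by (simp add: conj_exponent_def inverse_ennreal field_simps)
qed

text \<open>The witness \<open>v\<close> depends on the dual exponent: constant 1 for
  \<open>q = \<infinity>\<close>, where the sum of \<open>b\<close> diverges; a unit sequence for
  \<open>q \<le> 1\<close>, where \<open>b\<close> is unbounded; and the extremal sequence of
  Hoelder's inequality in between.\<close>

lemma lq_duality:
  assumes q: "0 < q" and b: "\<And>j. b j > 0" and inf: "b \<notin> lq_space (conj_exponent q)"
  obtains K v where "lq_unit q K v" "M \<le> (\<Sum>i\<le>K. v i * b i)"
proof (cases "q = \<infinity>")
  case True
  have "b \<notin> lq_space (ennreal 1)" using inf unfolding True conj_exponent_top .
  then have "(\<Sum>j. ennreal (b j powr 1)) = \<infinity>"
    using b by (intro lq_norm_infinite_imp_sum) (auto simp: less_imp_le)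
  then obtain K where "M \<le> (\<Sum>i\<le>K. b i)"
    using partial_sums_unbounded[of b M] b by (auto simp: less_imp_le)
  with True that[of K "\<lambda>_. 1"] show ?thesis by (simp add: lq_unit_def)
next
  case False
  with q obtain r where r: "r > 0" "q = ennreal r" by (cases q) auto
  show ?thesis
  proof (cases "r \<le> 1")
    case True
    have sup: "\<not> (SUP j. ennreal (b j)) < \<infinity>"
      using inf b unfolding r(2) conj_exponent_le_1[OF r(1) True]
      by (simp add: lq_space_def lq_norm_def abs_of_pos)
    obtain j where "ennreal M < ennreal (b j)"
    proof (rule ccontr)
      assume "\<not> thesis"
      then have "ennreal (b j) \<le> ennreal M" for j using that by (meson not_le)
      then have "(SUP j. ennreal (b j)) \<le> ennreal M" by (intro SUP_least)
      with sup show False by (simp add: le_less_trans)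
    qed
    \<comment> \<open>A negative \<open>M\<close> is truncated by \<open>ennreal\<close>, but then
      positivity of \<open>b j\<close> settles the claim.\<close>
    then have "M \<le> b j" using ennreal_less_iff[of M "b j"] b[of j] by (cases "M \<ge> 0") auto
    with that[of j "\<lambda>i. if i = j then 1 else 0"] r show ?thesis
      by (simp add: lq_unit_def if_distrib[of "\<lambda>x. x powr r"] if_distrib[of "\<lambda>x. x * b _"] sum.If_cases)
  next
    case False
    define r' where "r' = r / (r - 1)"
    have r': "r' > 1" "(r' - 1) * r = r'" "1 - 1 / r = 1 / r'"
      using False by (auto simp: r'_def field_simps)
    have "(\<Sum>j. ennreal (b j powr r')) = \<infinity>"
      using inf b r r' False
      by (intro lq_norm_infinite_imp_sum) (auto simp: conj_exponent_gt_1 r'_def less_imp_le)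
    \<comment> \<open>The 1 keeps \<open>S\<close> positive; the power of
      \<open>\<bar>M\<bar>\<close> anticipates the root \<open>1 / r'\<close> that the pairing with
      \<open>v\<close> produces.\<close>
    then obtain K where K: "max 1 (\<bar>M\<bar> powr r') \<le> (\<Sum>i\<le>K. b i powr r')"
      using partial_sums_unbounded[of "\<lambda>j. b j powr r'" "max 1 (\<bar>M\<bar> powr r')"] by auto
    define S where "S = (\<Sum>i\<le>K. b i powr r')"
    have S: "S \<ge> 1" "\<bar>M\<bar> powr r' \<le> S" using K by (auto simp: S_def)
    \<comment> \<open>Equality case of Hoelder's inequality, normalised:
      \<open>(r' - 1) * r = r'\<close> makes the r-th powers sum to 1, and the pairing with
      \<open>b\<close> becomes \<open>S powr (1 / r')\<close>.\<close>
    define v where "v i = b i powr (r' - 1) * S powr (- (1 / r))" for i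
    have "(\<Sum>i\<le>K. v i powr r) = (\<Sum>i\<le>K. b i powr r' * S powr (-1))"
      using r(1) r'(2) S by (simp add: v_def powr_mult powr_powr)
    also have "\<dots> = S * S powr (-1)" by (simp only: S_def sum_distrib_right)
    also have "\<dots> = 1" using S by (simp add: powr_minus)
    finally have "lq_unit q K v" using r by (simp add: lq_unit_def v_def)
    moreover have "M \<le> (\<Sum>i\<le>K. v i * b i)"
    proof -
      have "b i powr (r' - 1) * b i = b i powr r'" for i
        using b[of i] by (simp add: powr_diff)
      then have "v i * b i = b i powr r' * S powr (- (1 / r))" for i
        by (simp add: v_def mult_ac)
      then have "(\<Sum>i\<le>K. v i * b i) = S * S powr (- (1 / r))" by (simp add: S_def sum_distrib_right)
      also have "\<dots> = S powr 1 * S powr (- (1 / r))" using S by simp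
      also have "\<dots> = S powr (1 / r')" unfolding powr_add[symmetric] using r'(3) by simp
      finally have eq: "(\<Sum>i\<le>K. v i * b i) = S powr (1 / r')" .
      have "M \<le> (\<bar>M\<bar> powr r') powr (1 / r')" using r'(1) by (simp add: powr_powr)
      also have "\<dots> \<le> S powr (1 / r')" using S r'(1) by (intro powr_mono2) auto
      finally show ?thesis using eq by simp
    qed
    ultimately show ?thesis by (rule that)
  qed
qed

subsection \<open>Distributions represented by Schwartz functions\<close>

lemma schwartz_cmult:
  fixes f :: "real^'n::finite \<Rightarrow> complex"
  shows "f \<in> schwartz \<Longrightarrow> (\<lambda>x. c * f x) \<in> schwartz"
  by (rule schwartz_bounded_linear[OF _ bounded_linear_mult_right])

lemma schwartz_sum:
  assumes "\<And>j. j \<in> J \<Longrightarrow> f j \<in> schwartz"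
  shows "(\<lambda>x. \<Sum>j\<in>J. f j x) \<in> schwartz"
  using assms by (induction J rule: infinite_finite_induct) (auto intro: schwartz_zero schwartz_add)

definition schwartz_dist :: "(real^'n::finite \<Rightarrow> complex) \<Rightarrow> (real^'n \<Rightarrow> complex) \<Rightarrow> complex" where
  "schwartz_dist f = (\<lambda>\<psi>\<in>schwartz. \<integral>x. f x * \<psi> x \<partial>lborel)"

lemma schwartz_locally_integrable:
  fixes f :: "real^'n::finite \<Rightarrow> complex"
  assumes f: "f \<in> schwartz"
  shows "locally_integrable f"
  unfolding locally_integrable_def set_integrable_def
proof (intro allI impI)
  fix K :: "(real^'n) set" assume "compact K"
  then have "K \<in> sets lebesgue" by (simp add: borel_compact)
  moreover have "integrable lebesgue f"
    using schwartz_integrable[OF f] schwartz_measurable[OF f] by (simp add: integrable_completion)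
  ultimately show "integrable lebesgue (\<lambda>x. indicat_real K x *\<^sub>R f x)"
    by (rule integrable_mult_indicator)
qed

lemma integral_lebesgue_schwartz:
  fixes f g :: "real^'n::finite \<Rightarrow> complex"
  assumes "f \<in> schwartz" "g \<in> schwartz"
  shows "(\<integral>x. f x * g x \<partial>lebesgue) = (\<integral>x. f x * g x \<partial>lborel)"
  using schwartz_measurable[OF schwartz_mult[OF assms]] by (intro integral_completion) simp

lemma represents_schwartz_dist:
  fixes f :: "real^'n::finite \<Rightarrow> complex"
  assumes "f \<in> schwartz"
  shows "represents f (schwartz_dist f)"
  using assms by (auto simp: represents_def schwartz_dist_def schwartz_locally_integrable integral_lebesgue_schwartz)

lemma tempered_schwartz_dist:
  fixes f :: "real^'n::finite \<Rightarrow> complex"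
  assumes f: "f \<in> schwartz"
  shows "schwartz_dist f \<in> tempered_distributions"
proof -
  note int = schwartz_integrable[OF schwartz_mult[OF f]]
  have "schwartz_dist f (\<lambda>x. \<psi> x + \<theta> x) = schwartz_dist f \<psi> + schwartz_dist f \<theta>"
    if "\<psi> \<in> schwartz" "\<theta> \<in> schwartz" for \<psi> \<theta>
    using that int[OF that(1)] int[OF that(2)] schwartz_add[OF that]
    by (simp add: schwartz_dist_def distrib_left)
  moreover have "schwartz_dist f (\<lambda>x. c * \<psi> x) = c * schwartz_dist f \<psi>" if "\<psi> \<in> schwartz" for c \<psi>
    using that schwartz_cmult[OF that, of c] by (simp add: schwartz_dist_def mult.left_commute)
  moreover have "norm (schwartz_dist f \<psi>) \<le>
      (\<integral>x. norm (f x) \<partial>lborel) * (\<Sum>\<alpha> | length \<alpha> \<le> 0. schwartz_seminorm 0 \<alpha> \<psi>)" if \<psi>: "\<psi> \<in> schwartz" for \<psi>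
  proof -
    have sup: "norm (\<psi> x) \<le> schwartz_seminorm 0 [] \<psi>" for x
    proof -
      obtain C where "\<And>x. (1 + norm x) ^ 0 * norm (\<psi> x) \<le> C" by (blast intro: schwartz_decay[OF \<psi>, of 0])
      then have "bdd_above (range (\<lambda>x. norm (\<psi> x)))" by (intro bdd_aboveI2) simp
      from cSUP_upper[OF UNIV_I this] show ?thesis by (simp add: schwartz_seminorm_def)
    qed
    have "norm (schwartz_dist f \<psi>) \<le> (\<integral>x. norm (f x * \<psi> x) \<partial>lborel)"
      unfolding schwartz_dist_def using \<psi> by (simp add: integral_norm_bound)
    also have "\<dots> \<le> (\<integral>x. norm (f x) * schwartz_seminorm 0 [] \<psi> \<partial>lborel)"
      using int[OF \<psi>] schwartz_integrable[OF f] sup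
      by (intro integral_mono integrable_norm integrable_mult_left) (auto simp: norm_mult intro: mult_left_mono)
    also have "\<dots> = (\<integral>x. norm (f x) \<partial>lborel) * (\<Sum>\<alpha> | length \<alpha> \<le> 0. schwartz_seminorm 0 \<alpha> \<psi>)"
      by simp
    finally show ?thesis .
  qed
  moreover have "schwartz_dist f \<in> extensional schwartz" by (simp add: schwartz_dist_def)
  ultimately show ?thesis unfolding tempered_distributions_def by blast
qed

text \<open>Both transforms and the multiplier are moved onto the test function by the
  multiplication formulas. Inversion is applied to the Schwartz function \<open>h\<close> alone,
  which is how the unspecified constant \<open>c\<close> enters.\<close>

lemma represents_fourier_multiplier:
  fixes G g :: "real^'n::finite \<Rightarrow> complex"
  assumes inversion: "\<And>h (x::real^'n). h \<in> schwartz \<Longrightarrow> fourier_inv (fourier h) x = c * h x"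
    and G: "G \<in> schwartz" and g: "g \<in> schwartz"
  shows "represents (\<lambda>x. c * fourier_inv (\<lambda>\<xi>. g \<xi> * G \<xi>) x)
    (dist_fourier_inv (dist_mult g (dist_fourier (schwartz_dist (fourier_inv G)))))"
proof -
  let ?F = "\<lambda>x. c * fourier_inv (\<lambda>\<xi>. g \<xi> * G \<xi>) x"
  have gG: "(\<lambda>\<xi>. g \<xi> * G \<xi>) \<in> schwartz" by (rule schwartz_mult[OF g G])
  have F: "?F \<in> schwartz" by (intro schwartz_cmult schwartz_fourier_inv gG)
  have "dist_fourier_inv (dist_mult g (dist_fourier (schwartz_dist (fourier_inv G)))) \<psi>
      = (\<integral>x. ?F x * \<psi> x \<partial>lebesgue)" if \<psi>: "\<psi> \<in> schwartz" for \<psi>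
  proof -
    define h where "h = (\<lambda>x. g x * fourier_inv \<psi> x)"
    have h: "h \<in> schwartz" unfolding h_def by (intro schwartz_mult g schwartz_fourier_inv \<psi>)
    have "dist_fourier_inv (dist_mult g (dist_fourier (schwartz_dist (fourier_inv G)))) \<psi>
        = (\<integral>x. fourier_inv G x * fourier h x \<partial>lborel)"
      using \<psi> h schwartz_fourier_inv[OF \<psi>] schwartz_fourier[OF h]
      by (simp add: dist_fourier_inv_def dist_mult_def dist_fourier_def schwartz_dist_def h_def)
    also have "\<dots> = (\<integral>x. G x * fourier_inv (fourier h) x \<partial>lborel)"
      by (intro integral_fourier_inv_swap[symmetric] schwartz_integrable G schwartz_fourier h)
    also have "\<dots> = c * (\<integral>x. (g x * G x) * fourier_inv \<psi> x \<partial>lborel)"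
      unfolding inversion[OF h] by (simp add: h_def mult_ac flip: integral_mult_right_zero)
    also have "\<dots> = c * (\<integral>x. fourier_inv (\<lambda>\<xi>. g \<xi> * G \<xi>) x * \<psi> x \<partial>lborel)"
      by (intro arg_cong[of _ _ "\<lambda>z. c * z"] integral_fourier_inv_swap schwartz_integrable gG \<psi>)
    also have "\<dots> = (\<integral>x. ?F x * \<psi> x \<partial>lborel)"
      by (simp add: mult.assoc flip: integral_mult_right_zero)
    finally show ?thesis by (simp add: integral_lebesgue_schwartz[OF F \<psi>])
  qed
  then show ?thesis using schwartz_locally_integrable[OF F] by (simp add: represents_def)
qed

section \<open>Independence of the selected representative\<close>

lemma integral_pos_of_continuous:
  fixes f :: "'a::euclidean_space \<Rightarrow> real"
  assumes "integrable lborel f" "continuous_on UNIV f" "\<And>x. f x \<ge> 0" "f a > 0"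
  shows "(\<integral>x. f x \<partial>lborel) > 0"
proof (rule ccontr)
  assume "\<not> ?thesis"
  moreover have "(\<integral>x. f x \<partial>lborel) \<ge> 0" using assms(3) by simp
  ultimately have "(\<integral>x. f x \<partial>lborel) = 0" by linarith
  then have "AE x in lborel. f x = 0"
    using integral_nonneg_eq_0_iff_AE[OF assms(1)] assms(3) by simp
  then have "AE x in lebesgue. f x = 0" by (rule AE_completion)
  moreover have op: "open {x. f x \<noteq> 0}"
    using assms(2) by (intro open_Collect_neq continuous_on_const)
  then have "{x. f x \<noteq> 0} \<in> sets lebesgue" by simp
  ultimately have "negligible {x. f x \<noteq> 0}"
    by (subst negligible_iff_null_sets) (simp add: AE_iff_null)
  moreover have "a \<in> {x. f x \<noteq> 0}" using assms(4) by simp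
  ultimately show False using open_not_negligible[OF op] by blast
qed

lemma represents_regular_fun: "represents f T \<Longrightarrow> represents (regular_fun T) T"
  unfolding regular_fun_def by (rule someI[of "\<lambda>f. represents f T"])

lemma dist_morrey_norm_eq:
  fixes f :: "real^'n::finite \<Rightarrow> complex" and \<kappa> :: "real^'n \<Rightarrow> real"
  assumes f: "represents f T"
    and \<kappa>: "\<kappa> \<in> schwartz" "\<And>x. \<kappa> x \<ge> 0" "(\<integral>x. \<kappa> x \<partial>lborel) > 0" "compact (supp \<kappa>)"
  shows "dist_morrey_norm \<phi> p T = morrey_norm \<phi> p f"
  using f morrey_norm_cong_AE[OF represents_unique[OF represents_regular_fun[OF f] f \<kappa>]]
  by (auto simp: dist_morrey_norm_def regular_def)

text \<open>The selected representative agrees with \<open>f\<close> only almost everywhere. It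
  inherits measurability because Lebesgue measure is complete, and its superlevel sets at heights
  below \<open>Y\<close> contain \<open>S\<close> up to a null set.\<close>

lemma rearrangement_regular_fun_ge:
  fixes f :: "real^'n::finite \<Rightarrow> complex" and \<kappa> :: "real^'n \<Rightarrow> real"
  assumes f: "represents f T" "f \<in> borel_measurable lebesgue"
    and \<kappa>: "\<kappa> \<in> schwartz" "\<And>x. \<kappa> x \<ge> 0" "(\<integral>x. \<kappa> x \<partial>lborel) > 0" "compact (supp \<kappa>)"
    and S: "S \<in> sets lebesgue" "ennreal t < emeasure lebesgue S" "\<And>x. x \<in> S \<Longrightarrow> Y \<le> norm (f x)"
  shows "ennreal Y \<le> rearrangement (regular_fun T) t"
  unfolding rearrangement_def
proof (rule Inf_greatest, clarify)
  fix \<sigma> :: real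
  let ?g = "regular_fun T"
  assume \<sigma>: "\<sigma> > 0" "emeasure lebesgue {x. norm (?g x) > \<sigma>} \<le> ennreal t"
  show "ennreal Y \<le> ennreal \<sigma>"
  proof (rule ccontr)
    assume "\<not> ?thesis"
    then have "\<sigma> < Y" using ennreal_leI by (meson not_le)
    have ae: "AE x in lebesgue. f x = ?g x"
      by (rule represents_unique[OF f(1) represents_regular_fun[OF f(1)] \<kappa>])
    then have "?g \<in> borel_measurable lebesgue"
      using borel_measurable_AE[OF f(2)] by simp
    then have "(\<lambda>x. norm (?g x)) \<in> borel_measurable lebesgue"
      by (rule measurable_compose) simp
    then have gm: "{x. norm (?g x) > \<sigma>} \<in> sets lebesgue"
      unfolding borel_measurable_iff_greater by simp
    have "emeasure lebesgue S \<le> emeasure lebesgue {x. norm (?g x) > \<sigma>}"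
    proof (rule emeasure_mono_AE)
      show "AE x in lebesgue. x \<in> S \<longrightarrow> x \<in> {x. norm (?g x) > \<sigma>}"
        using ae by eventually_elim (use S(3) \<open>\<sigma> < Y\<close> in force)
    qed (rule gm)
    with S(2) \<sigma>(2) show False by (meson leD order_trans)
  qed
qed

text \<open>Frequency-side form of a dilation and translation: its inverse transform is
  \<open>fourier_inv u\<close> evaluated at \<open>2 ^ i *\<^sub>R (x - X)\<close>.\<close>

definition dilate :: "nat \<Rightarrow> real^'n::finite \<Rightarrow> (real^'n \<Rightarrow> complex) \<Rightarrow> real^'n \<Rightarrow> complex" where
  "dilate i X u \<xi> = of_real ((1 / 2 ^ i) ^ CARD('n)) * (cis (- (\<xi> \<bullet> X)) * u ((1 / 2 ^ i) *\<^sub>R \<xi>))"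

lemma schwartz_dilate:
  fixes u :: "real^'n::finite \<Rightarrow> complex"
  assumes u: "u \<in> schwartz"
  shows "dilate i X u \<in> schwartz"
  using schwartz_cmult[OF schwartz_modulation[OF schwartz_affine[OF u, of "1 / 2 ^ i" 0]]]
  unfolding dilate_def[abs_def] by simp

lemma fourier_inv_dilate:
  fixes u :: "real^'n::finite \<Rightarrow> complex"
  assumes u: "u \<in> schwartz"
  shows "fourier_inv (dilate i X u) x = fourier_inv u (2 ^ i *\<^sub>R (x - X))"
proof -
  let ?z = "2 ^ i *\<^sub>R (x - X)"
  have z: "?z \<bullet> ((1 / 2 ^ i) *\<^sub>R \<xi>) = x \<bullet> \<xi> - \<xi> \<bullet> X" for \<xi>
    by (simp add: inner_diff_left inner_diff_right inner_commute)
  have int: "integrable lborel (\<lambda>\<xi>. cis (?z \<bullet> \<xi>) * u \<xi>)"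
    using schwartz_integrable[OF schwartz_modulation[OF u, of "- ?z"]] by (simp add: inner_commute)
  have "(\<integral>\<xi>. cis (?z \<bullet> \<xi>) * u \<xi> \<partial>lborel) = (1 / 2 ^ i) ^ CARD('n) *\<^sub>R
      (\<integral>\<xi>. cis (?z \<bullet> (0 + (1 / 2 ^ i) *\<^sub>R \<xi>)) * u (0 + (1 / 2 ^ i) *\<^sub>R \<xi>) \<partial>lborel)"
    using integral_affine[OF int, of "1 / 2 ^ i" 0] by simp
  also have "\<dots> = (\<integral>\<xi>. cis (x \<bullet> \<xi>) * dilate i X u \<xi> \<partial>lborel)"
    unfolding add_0 z dilate_def
    by (simp add: scaleR_conv_of_real cis_divide[symmetric] cis_cnj divide_inverse mult_ac
        flip: integral_mult_right_zero cis_inverse)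
  finally show ?thesis
    using schwartz_measurable[OF u] schwartz_measurable[OF schwartz_dilate[OF u]]
    by (simp add: fourier_inv_eq_lborel)
qed

lemma fourier_inv_cmult:
  fixes u :: "real^'n::finite \<Rightarrow> complex"
  shows "fourier_inv (\<lambda>\<xi>. c * u \<xi>) x = c * fourier_inv u x"
proof -
  have "exp (\<i> * complex_of_real (x \<bullet> \<xi>)) * (c * u \<xi>) = c * (exp (\<i> * complex_of_real (x \<bullet> \<xi>)) * u \<xi>)" for \<xi>
    by simp
  then show ?thesis
    unfolding fourier_inv_def by (simp only: integral_mult_right_zero mult.left_commute)
qed

lemma fourier_inv_sum:
  fixes u :: "'j \<Rightarrow> real^'n::finite \<Rightarrow> complex"
  assumes u: "\<And>j. j \<in> J \<Longrightarrow> u j \<in> schwartz"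
  shows "fourier_inv (\<lambda>\<xi>. \<Sum>j\<in>J. u j \<xi>) x = (\<Sum>j\<in>J. fourier_inv (u j) x)"
proof -
  have int: "integrable lborel (\<lambda>\<xi>. cis (x \<bullet> \<xi>) * u j \<xi>)" if "j \<in> J" for j
    using schwartz_integrable[OF schwartz_modulation[OF u[OF that], of "- x"]] by (simp add: inner_commute)
  have "(\<integral>\<xi>. cis (x \<bullet> \<xi>) * (\<Sum>j\<in>J. u j \<xi>) \<partial>lborel) = (\<Sum>j\<in>J. \<integral>\<xi>. cis (x \<bullet> \<xi>) * u j \<xi> \<partial>lborel)"
    unfolding sum_distrib_left by (rule Bochner_Integration.integral_sum) (rule int)
  moreover have "fourier_inv (u j) x = fourier_const TYPE('n) * (\<integral>\<xi>. cis (x \<bullet> \<xi>) * u j \<xi> \<partial>lborel)" if "j \<in> J" for j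
    by (rule fourier_inv_eq_lborel[OF schwartz_measurable[OF u[OF that]]])
  ultimately show ?thesis
    using schwartz_measurable[OF schwartz_sum[of J u, OF u]]
    by (simp add: fourier_inv_eq_lborel sum_distrib_left)
qed

subsection \<open>Sparse superpositions in Besov-Morrey spaces\<close>

text \<open>\<open>\<eta>\<close> lives in an annulus with radii \<open>r0\<close> and
  \<open>r1\<close>, \<open>\<eta>0\<close> in the ball of radius \<open>r1\<close>. Two dyadic
  copies of the annulus can meet only if their scales differ by a factor of at most
  \<open>r1 / r0\<close>, which is below \<open>2 ^ c\<close>.\<close>

lemma resolution_pair_bands:
  fixes \<eta>0 \<eta> :: "real^'n::finite \<Rightarrow> real"
  assumes rp: "resolution_pair \<eta>0 \<eta>"
  obtains c where "\<And>k i x. resolution \<eta>0 \<eta> k x * \<eta> ((1 / 2 ^ i) *\<^sub>R x) \<noteq> 0 \<Longrightarrow> i \<le> k + c \<and> k \<le> i + c"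
proof -
  have "open (- supp \<eta>)" "0 \<in> - supp \<eta>" "bounded (supp \<eta>)" "bounded (supp \<eta>0)"
    using rp by (auto simp: resolution_pair_def supp_def intro: compact_imp_bounded)
  then obtain r0 a b where r0: "r0 > 0" "ball 0 r0 \<subseteq> - supp \<eta>"
    and a: "a > 0" "\<forall>x\<in>supp \<eta>. norm x \<le> a" and b: "b > 0" "\<forall>x\<in>supp \<eta>0. norm x \<le> b"
    unfolding bounded_pos open_contains_ball by meson
  define r1 where "r1 = max a b"
  have r1: "r1 > 0" using a by (simp add: r1_def)
  have supp: "x \<in> supp f" if "f x \<noteq> 0" for f :: "real^'n \<Rightarrow> real" and x
    using that closure_subset[of "{x. f x \<noteq> 0}"] unfolding supp_def by blast
  have lo: "r0 \<le> norm x" if "\<eta> x \<noteq> 0" for x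
    using supp[of \<eta> x] that r0(2) by (auto simp: subset_iff not_less[symmetric])
  have hi: "norm x \<le> r1" if "\<eta> x \<noteq> 0" for x
    using supp[of \<eta> x] that a(2) by (force simp: r1_def)
  have hi0: "norm x \<le> r1" if "\<eta>0 x \<noteq> 0" for x
    using supp[of \<eta>0 x] that b(2) by (force simp: r1_def)
  obtain c where c: "r1 / r0 < 2 ^ c" using real_arch_pow[of 2 "r1 / r0"] by auto
  have cmp: "i \<le> k + c" if "r0 * 2 ^ i \<le> t" "t \<le> r1 * 2 ^ k" for i k :: nat and t
  proof -
    have "2 ^ i \<le> r1 / r0 * 2 ^ k" using that r0(1) by (simp add: field_simps)
    also have "\<dots> < 2 ^ c * 2 ^ k" using c by (intro mult_strict_right_mono) auto
    finally have "(2::real) ^ i < 2 ^ (k + c)" by (simp add: power_add mult.commute)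
    then show ?thesis by simp
  qed
  show ?thesis
  proof (rule that[of c])
    fix k i x assume "resolution \<eta>0 \<eta> k x * \<eta> ((1 / 2 ^ i) *\<^sub>R x) \<noteq> 0"
    then have ne: "resolution \<eta>0 \<eta> k x \<noteq> 0" "\<eta> ((1 / 2 ^ i) *\<^sub>R x) \<noteq> 0" by auto
    have i: "r0 * 2 ^ i \<le> norm x" "norm x \<le> r1 * 2 ^ i"
      using lo[OF ne(2)] hi[OF ne(2)] by (simp_all add: field_simps)
    show "i \<le> k + c \<and> k \<le> i + c"
    \<comment> \<open>For \<open>k = 0\<close> only an upper bound on \<open>norm x\<close> is
      available, but then \<open>k \<le> i + c\<close> is trivial.\<close>
    proof (cases "k = 0")
      case True
      then have "norm x \<le> r1 * 2 ^ k" using ne(1) hi0[of x] by (simp add: resolution_def)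
      from cmp[OF i(1) this] True show ?thesis by simp
    next
      case False
      then have "\<eta> ((1 / 2 ^ k) *\<^sub>R x) \<noteq> 0" using ne(1) by (simp add: resolution_def)
      from lo[OF this] hi[OF this] have "r0 * 2 ^ k \<le> norm x" "norm x \<le> r1 * 2 ^ k"
        by (simp_all add: field_simps)
      with cmp i show ?thesis by blast
    qed
  qed
qed

lemma finite_schwartz_bound:
  assumes "finite F" "F \<subseteq> (schwartz :: (real^'n::finite \<Rightarrow> complex) set)"
  shows "\<exists>A\<ge>0. \<forall>u\<in>F. \<forall>x. norm (u x) \<le> A * decay_weight m x"
  using assms
proof (induction F rule: finite_induct)
  case empty
  then show ?case by auto
next
  case (insert u F)
  then obtain A where A: "A \<ge> 0" "\<forall>u\<in>F. \<forall>x. norm (u x) \<le> A * decay_weight m x" by auto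
  from insert.prems have u: "u \<in> schwartz" by simp
  obtain B where B: "B \<ge> 0" "\<And>x. (1 + norm x) ^ m * norm (u x) \<le> B"
    using schwartz_decay[OF u, of m] by blast
  have Bu: "norm (u x) \<le> B * decay_weight m x" for x
  proof -
    have "(1 + norm x) ^ m > 0" by (simp add: add_pos_nonneg)
    then show ?thesis using B(2)[of x] by (simp add: decay_weight_def field_simps)
  qed
  have w: "decay_weight m x \<ge> 0" for x :: "real^'n" using decay_weight_pos[of m x] by simp
  have "\<forall>u\<in>insert u F. \<forall>x. norm (u x) \<le> (A + B) * decay_weight m x"
    using A B Bu w by (auto simp: distrib_right intro: add_increasing add_increasing2)
  with A(1) B(1) show ?case by (intro exI[of _ "A + B"]) auto
qed

lemma schwartz_resolution:
  assumes "resolution_pair \<eta>0 \<eta>"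
  shows "resolution \<eta>0 \<eta> k \<in> schwartz"
proof (cases "k = 0")
  case True
  then show ?thesis using assms by (simp add: resolution_pair_def resolution_def[abs_def])
next
  case False
  then show ?thesis
    using assms schwartz_affine[of \<eta> "1 / 2 ^ k" 0] by (simp add: resolution_pair_def resolution_def[abs_def])
qed

text \<open>The symbol of band \<open>k\<close> acting on the piece of scale \<open>i\<close>,
  pulled back by \<open>2 ^ i\<close> so that the factor \<open>\<eta>\<close> no longer moves with
  \<open>i\<close>.\<close>

definition resolution_kernel ::
  "(real^'n::finite \<Rightarrow> real) \<Rightarrow> (real^'n \<Rightarrow> real) \<Rightarrow> nat \<Rightarrow> nat \<Rightarrow> real^'n \<Rightarrow> complex" where
  "resolution_kernel \<eta>0 \<eta> k i \<xi> = of_real (resolution \<eta>0 \<eta> k (2 ^ i *\<^sub>R \<xi>)) * of_real (\<eta> \<xi>)"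

lemma schwartz_resolution_kernel:
  assumes rp: "resolution_pair \<eta>0 \<eta>"
  shows "resolution_kernel \<eta>0 \<eta> k i \<in> schwartz"
  using schwartz_mult[OF schwartz_complex_of_real[OF schwartz_affine[OF schwartz_resolution[OF rp], of "2 ^ i" k 0]]
      schwartz_complex_of_real[of \<eta>]] rp
  unfolding resolution_kernel_def[abs_def] resolution_pair_def by simp

lemma resolution_mult_dilate:
  "of_real (resolution \<eta>0 \<eta> k \<xi>) * dilate i X (\<lambda>\<xi>. of_real (\<eta> \<xi>)) \<xi> = dilate i X (resolution_kernel \<eta>0 \<eta> k i) \<xi>"
  by (simp add: dilate_def resolution_kernel_def mult_ac)

text \<open>In each band \<open>\<bar>k - i\<bar> \<le> c\<close> the kernels depend on \<open>k - i\<close> only (for \<open>k \<ge> 1\<close>), so there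
  are finitely many of them.\<close>

lemma resolution_kernel_bound:
  fixes \<eta>0 \<eta> :: "real^'n::finite \<Rightarrow> real"
  assumes rp: "resolution_pair \<eta>0 \<eta>"
    and c: "\<forall>k i x. resolution \<eta>0 \<eta> k x * \<eta> ((1 / 2 ^ i) *\<^sub>R x) \<noteq> 0 \<longrightarrow> i \<le> k + c \<and> k \<le> i + c"
  obtains A where "A \<ge> 0"
    "\<And>k i x. norm (fourier_inv (resolution_kernel \<eta>0 \<eta> k i) x)
      \<le> (if i \<le> k + c \<and> k \<le> i + c then A * decay_weight m x else 0)"
proof -
  define u where "u = resolution_kernel \<eta>0 \<eta>"
  \<comment> \<open>Truncated subtraction gives \<open>i - k\<close> and \<open>k - i\<close>, at
    least one of them 0, so the ratio \<open>2 ^ i / 2 ^ k\<close> becomes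
    \<open>2 ^ a / 2 ^ b\<close> with \<open>a\<close> and \<open>b\<close> at most \<open>c\<close>
    inside the band.\<close>
  define \<beta> where "\<beta> a b = (\<lambda>\<xi>::real^'n. complex_of_real (\<eta> ((2 ^ a / 2 ^ b) *\<^sub>R \<xi>)) * of_real (\<eta> \<xi>))" for a b :: nat
  have \<beta>: "\<beta> a b \<in> schwartz" for a b
    using schwartz_mult[OF schwartz_complex_of_real[OF schwartz_affine[of \<eta> "2 ^ a / 2 ^ b" 0]]
        schwartz_complex_of_real[of \<eta>]] rp
    unfolding \<beta>_def resolution_pair_def by simp
  have u: "u k i \<in> schwartz" for k i
    unfolding u_def by (rule schwartz_resolution_kernel[OF rp])
  \<comment> \<open>Band 0 is listed separately because it involves \<open>\<eta>0\<close>.\<close>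
  define F where "F = fourier_inv ` (case_prod \<beta> ` ({..c} \<times> {..c}) \<union> u 0 ` {..c})"
  have "finite F" "F \<subseteq> schwartz"
    using \<beta> u by (auto simp: F_def intro: schwartz_fourier_inv)
  then obtain A where A: "A \<ge> 0" "\<And>f x. f \<in> F \<Longrightarrow> norm (f x) \<le> A * decay_weight m x"
    using finite_schwartz_bound by meson
  show ?thesis
  proof (rule that[OF A(1)])
    fix k i x
    show "norm (fourier_inv (resolution_kernel \<eta>0 \<eta> k i) x)
      \<le> (if i \<le> k + c \<and> k \<le> i + c then A * decay_weight m x else 0)"
    proof (cases "i \<le> k + c \<and> k \<le> i + c")
      case True
      have "u k i \<in> case_prod \<beta> ` ({..c} \<times> {..c}) \<union> u 0 ` {..c}"
      proof (cases "k = 0")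
        case False
        have eq: "(2::real) ^ i / 2 ^ k = 2 ^ (i - k) / 2 ^ (k - i)"
          by (cases "k \<le> i") (simp_all add: power_diff)
        have "u k i = (\<lambda>\<xi>. complex_of_real (\<eta> ((2 ^ i / 2 ^ k) *\<^sub>R \<xi>)) * of_real (\<eta> \<xi>))"
          using False by (simp add: u_def resolution_kernel_def[abs_def] resolution_def)
        then have "u k i = case_prod \<beta> (i - k, k - i)" unfolding \<beta>_def eq by simp
        moreover have "(i - k, k - i) \<in> {..c} \<times> {..c}" using True by auto
        ultimately show ?thesis by blast
      qed (use True in auto)
      then have "fourier_inv (u k i) \<in> F" unfolding F_def by blast
      with A(2) True show ?thesis by (simp add: u_def)
    next
      case False
      have "resolution \<eta>0 \<eta> k (2 ^ i *\<^sub>R \<xi>) * \<eta> \<xi> = 0" for \<xi>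
        using c[rule_format, of k "2 ^ i *\<^sub>R \<xi>" i] False by auto
      then have "resolution_kernel \<eta>0 \<eta> k i = (\<lambda>\<xi>. 0)"
        by (auto simp: resolution_kernel_def fun_eq_iff)
      then show ?thesis using False by (auto simp: fourier_inv_def)
    qed
  qed
qed

text \<open>Within a band every scale \<open>i\<close> is replaced by \<open>k\<close> at bounded
  cost. A whole band is then dominated by translates at a single scale, and the Morrey estimate is
  applied once per \<open>k\<close> without any triangle inequality for the quasi-norm.\<close>

lemma decay_weight_band:
  assumes "k \<le> i + c"
  shows "decay_weight m (2 ^ i *\<^sub>R y) \<le> 2 ^ (c * m) * decay_weight m (2 ^ k *\<^sub>R y)"
proof -
  have "(2::real) ^ k \<le> 2 ^ c * 2 ^ i"
    unfolding power_add[symmetric] using assms by (intro power_increasing) auto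
  then have "1 + 2 ^ k * norm y \<le> 2 ^ c * 1 + 2 ^ c * 2 ^ i * norm y"
    by (intro add_mono mult_right_mono) auto
  then have "(1 + 2 ^ k * norm y) ^ m \<le> (2 ^ c * (1 + 2 ^ i * norm y)) ^ m"
    by (intro power_mono) (auto simp: algebra_simps)
  then have "(1 + 2 ^ k * norm y) ^ m \<le> 2 ^ (c * m) * (1 + 2 ^ i * norm y) ^ m"
    by (simp add: power_mult_distrib power_mult)
  moreover have "(1 + 2 ^ j * norm y) ^ m > 0" for j :: nat by (simp add: add_pos_nonneg)
  ultimately show ?thesis by (simp add: decay_weight_def field_simps)
qed

text \<open>2^-k is 2^c times 2^-(k+c), and such an enlargement of the argument costs at most
  \<open>2 powr (real (c * d) / p)\<close> by the second growth condition; since 2^-(k+c) is at most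
  2^-i, monotonicity does the rest.\<close>

lemma growth_class_band:
  assumes \<phi>: "\<phi> \<in> growth_class d p" and p: "p > 0" and le: "i \<le> k + c"
  shows "\<phi> (2 powr (- real k)) \<le> 2 powr (real (c * d) / p) * \<phi> (2 powr (- real i))"
proof -
  let ?t = "2 powr (- real k)" and ?s = "2 powr (- real (k + c))"
  have t: "?t = 2 powr real c * ?s" by (simp flip: powr_add)
  have "\<phi> ?t powr p * ?s ^ d \<le> \<phi> ?s powr p * ?t ^ d"
    by (rule growth_class_antimono[OF \<phi> p]) auto
  also have "\<dots> = (2 powr real (c * d) * \<phi> ?s powr p) * ?s ^ d"
    unfolding t power_mult_distrib by (simp add: powr_power mult_ac)
  finally have "\<phi> ?t powr p \<le> 2 powr real (c * d) * \<phi> ?s powr p" by simp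
  then have "(\<phi> ?t powr p) powr (1 / p) \<le> (2 powr real (c * d) * \<phi> ?s powr p) powr (1 / p)"
    using p by (intro powr_mono2) auto
  then have "\<phi> ?t \<le> 2 powr (real (c * d) / p) * \<phi> ?s"
    using p growth_class_pos[OF \<phi>, of ?t] growth_class_pos[OF \<phi>, of ?s]
    by (simp add: powr_mult powr_powr)
  also have "\<dots> \<le> 2 powr (real (c * d) / p) * \<phi> (2 powr (- real i))"
    using le by (intro mult_left_mono growth_class_mono[OF \<phi>]) auto
  finally show ?thesis .
qed

definition sparse_sum ::
  "(real^'n::finite \<Rightarrow> complex) \<Rightarrow> real^'n \<Rightarrow> real \<Rightarrow> nat \<Rightarrow> nat \<Rightarrow> (nat \<Rightarrow> real) \<Rightarrow> real^'n \<Rightarrow> complex" where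
  "sparse_sum \<psi> e R N K c x =
    (\<Sum>i\<le>K. of_real (c i) * (\<Sum>n<N. \<psi> (2 ^ i *\<^sub>R (x - (real n * R) *\<^sub>R e))))"

text \<open>In band \<open>k\<close> the Morrey norm contributes \<phi>(2^-k), and 2^(ks)
  \<phi>(2^-k) cancels the factor of scale \<open>i\<close> up to a constant as long as |k - i|
  \<le> c; a banded sum of \<open>v\<close> remains. Only the spacing depends on \<open>K\<close>
  and \<open>N\<close>, the constant does not.\<close>

lemma besov_morrey_norm_sparse_sum:
  fixes \<eta>0 \<eta> :: "real^'n::finite \<Rightarrow> real" and \<phi> :: "real \<Rightarrow> real" and e :: "real^'n"
  assumes rp: "resolution_pair \<eta>0 \<eta>" and p: "0 < p" and q: "0 < q"
    and \<phi>: "\<phi> \<in> growth_class CARD('n) p"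
    and lim: "((\<lambda>t. \<phi> t * t powr (- (real CARD('n) / p))) \<longlongrightarrow> 0) at_top"
    and e: "norm e = 1"
  obtains C where "C > 0"
    "\<And>K N. \<exists>R0. \<forall>R\<ge>R0. \<forall>v. lq_unit q K v \<longrightarrow> (\<forall>\<tau>\<ge>0.
      besov_morrey_norm \<eta>0 \<eta> s \<phi> p q (schwartz_dist (sparse_sum (fourier_inv (\<lambda>\<xi>. of_real (\<eta> \<xi>))) e R N K
        (\<lambda>i. \<tau> * v i * (2 powr (- real i * s) * inverse (\<phi> (2 powr (- real i))))))) \<le> ennreal (C * \<tau>))"
proof -
  \<comment> \<open>However small \<open>p\<close> is, the weight gets enough decay for its p-th
    power to be integrable.\<close>
  obtain m :: nat where "real (2 * CARD('n)) / p \<le> real m" using real_arch_simple by blast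
  then have m: "real (2 * CARD('n)) \<le> real m * p" "m \<ge> 1"
    using p by (auto simp: field_simps intro!: Suc_leI gr0I)
  obtain c where c: "\<forall>k i x. resolution \<eta>0 \<eta> k x * \<eta> ((1 / 2 ^ i) *\<^sub>R x) \<noteq> 0 \<longrightarrow> i \<le> k + c \<and> k \<le> i + c"
    using resolution_pair_bands[OF rp] by blast
  obtain A where A: "A \<ge> 0" "\<And>k i x. norm (fourier_inv (resolution_kernel \<eta>0 \<eta> k i) x)
      \<le> (if i \<le> k + c \<and> k \<le> i + c then A * decay_weight m x else 0)"
    using resolution_kernel_bound[OF rp c, of m] by blast
  obtain C1 where C1: "C1 > 0"
    "\<And>K N. \<exists>R0. \<forall>R\<ge>R0. \<forall>i\<le>K. \<forall>A\<ge>0. \<forall>h :: real^'n \<Rightarrow> complex.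
      (\<forall>x. norm (h x) \<le> A * (\<Sum>n<N. decay_weight m (2 ^ i *\<^sub>R (x - (real n * R) *\<^sub>R e)))) \<longrightarrow>
      morrey_norm \<phi> p h \<le> ennreal (C1 * A * \<phi> (2 powr (- real i)))"
    using morrey_norm_sparse_sum[OF \<phi> p lim m e] by blast
  obtain C2 where C2: "C2 > 0"
    "\<And>K v D a. lq_unit q K v \<Longrightarrow> D \<ge> 0 \<Longrightarrow>
      (\<And>k. a k \<le> ennreal (D * (\<Sum>i | i \<le> K \<and> i \<le> k + c \<and> k \<le> i + c. v i))) \<Longrightarrow>
      lq_norm q a \<le> ennreal (C2 * D)"
    using lq_norm_banded[OF q, of c] by blast
  have \<eta>0: "\<eta>0 \<in> schwartz" "\<And>x. \<eta>0 x \<ge> 0" "compact (supp \<eta>0)" "\<eta>0 0 > 0" and \<eta>: "\<eta> \<in> schwartz"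
    using rp by (auto simp: resolution_pair_def centred_cube_def)
  have \<eta>0_int: "(\<integral>x. \<eta>0 x \<partial>lborel) > 0"
    by (rule integral_pos_of_continuous[OF schwartz_integrable[OF \<eta>0(1)] schwartz_continuous[OF \<eta>0(1)] \<eta>0(2,4)])
  \<comment> \<open>\<open>\<eta>0\<close>, normalised at the origin, acts as the regulariser for
    Fourier inversion.\<close>
  have \<theta>: "(\<lambda>x. complex_of_real (inverse (\<eta>0 0)) * of_real (\<eta>0 x)) \<in> schwartz"
    by (intro schwartz_cmult schwartz_complex_of_real \<eta>0)
  obtain c0 where c0: "\<And>h (x::real^'n). h \<in> schwartz \<Longrightarrow> fourier_inv (fourier h) x = c0 * h x"
    using fourier_inversion_upto_const[OF \<theta>] \<eta>0(4) by auto
  define \<psi> where "\<psi> = fourier_inv (\<lambda>\<xi>. complex_of_real (\<eta> \<xi>))"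
  define b where "b i = 2 powr (- real i * s) * inverse (\<phi> (2 powr (- real i)))" for i
  have \<phi>pos: "\<phi> (2 powr t) > 0" for t by (rule growth_class_pos[OF \<phi>]) simp
  have b: "b i > 0" for i using \<phi>pos by (simp add: b_def)
  \<comment> \<open>Collects the Morrey constant, the inversion constant, the kernel bound, the loss
    in passing to scale \<open>k\<close>, and the comparison of both weights across a band. Adding 1
    keeps it positive even if \<open>A = 0\<close>.\<close>
  define D0 where "D0 = 1 + C1 * (norm c0 * A * 2 ^ (c * m)) * (2 powr (real c * \<bar>s\<bar>) * 2 powr (real (c * CARD('n)) / p))"
  have D0: "D0 > 0" using C1(1) A(1) by (simp add: D0_def add_pos_nonneg)
  show ?thesis
  proof (rule that[of "C2 * D0"])
    show "C2 * D0 > 0" using C2(1) D0 by simp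
    fix K N :: nat
    \<comment> \<open>Scales up to \<open>K\<close> reach bands up to \<open>K + c\<close>, and each
      band is estimated at its own scale \<open>k\<close>.\<close>
    obtain R0 where R0: "\<And>R i B h. R0 \<le> R \<Longrightarrow> i \<le> K + c \<Longrightarrow> 0 \<le> B \<Longrightarrow>
      (\<And>x. norm (h x) \<le> B * (\<Sum>n<N. decay_weight m (2 ^ i *\<^sub>R (x - (real n * R) *\<^sub>R e)))) \<Longrightarrow>
      morrey_norm \<phi> p h \<le> ennreal (C1 * B * \<phi> (2 powr (- real i)))"
      using C1(2)[of "K + c" N] by blast
    show "\<exists>R0. \<forall>R\<ge>R0. \<forall>v. lq_unit q K v \<longrightarrow> (\<forall>\<tau>\<ge>0.
      besov_morrey_norm \<eta>0 \<eta> s \<phi> p q (schwartz_dist (sparse_sum (fourier_inv (\<lambda>\<xi>. of_real (\<eta> \<xi>))) e R N K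
        (\<lambda>i. \<tau> * v i * (2 powr (- real i * s) * inverse (\<phi> (2 powr (- real i)))))))
      \<le> ennreal (C2 * D0 * \<tau>))"
    proof (intro exI[of _ R0] allI impI)
      fix R \<tau> :: real and v assume R: "R0 \<le> R" and unit: "lq_unit q K v" and \<tau>: "0 \<le> \<tau>"
      define X where "X n = (real n * R) *\<^sub>R e" for n
      define \<gamma> where "\<gamma> i = \<tau> * v i * b i" for i
      have v: "v i \<ge> 0" for i using unit by (simp add: lq_unit_def)
      have \<gamma>: "\<gamma> i \<ge> 0" for i using v \<tau> b[of i] by (simp add: \<gamma>_def)
      \<comment> \<open>The test function is prescribed through its spectrum, so that the resolution
        acts on each scale separately.\<close>
      define G where "G \<xi> = (\<Sum>i\<le>K. of_real (\<gamma> i) * (\<Sum>n<N. dilate i (X n) (\<lambda>\<xi>. of_real (\<eta> \<xi>)) \<xi>))" for \<xi>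
      have \<eta>c: "(\<lambda>\<xi>. complex_of_real (\<eta> \<xi>)) \<in> schwartz" by (rule schwartz_complex_of_real[OF \<eta>])
      have inv: "fourier_inv (\<lambda>\<xi>. \<Sum>i\<le>K. of_real (\<gamma> i) * (\<Sum>n<N. dilate i (X n) (w i) \<xi>)) x
          = (\<Sum>i\<le>K. of_real (\<gamma> i) * (\<Sum>n<N. fourier_inv (w i) (2 ^ i *\<^sub>R (x - X n))))"
        if w: "\<And>i. w i \<in> schwartz" for w x
      proof -
        have "fourier_inv (\<lambda>\<xi>. \<Sum>i\<le>K. of_real (\<gamma> i) * (\<Sum>n<N. dilate i (X n) (w i) \<xi>)) x
          = (\<Sum>i\<le>K. fourier_inv (\<lambda>\<xi>. of_real (\<gamma> i) * (\<Sum>n<N. dilate i (X n) (w i) \<xi>)) x)"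
          by (intro fourier_inv_sum schwartz_cmult schwartz_sum schwartz_dilate w)
        also have "\<dots> = (\<Sum>i\<le>K. of_real (\<gamma> i) * (\<Sum>n<N. fourier_inv (dilate i (X n) (w i)) x))"
          unfolding fourier_inv_cmult
          by (intro sum.cong refl arg_cong[of _ _ "\<lambda>z. _ * z"] fourier_inv_sum schwartz_dilate w)
        finally show ?thesis by (simp add: fourier_inv_dilate[OF w])
      qed
      have G: "G \<in> schwartz"
        unfolding G_def[abs_def] by (intro schwartz_sum schwartz_cmult schwartz_dilate \<eta>c)
      define T where "T = schwartz_dist (fourier_inv G)"
      have T: "T = schwartz_dist (\<lambda>x. \<Sum>i\<le>K. of_real (\<gamma> i) * (\<Sum>n<N. \<psi> (2 ^ i *\<^sub>R (x - X n))))"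
        unfolding T_def G_def[abs_def] \<psi>_def by (intro arg_cong[of _ _ schwartz_dist] ext inv \<eta>c)
      define D where "D k = dist_fourier_inv (dist_mult (\<lambda>\<xi>. of_real (resolution \<eta>0 \<eta> k \<xi>)) (dist_fourier T))" for k
      define F where "F k x = c0 * (\<Sum>i\<le>K. of_real (\<gamma> i) *
          (\<Sum>n<N. fourier_inv (resolution_kernel \<eta>0 \<eta> k i) (2 ^ i *\<^sub>R (x - X n))))" for k x
      have rep: "represents (F k) (D k)" for k
      proof -
        have "of_real (resolution \<eta>0 \<eta> k \<xi>) * G \<xi> =
            (\<Sum>i\<le>K. of_real (\<gamma> i) * (\<Sum>n<N. dilate i (X n) (resolution_kernel \<eta>0 \<eta> k i) \<xi>))" for \<xi>
          unfolding G_def sum_distrib_left resolution_mult_dilate[symmetric]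
          by (simp add: mult.left_commute)
        then have "fourier_inv (\<lambda>\<xi>. of_real (resolution \<eta>0 \<eta> k \<xi>) * G \<xi>) x
          = (\<Sum>i\<le>K. of_real (\<gamma> i) * (\<Sum>n<N. fourier_inv (resolution_kernel \<eta>0 \<eta> k i) (2 ^ i *\<^sub>R (x - X n))))" for x
          using inv[OF schwartz_resolution_kernel[OF rp]] by simp
        then show ?thesis
          using represents_fourier_multiplier[OF c0 G schwartz_complex_of_real[OF schwartz_resolution[OF rp, of k]]]
          unfolding F_def[abs_def] D_def T_def by simp
      qed
      let ?I = "\<lambda>k. {i. i \<le> K \<and> i \<le> k + c \<and> k \<le> i + c}"
      have morrey: "ennreal (2 powr (real k * s)) * dist_morrey_norm \<phi> p (D k) \<le> ennreal (D0 * \<tau> * (\<Sum>i\<in>?I k. v i))" for k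
      proof -
        define B where "B = norm c0 * A * 2 ^ (c * m) * (\<Sum>i\<in>?I k. \<gamma> i)"
        have B: "B \<ge> 0" using A(1) \<gamma> by (simp add: B_def sum_nonneg)
        have Fle: "norm (F k x) \<le> B * (\<Sum>n<N. decay_weight m (2 ^ k *\<^sub>R (x - X n)))" for x
        proof -
          let ?z = "\<lambda>i. of_real (\<gamma> i) * (\<Sum>n<N. fourier_inv (resolution_kernel \<eta>0 \<eta> k i) (2 ^ i *\<^sub>R (x - X n)))"
          let ?y = "\<lambda>i. \<gamma> i * (\<Sum>n<N. A * (2 ^ (c * m) * decay_weight m (2 ^ k *\<^sub>R (x - X n))))"
          have "norm (F k x) = norm c0 * norm (\<Sum>i\<le>K. ?z i)"
            by (simp add: F_def norm_mult)
          also have "\<dots> \<le> norm c0 * (\<Sum>i\<le>K. if i \<in> ?I k then ?y i else 0)"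
          proof (intro mult_left_mono sum_norm_le)
            fix i assume i: "i \<in> {..K}"
            have "norm (?z i) \<le> \<gamma> i * (\<Sum>n<N. if i \<le> k + c \<and> k \<le> i + c then A * decay_weight m (2 ^ i *\<^sub>R (x - X n)) else 0)"
              unfolding norm_mult norm_of_real abs_of_nonneg[OF \<gamma>]
              by (intro mult_left_mono sum_norm_le A \<gamma>)
            also have "\<dots> \<le> (if i \<in> ?I k then ?y i else 0)"
              using i by (auto intro!: mult_left_mono sum_mono decay_weight_band A(1) \<gamma>)
            finally show "norm (?z i) \<le> (if i \<in> ?I k then ?y i else 0)" .
          qed simp
          also have "(\<Sum>i\<le>K. if i \<in> ?I k then ?y i else 0)
            = (\<Sum>i\<in>?I k. ?y i)"
            by (intro sum.mono_neutral_cong_right) auto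
          also have "norm c0 * \<dots> = B * (\<Sum>n<N. decay_weight m (2 ^ k *\<^sub>R (x - X n)))"
            unfolding sum_distrib_left[symmetric] sum_distrib_right[symmetric] B_def by (simp add: mult_ac)
          finally show ?thesis .
        qed
        have le: "2 powr (real k * s) * (C1 * B * \<phi> (2 powr (- real k))) \<le> D0 * \<tau> * (\<Sum>i\<in>?I k. v i)"
        proof -
          let ?E = "2 powr (real c * \<bar>s\<bar>) * 2 powr (real (c * CARD('n)) / p)"
          have "2 powr (real k * s) * \<phi> (2 powr (- real k)) * \<gamma> i \<le> ?E * (\<tau> * v i)" if i: "i \<in> ?I k" for i
          proof -
            have "2 powr (real k * s) * 2 powr (- real i * s) \<le> 2 powr (real c * \<bar>s\<bar>)"
            proof -
              have "real k * s + - real i * s = (real k - real i) * s" by (simp add: algebra_simps)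
              also have "\<dots> \<le> \<bar>real k - real i\<bar> * \<bar>s\<bar>" by (metis abs_ge_self abs_mult)
              also have "\<dots> \<le> real c * \<bar>s\<bar>" using i by (intro mult_right_mono) auto
              finally show ?thesis unfolding powr_add[symmetric] by simp
            qed
            moreover have "\<phi> (2 powr (- real k)) * inverse (\<phi> (2 powr (- real i))) \<le> 2 powr (real (c * CARD('n)) / p)"
              using growth_class_band[OF \<phi> p, of i k c] i \<phi>pos[of "- real i"] by (simp add: field_simps)
            ultimately have "(2 powr (real k * s) * 2 powr (- real i * s)) *
                (\<phi> (2 powr (- real k)) * inverse (\<phi> (2 powr (- real i)))) \<le> ?E"
              using \<phi>pos[of "- real k"] \<phi>pos[of "- real i"] by (intro mult_mono) auto
            from mult_right_mono[OF this, of "\<tau> * v i"] show ?thesis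
              using \<tau> v[of i] by (simp add: \<gamma>_def b_def mult_ac)
          qed
          then have "(\<Sum>i\<in>?I k. 2 powr (real k * s) * \<phi> (2 powr (- real k)) * \<gamma> i) \<le> (\<Sum>i\<in>?I k. ?E * (\<tau> * v i))"
            by (intro sum_mono)
          then have le: "2 powr (real k * s) * \<phi> (2 powr (- real k)) * (\<Sum>i\<in>?I k. \<gamma> i) \<le> ?E * (\<tau> * (\<Sum>i\<in>?I k. v i))"
            by (simp add: sum_distrib_left)
          have "2 powr (real k * s) * (C1 * B * \<phi> (2 powr (- real k)))
              = C1 * (norm c0 * A * 2 ^ (c * m)) * (2 powr (real k * s) * \<phi> (2 powr (- real k)) * (\<Sum>i\<in>?I k. \<gamma> i))"
            by (simp add: B_def mult_ac)
          also have "\<dots> \<le> C1 * (norm c0 * A * 2 ^ (c * m)) * (?E * (\<tau> * (\<Sum>i\<in>?I k. v i)))"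
            using C1(1) A(1) by (intro mult_left_mono le) auto
          also have "\<dots> \<le> D0 * (\<tau> * (\<Sum>i\<in>?I k. v i))"
            unfolding mult.assoc[symmetric, of _ ?E] D0_def using \<tau> v
            by (intro mult_right_mono) (auto simp: mult.assoc sum_nonneg)
          finally show ?thesis by (simp add: mult.assoc)
        qed
        have M: "morrey_norm \<phi> p (F k) \<le> ennreal (C1 * B * \<phi> (2 powr (- real k)))"
        proof (cases "k \<le> K + c")
          case True
          then show ?thesis using R0[OF R True B] Fle by (simp add: X_def)
        next
          case False
          \<comment> \<open>No scale meets such a band, so \<open>F k\<close> is bounded by 0, and
            any admissible index, here 0, yields the estimate.\<close>
          then have I: "?I k = {}" by auto
          have "B = 0" unfolding B_def I by simp
          then show ?thesis using R0[OF R, of 0 0 "F k"] Fle by simp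
        qed
        have eq: "dist_morrey_norm \<phi> p (D k) = morrey_norm \<phi> p (F k)"
          by (rule dist_morrey_norm_eq[OF rep \<eta>0(1,2) \<eta>0_int \<eta>0(3)])
        have "ennreal (2 powr (real k * s)) * dist_morrey_norm \<phi> p (D k)
            \<le> ennreal (2 powr (real k * s)) * ennreal (C1 * B * \<phi> (2 powr (- real k)))"
          unfolding eq by (intro mult_left_mono M) simp
        also have "\<dots> = ennreal (2 powr (real k * s) * (C1 * B * \<phi> (2 powr (- real k))))"
          by (rule ennreal_mult'[symmetric]) simp
        also have "\<dots> \<le> ennreal (D0 * \<tau> * (\<Sum>i\<in>?I k. v i))" by (rule ennreal_leI[OF le])
        finally show ?thesis .
      qed
      have "besov_morrey_norm \<eta>0 \<eta> s \<phi> p q T \<le> ennreal (C2 * (D0 * \<tau>))"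
        unfolding besov_morrey_norm_def D_def[symmetric]
        using D0 \<tau> morrey by (intro C2(2)[OF unit]) auto
      then show "besov_morrey_norm \<eta>0 \<eta> s \<phi> p q (schwartz_dist (sparse_sum (fourier_inv (\<lambda>\<xi>. of_real (\<eta> \<xi>))) e R N K
        (\<lambda>i. \<tau> * v i * (2 powr (- real i * s) * inverse (\<phi> (2 powr (- real i)))))))
        \<le> ennreal (C2 * D0 * \<tau>)"
        unfolding T \<gamma>_def b_def \<psi>_def X_def sparse_sum_def[abs_def] by (simp add: mult.assoc)
    qed
  qed
qed

text \<open>Near a centre the dilated points of all scales up to \<open>K\<close> stay where the
  real part of \<psi> is bounded below, and nonnegative coefficients exclude cancellation between
  scales. The other copies enter through their tails, which spacing alone makes small; hence the
  radius depends on \<open>K\<close> but not on \<open>N\<close>.\<close>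

lemma sparse_sum_lower_bound:
  fixes \<psi> :: "real^'n::finite \<Rightarrow> complex" and e :: "real^'n"
  assumes \<psi>: "\<psi> \<in> schwartz" "Re (\<psi> 0) > 0" and e: "norm e = 1"
  obtains a \<rho> where "a > 0" "\<rho> > 0" "\<rho> \<le> 1"
    "\<And>K N. \<exists>R0. \<forall>R\<ge>R0. \<forall>c. (\<forall>i. c i \<ge> 0) \<longrightarrow> (\<forall>n<N. \<forall>x\<in>ball ((real n * R) *\<^sub>R e) (\<rho> / 2 ^ K).
      a * (\<Sum>i\<le>K. c i) \<le> norm (sparse_sum \<psi> e R N K c x))"
proof -
  \<comment> \<open>Of the value \<open>4 * a\<close> at the origin, continuity may take
    \<open>2 * a\<close> and the tails of the other copies another \<open>a\<close>.\<close>
  define a where "a = Re (\<psi> 0) / 4"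
  have a: "a > 0" using \<psi>(2) by (simp add: a_def)
  have "isCont \<psi> 0"
    using differentiable_imp_continuous_within[OF schwartz_differentiable[OF \<psi>(1), of 0]] .
  then obtain d where d: "d > 0" "\<And>y. dist y 0 < d \<Longrightarrow> dist (\<psi> y) (\<psi> 0) < 2 * a"
    unfolding continuous_at_eps_delta using a by (metis mult_pos_pos zero_less_numeral)
  define \<rho> where "\<rho> = min d 1"
  have \<rho>: "\<rho> > 0" "\<rho> \<le> 1" using d(1) by (auto simp: \<rho>_def)
  have near: "Re (\<psi> y) \<ge> 2 * a" if "norm y < \<rho>" for y
  proof -
    have "norm (\<psi> y - \<psi> 0) < 2 * a" using d(2)[of y] that by (simp add: \<rho>_def dist_norm)
    moreover have "\<bar>Re (\<psi> y - \<psi> 0)\<bar> \<le> norm (\<psi> y - \<psi> 0)" by (rule abs_Re_le_cmod)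
    ultimately show ?thesis by (simp add: a_def)
  qed
  obtain A where A: "A \<ge> 0" "\<And>x. norm (\<psi> x) \<le> A * decay_weight 1 x"
    using finite_schwartz_bound[of "{\<psi>}" 1] \<psi>(1) by auto
  show ?thesis
  proof (rule that[OF a \<rho>])
    fix K N :: nat
    \<comment> \<open>With \<open>R \<ge> 2\<close> a point within 1 of its own centre is at least
      \<open>R / 2\<close> away from all others; the second entry makes \<open>N\<close> tails of
      size \<open>A * (2 / R)\<close> add up to at most \<open>a\<close>.\<close>
    define R0 where "R0 = max 2 (2 * real N * A / a)"
    show "\<exists>R0. \<forall>R\<ge>R0. \<forall>c. (\<forall>i. c i \<ge> 0) \<longrightarrow> (\<forall>n<N. \<forall>x\<in>ball ((real n * R) *\<^sub>R e) (\<rho> / 2 ^ K).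
      a * (\<Sum>i\<le>K. c i) \<le> norm (sparse_sum \<psi> e R N K c x))"
    proof (intro exI[of _ R0] allI impI ballI)
      fix R :: real and c :: "nat \<Rightarrow> real" and n :: nat and x
      assume R0: "R0 \<le> R" and c: "\<forall>i. 0 \<le> c i" and n: "n < N" and x: "x \<in> ball ((real n * R) *\<^sub>R e) (\<rho> / 2 ^ K)"
      define X where "X n = (real n * R) *\<^sub>R e" for n
      have R: "R \<ge> 2" "real N * (A * (2 / R)) \<le> a"
        using R0 a by (auto simp: R0_def field_simps)
      have x': "norm (x - X n) < \<rho> / 2 ^ K" using x by (simp add: X_def dist_norm norm_minus_commute)
      also have "\<dots> \<le> 1 / 1" using \<rho> by (intro frac_le) auto
      finally have x1: "norm (x - X n) < 1" by simp
      have low: "a \<le> Re (\<Sum>n<N. \<psi> (2 ^ i *\<^sub>R (x - X n)))" if i: "i \<le> K" for i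
      proof -
        have "norm (2 ^ i *\<^sub>R (x - X n)) \<le> 2 ^ K * norm (x - X n)"
          using i by (simp add: mult_right_mono power_increasing)
        also have "\<dots> < \<rho>" using x' by (simp add: field_simps)
        finally have main: "2 * a \<le> Re (\<psi> (2 ^ i *\<^sub>R (x - X n)))" by (rule near)
        have far: "- (A * (2 / R)) \<le> Re (\<psi> (2 ^ i *\<^sub>R (x - X n')))" if "n' \<noteq> n" for n'
        proof -
          have "R * 1 \<le> R * \<bar>real n - real n'\<bar>"
            using that R(1) by (intro mult_left_mono) auto
          also have "\<dots> = norm (X n - X n')"
            using R(1) by (simp add: X_def e abs_mult flip: scaleR_diff_left left_diff_distrib)
          also have "\<dots> = norm ((x - X n') - (x - X n))" by simp
          also have "\<dots> \<le> norm (x - X n') + norm (x - X n)" by (rule norm_triangle_ineq4)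
          finally have "R / 2 \<le> norm (x - X n')" using x1 R(1) by simp
          then have "decay_weight 1 (2 ^ i *\<^sub>R (x - X n')) \<le> 1 / (R / 2)"
            using R(1) by (intro decay_weight_scale_le) auto
          then have "A * decay_weight 1 (2 ^ i *\<^sub>R (x - X n')) \<le> A * (2 / R)"
            using A(1) by (intro mult_left_mono) auto
          with A(2)[of "2 ^ i *\<^sub>R (x - X n')"] abs_Re_le_cmod[of "\<psi> (2 ^ i *\<^sub>R (x - X n'))"]
          show ?thesis by linarith
        qed
        have "(\<Sum>n'<N. (if n' = n then 2 * a else 0) + - (A * (2 / R))) \<le> (\<Sum>n'<N. Re (\<psi> (2 ^ i *\<^sub>R (x - X n'))))"
        proof (rule sum_mono)
          fix n'
          have "0 \<le> A * (2 / R)" using A(1) R(1) by simp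
          then show "(if n' = n then 2 * a else 0) + - (A * (2 / R)) \<le> Re (\<psi> (2 ^ i *\<^sub>R (x - X n')))"
            using main far[of n'] by (cases "n' = n") auto
        qed
        moreover have "(\<Sum>n'<N. (if n' = n then 2 * a else 0) + - (A * (2 / R))) = 2 * a - real N * (A * (2 / R))"
          using n by (simp add: sum.distrib sum_subtractf)
        ultimately show ?thesis using R(2) by simp
      qed
      have "a * (\<Sum>i\<le>K. c i) \<le> (\<Sum>i\<le>K. c i * Re (\<Sum>n<N. \<psi> (2 ^ i *\<^sub>R (x - X n))))"
        unfolding sum_distrib_left
      proof (rule sum_mono)
        fix i assume "i \<in> {..K}"
        with mult_left_mono[OF low[of i], of "c i"] c
        show "a * c i \<le> c i * Re (\<Sum>n<N. \<psi> (2 ^ i *\<^sub>R (x - X n)))" by (simp add: mult.commute)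
      qed
      also have "\<dots> = Re (\<Sum>i\<le>K. of_real (c i) * (\<Sum>n<N. \<psi> (2 ^ i *\<^sub>R (x - X n))))"
        by simp
      also have "\<dots> \<le> norm (\<Sum>i\<le>K. of_real (c i) * (\<Sum>n<N. \<psi> (2 ^ i *\<^sub>R (x - X n))))"
        by (rule complex_Re_le_cmod)
      finally show "a * (\<Sum>i\<le>K. c i) \<le> norm (sparse_sum \<psi> e R N K c x)"
        by (simp add: X_def sparse_sum_def)
    qed
  qed
qed

lemma emeasure_union_balls:
  fixes e :: "real^'n::finite"
  assumes R: "R \<ge> 2" and r: "0 < r" "r \<le> 1" and e: "norm e = 1"
  shows "emeasure lebesgue (\<Union>n<N. ball ((real n * R) *\<^sub>R e) r)
    = ennreal (real N * (unit_ball_vol CARD('n) * r ^ CARD('n)))"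
proof -
  have "disjoint_family_on (\<lambda>n. ball ((real n * R) *\<^sub>R e) r) {..<N}"
    unfolding disjoint_family_on_def
  proof (intro ballI impI)
    fix n n' assume "n \<noteq> (n'::nat)"
    have "R * 1 \<le> R * \<bar>real n - real n'\<bar>"
      using \<open>n \<noteq> n'\<close> R by (intro mult_left_mono) auto
    also have "\<dots> = dist ((real n * R) *\<^sub>R e) ((real n' * R) *\<^sub>R e)"
      using R by (simp add: dist_norm e abs_mult flip: scaleR_diff_left left_diff_distrib)
    finally have "r + r \<le> dist ((real n * R) *\<^sub>R e) ((real n' * R) *\<^sub>R e)" using R r by simp
    then show "ball ((real n * R) *\<^sub>R e) r \<inter> ball ((real n' * R) *\<^sub>R e) r = {}"
      by (rule disjoint_ballI)
  qed
  then have "emeasure lborel (\<Union>n<N. ball ((real n * R) *\<^sub>R e) r) = (\<Sum>n<N. emeasure lborel (ball ((real n * R) *\<^sub>R e) r))"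
    by (intro sum_emeasure[symmetric]) auto
  also have "\<dots> = ennreal (real N * (unit_ball_vol CARD('n) * r ^ CARD('n)))"
    using r by (simp add: emeasure_ball ennreal_mult ennreal_of_nat_eq_real_of_nat)
  finally show ?thesis by simp
qed

section \<open>Choice of the parameters for a given height and measure\<close>

theorem proposition3p12:
  fixes \<eta>0 \<eta> :: "real^'n::finite \<Rightarrow> real"
    and \<phi> :: "real \<Rightarrow> real" and p s :: real and q :: ennreal
  assumes "resolution_pair \<eta>0 \<eta>"
    and "0 < p" and "0 < q"
    and "\<phi> \<in> growth_class CARD('n) p" and "\<phi> 1 = 1"
    and "\<forall>T\<in>besov_morrey_space \<eta>0 \<eta> s \<phi> p q. regular T"
    and "(\<lambda>j::nat. 2 powr (- real j * s) * inverse (\<phi> (2 powr (- real j))))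
           \<notin> lq_space (conj_exponent q)"
    and "((\<lambda>t. \<phi> t * t powr (- (real CARD('n) / p))) \<longlongrightarrow> 0) at_top"
  shows "\<forall>t>0. growth_envelope (besov_morrey_space \<eta>0 \<eta> s \<phi> p q)
           (besov_morrey_norm \<eta>0 \<eta> s \<phi> p q) t = \<infinity>"
proof (intro allI impI)
  fix t :: real assume t: "t > 0"
  define i0 :: 'n where "i0 = undefined"
  define e :: "real^'n" where "e = axis i0 1"
  have e: "norm e = 1" by (simp add: e_def)
  let ?b = "\<lambda>j::nat. 2 powr (- real j * s) * inverse (\<phi> (2 powr (- real j)))"
  let ?X = "besov_morrey_space \<eta>0 \<eta> s \<phi> p q" and ?nrm = "besov_morrey_norm \<eta>0 \<eta> s \<phi> p q"
  have b: "?b j > 0" for j using growth_class_pos[OF assms(4), of "2 powr (- real j)"] by simp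
  have \<eta>0: "\<eta>0 \<in> schwartz" "\<And>x. \<eta>0 x \<ge> 0" "compact (supp \<eta>0)" "\<eta>0 0 > 0"
    and \<eta>: "\<eta> \<in> schwartz" "\<And>x. \<eta> x \<ge> 0"
    using assms(1) by (auto simp: resolution_pair_def centred_cube_def)
  have \<eta>0_int: "(\<integral>x. \<eta>0 x \<partial>lborel) > 0"
    by (rule integral_pos_of_continuous[OF schwartz_integrable[OF \<eta>0(1)] schwartz_continuous[OF \<eta>0(1)] \<eta>0(2,4)])
  \<comment> \<open>The vector with all coordinates 1 is a point where \<open>\<eta>\<close> is
    positive; this gives \<open>\<eta>\<close> a positive integral and \<open>\<psi>\<close> a
    positive value at the origin.\<close>
  have "(1::real^'n) \<in> centred_cube 2 - centred_cube 1" by (simp add: centred_cube_def)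
  then have "\<eta> 1 > 0" using assms(1) unfolding resolution_pair_def by blast
  then have \<eta>_int: "(\<integral>x. \<eta> x \<partial>lborel) > 0"
    by (rule integral_pos_of_continuous[OF schwartz_integrable[OF \<eta>(1)] schwartz_continuous[OF \<eta>(1)] \<eta>(2)])
  define \<psi> where "\<psi> = fourier_inv (\<lambda>\<xi>. complex_of_real (\<eta> \<xi>))"
  have \<eta>c: "(\<lambda>\<xi>. complex_of_real (\<eta> \<xi>)) \<in> schwartz" by (rule schwartz_complex_of_real[OF \<eta>(1)])
  have \<psi>: "\<psi> \<in> schwartz" unfolding \<psi>_def by (rule schwartz_fourier_inv[OF \<eta>c])
  have "\<psi> 0 = of_real ((2 * pi) powr (- (real CARD('n) / 2)) * (\<integral>x. \<eta> x \<partial>lborel))"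
    unfolding \<psi>_def fourier_inv_eq_lborel[OF schwartz_measurable[OF \<eta>c]] by simp
  then have \<psi>0: "Re (\<psi> 0) > 0" using \<eta>_int by simp
  obtain a \<rho> where a: "a > 0" and \<rho>: "\<rho> > 0" "\<rho> \<le> 1" and lower:
    "\<And>K N. \<exists>R0. \<forall>R\<ge>R0. \<forall>c. (\<forall>i. c i \<ge> 0) \<longrightarrow> (\<forall>n<N. \<forall>x\<in>ball ((real n * R) *\<^sub>R e) (\<rho> / 2 ^ K).
      a * (\<Sum>i\<le>K. c i) \<le> norm (sparse_sum \<psi> e R N K c x))"
    using sparse_sum_lower_bound[OF \<psi> \<psi>0 e] by blast
  obtain C where C: "C > 0" and upper:
    "\<And>K N. \<exists>R0. \<forall>R\<ge>R0. \<forall>v. lq_unit q K v \<longrightarrow> (\<forall>\<tau>\<ge>0.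
      ?nrm (schwartz_dist (sparse_sum \<psi> e R N K (\<lambda>i. \<tau> * v i * ?b i))) \<le> ennreal (C * \<tau>))"
    using besov_morrey_norm_sparse_sum[OF assms(1-4,8) e, of s] unfolding \<psi>_def by blast
  define \<tau> where "\<tau> = 1 / C"
  have \<tau>: "\<tau> > 0" using C by (simp add: \<tau>_def)
  have large: "ennreal Y \<le> growth_envelope ?X ?nrm t" for Y :: real
  proof -
    \<comment> \<open>The target compensates the factor \<open>a\<close> of the lower bound and the
      normalisation \<open>\<tau>\<close>. From here \<open>K\<close> fixes the radius, the radius
      and \<open>t\<close> fix \<open>N\<close>, and \<open>R\<close> is chosen last.\<close>
    obtain K v where unit: "lq_unit q K v" and M: "Y / (a * \<tau>) \<le> (\<Sum>i\<le>K. v i * ?b i)"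
      using lq_duality[OF assms(3) b assms(7)] by blast
    define r where "r = \<rho> / 2 ^ K"
    have "r \<le> 1 / 1" unfolding r_def using \<rho> by (intro frac_le) auto
    then have r: "0 < r" "r \<le> 1" using \<rho> by (auto simp: r_def)
    define V where "V = unit_ball_vol (real CARD('n)) * r ^ CARD('n)"
    have V: "V > 0" using r by (simp add: V_def)
    obtain N :: nat where "t / V < real N" using reals_Archimedean2 by blast
    with V have N: "t < real N * V" by (simp add: field_simps)
    obtain R1 where R1: "\<And>R v. R \<ge> R1 \<Longrightarrow> lq_unit q K v \<Longrightarrow>
      ?nrm (schwartz_dist (sparse_sum \<psi> e R N K (\<lambda>i. \<tau> * v i * ?b i))) \<le> ennreal (C * \<tau>)"
      using upper[where K=K and N=N] \<tau> by (meson less_imp_le)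
    obtain R2 where R2: "\<And>R c n x. R \<ge> R2 \<Longrightarrow> (\<And>i. c i \<ge> 0) \<Longrightarrow> n < N \<Longrightarrow> x \<in> ball ((real n * R) *\<^sub>R e) r \<Longrightarrow>
      a * (\<Sum>i\<le>K. c i) \<le> norm (sparse_sum \<psi> e R N K c x)"
      using lower[where K=K and N=N] unfolding r_def by meson
    \<comment> \<open>The entry 2 separates the balls, whose radius is at most 1.\<close>
    define R where "R = max 2 (max R1 R2)"
    have R: "R \<ge> 2" "R \<ge> R1" "R \<ge> R2" by (auto simp: R_def)
    define f where "f = sparse_sum \<psi> e R N K (\<lambda>i. \<tau> * v i * ?b i)"
    have "(\<lambda>x. \<psi> (2 ^ i *\<^sub>R (x - y))) \<in> schwartz" for i y
      using schwartz_affine[OF \<psi>, of "2 ^ i" "- (2 ^ i *\<^sub>R y)"] by (simp add: scaleR_diff_right)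
    then have f: "f \<in> schwartz"
      unfolding f_def sparse_sum_def[abs_def] by (intro schwartz_sum schwartz_cmult)
    define T where "T = schwartz_dist f"
    have nrm: "?nrm T \<le> 1"
      using R1[OF R(2) unit] C by (simp add: T_def f_def \<tau>_def)
    then have "?nrm T < \<infinity>" by (rule order_le_less_trans) simp
    then have T: "T \<in> ?X"
      using tempered_schwartz_dist[OF f] by (simp add: besov_morrey_space_def T_def)
    let ?S = "\<Union>n<N. ball ((real n * R) *\<^sub>R e) r"
    have "ennreal Y \<le> rearrangement (regular_fun T) t"
    proof (rule rearrangement_regular_fun_ge[OF _ _ \<eta>0(1,2) \<eta>0_int \<eta>0(3), of f])
      show "represents f T" unfolding T_def by (rule represents_schwartz_dist[OF f])
      show "f \<in> borel_measurable lebesgue"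
        using schwartz_measurable[OF f] by (intro measurable_completion) simp
      show "?S \<in> sets lebesgue" by (intro sets.finite_UN) auto
      show "ennreal t < emeasure lebesgue ?S"
        using N t V by (simp add: emeasure_union_balls[OF R(1) r e] ennreal_less_iff flip: V_def)
      show "Y \<le> norm (f x)" if "x \<in> ?S" for x
      proof -
        have "Y = a * (\<tau> * (Y / (a * \<tau>)))" using a \<tau> by simp
        also have "\<dots> \<le> a * (\<tau> * (\<Sum>i\<le>K. v i * ?b i))"
          using a \<tau> by (intro mult_left_mono M) auto
        also have "\<dots> = a * (\<Sum>i\<le>K. \<tau> * v i * ?b i)" by (simp add: sum_distrib_left mult.assoc)
        also have "\<dots> \<le> norm (f x)"
        proof -
          from that obtain n where n: "n < N" "x \<in> ball ((real n * R) *\<^sub>R e) r" by blast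
          have "\<tau> * v i * ?b i \<ge> 0" for i
            using \<tau> b[of i] unit by (simp add: lq_unit_def)
          from R2[OF R(3) this n] show ?thesis unfolding f_def .
        qed
        finally show ?thesis .
      qed
    qed
    also have "\<dots> \<le> growth_envelope ?X ?nrm t"
      unfolding growth_envelope_def using T nrm by (intro SUP_upper) auto
    finally show ?thesis .
  qed
  show "growth_envelope ?X ?nrm t = \<infinity>"
  proof (cases "growth_envelope ?X ?nrm t")
    case (real g)
    with large[of "g + 1"] show ?thesis by (simp add: ennreal_le_iff)
  qed simp
qed

end
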